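(* Let $R$ be a commutative ring and let $\mathcal{W}$ be a full additive subcategory, closed under isomorphisms, of the category of $R$-modules. Assume $\operatorname{Ext}^i_R(W,W')=0$ for all $W,W'\in\mathcal{W}$ and all $i\geq 1$. Then the Gorenstein subcategory $\mathcal{G}(\mathcal{W})$ is exact (i.e., closed under direct summands and extensions). Moreover, if $\mathcal{W}$ is closed under kernels of epimorphisms, then so is $\mathcal{G}(\mathcal{W})$; and if $\mathcal{W}$ is closed under cokernels of monomorphisms, then so is $\mathcal{G}(\mathcal{W})$.
   Context: An exact complex $X=\cdots\to X_1\xrightarrow{\partial^X_1}X_0\xrightarrow{\partial^X_0}X_{-1}\to\cdots$ of modules in $\mathcal{W}$ (unbounded in both directions) is totally $\mathcal{W}$-acyclic if $\operatorname{Hom}_R(W,X)$ and $\operatorname{Hom}_R(X,W)$ are exact for every $W\in\mathcal{W}$. $\mathcal{G}(\mathcal{W})$ is the full subcategory of $R$-modules $M$ with $M\cong\operatorname{Coker}(\partial^X_1)$ for some totally $\mathcal{W}$-acyclic complex $X$. A subcategory $\mathcal{X}$ is exact if it is closed under direct summands and extensions (if $0\to M'\to M\to M''\to 0$ is exact with $M',M''\in\mathcal{X}$, then $M\in\mathcal{X}$). It is closed under kernels of epimorphisms if the kernel of every surjective homomorphism between modules in $\mathcal{X}$ is in $\mathcal{X}$, and closed under cokernels of monomorphisms if the cokernel of every injective homomorphism between modules in $\mathcal{X}$ is in $\mathcal{X}$. *)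

theory Defs
  imports "HOL-Algebra.Module" "HOL-Algebra.AbelCoset"
begin

section \<open>Modules and their homomorphisms\<close>

text \<open>Modules over a commutative ring are those of \<^locale>\<open>module\<close>.  The fields for
  ring multiplication and unit in the underlying record carry no information for a module;
  they are left \<^const>\<open>undefined\<close> in the constructions below.\<close>

definition mod_hom ::
    "('a, 'm) ring_scheme \<Rightarrow> ('a, 'b) module \<Rightarrow> ('a, 'c) module \<Rightarrow> ('b \<Rightarrow> 'c) set" where
  "mod_hom R M N = {f \<in> hom (add_monoid M) (add_monoid N).
     \<forall>r \<in> carrier R. \<forall>x \<in> carrier M. f (r \<odot>\<^bsub>M\<^esub> x) = r \<odot>\<^bsub>N\<^esub> f x}"

definition mod_iso ::
    "('a, 'm) ring_scheme \<Rightarrow> ('a, 'b) module \<Rightarrow> ('a, 'c) module \<Rightarrow> bool" where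
  "mod_iso R M N \<longleftrightarrow> (\<exists>f \<in> mod_hom R M N. bij_betw f (carrier M) (carrier N))"

definition quot_mod :: "('a, 'b) module \<Rightarrow> 'b set \<Rightarrow> ('a, 'b set) module" where
  "quot_mod M H = \<lparr>carrier = a_rcosets\<^bsub>M\<^esub> H, monoid.mult = undefined, one = undefined,
     zero = H, add = set_add M, smult = (\<lambda>r C. \<Union>x \<in> C. H +>\<^bsub>M\<^esub> (r \<odot>\<^bsub>M\<^esub> x))\<rparr>"

definition dsum_mod :: "('a, 'b) module \<Rightarrow> ('a, 'c) module \<Rightarrow> ('a, 'b \<times> 'c) module" where
  "dsum_mod M N = \<lparr>carrier = carrier M \<times> carrier N, monoid.mult = undefined, one = undefined,
     zero = (\<zero>\<^bsub>M\<^esub>, \<zero>\<^bsub>N\<^esub>),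
     add = (\<lambda>(x, y) (x', y'). (x \<oplus>\<^bsub>M\<^esub> x', y \<oplus>\<^bsub>N\<^esub> y')),
     smult = (\<lambda>r (x, y). (r \<odot>\<^bsub>M\<^esub> x, r \<odot>\<^bsub>N\<^esub> y))\<rparr>"

definition ker_mod :: "('a, 'b) module \<Rightarrow> ('a, 'c) module \<Rightarrow> ('b \<Rightarrow> 'c) \<Rightarrow> ('a, 'b) module" where
  "ker_mod M N f = M\<lparr>carrier := a_kernel M N f\<rparr>"

definition coker_mod :: "('a, 'b) module \<Rightarrow> ('a, 'c) module \<Rightarrow> ('b \<Rightarrow> 'c) \<Rightarrow> ('a, 'c set) module" where
  "coker_mod M N f = quot_mod N (f ` carrier M)"

text \<open>Homomorphisms are total functions on the carrier type, so elements of a Hom module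
  are taken extensional to make equality of maps on the carrier coincide with equality.\<close>

definition Hom_mod ::
    "('a, 'm) ring_scheme \<Rightarrow> ('a, 'b) module \<Rightarrow> ('a, 'c) module \<Rightarrow> ('a, 'b \<Rightarrow> 'c) module" where
  "Hom_mod R M N = \<lparr>carrier = mod_hom R M N \<inter> extensional (carrier M),
     monoid.mult = undefined, one = undefined,
     zero = (\<lambda>x \<in> carrier M. \<zero>\<^bsub>N\<^esub>),
     add = (\<lambda>f g. \<lambda>x \<in> carrier M. f x \<oplus>\<^bsub>N\<^esub> g x),
     smult = (\<lambda>r f. \<lambda>x \<in> carrier M. r \<odot>\<^bsub>N\<^esub> f x)\<rparr>"


section \<open>Unbounded complexes\<close>

text \<open>Homological grading: \<open>Diff X n\<close> maps \<open>Ob X n\<close> to \<open>Ob X (n - 1)\<close>.\<close>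

record ('a, 'b) mod_complex =
  Ob :: "int \<Rightarrow> ('a, 'b) module"
  Diff :: "int \<Rightarrow> 'b \<Rightarrow> 'b"

definition is_complex :: "('a, 'm) ring_scheme \<Rightarrow> ('a, 'b) mod_complex \<Rightarrow> bool" where
  "is_complex R X \<longleftrightarrow> (\<forall>n. module R (Ob X n) \<and> Diff X n \<in> mod_hom R (Ob X n) (Ob X (n - 1)) \<and>
     (\<forall>x \<in> carrier (Ob X (n + 1)). Diff X n (Diff X (n + 1) x) = \<zero>\<^bsub>Ob X (n - 1)\<^esub>))"

definition cycles :: "('a, 'b) mod_complex \<Rightarrow> int \<Rightarrow> 'b set" where
  "cycles X n = a_kernel (Ob X n) (Ob X (n - 1)) (Diff X n)"

definition boundaries :: "('a, 'b) mod_complex \<Rightarrow> int \<Rightarrow> 'b set" where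
  "boundaries X n = Diff X (n + 1) ` carrier (Ob X (n + 1))"

definition homology :: "('a, 'b) mod_complex \<Rightarrow> int \<Rightarrow> ('a, 'b set) module" where
  "homology X n = quot_mod ((Ob X n)\<lparr>carrier := cycles X n\<rparr>) (boundaries X n)"

definition exact :: "('a, 'b) mod_complex \<Rightarrow> bool" where
  "exact X \<longleftrightarrow> (\<forall>n. boundaries X n = cycles X n)"

definition Hom_into_complex :: "('a, 'm) ring_scheme \<Rightarrow> ('a, 'c) module \<Rightarrow> ('a, 'b) mod_complex \<Rightarrow>
    ('a, 'c \<Rightarrow> 'b) mod_complex" where
  "Hom_into_complex R W X = \<lparr>Ob = (\<lambda>n. Hom_mod R W (Ob X n)),
     Diff = (\<lambda>n f. compose (carrier W) (Diff X n) f)\<rparr>"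

text \<open>The contravariant Hom complex is regraded homologically: its degree \<open>n\<close> part is
  the module of homomorphisms out of \<open>Ob X (- n)\<close>.\<close>

definition Hom_from_complex :: "('a, 'm) ring_scheme \<Rightarrow> ('a, 'b) mod_complex \<Rightarrow> ('a, 'c) module \<Rightarrow>
    ('a, 'b \<Rightarrow> 'c) mod_complex" where
  "Hom_from_complex R X W = \<lparr>Ob = (\<lambda>n. Hom_mod R (Ob X (- n)) W),
     Diff = (\<lambda>n f. compose (carrier (Ob X (1 - n))) f (Diff X (1 - n)))\<rparr>"


section \<open>Free resolutions and Ext\<close>

text \<open>The free module on a set \<open>S\<close> consists of the finitely supported functions vanishing
  outside \<open>S\<close>; \<open>free_unit R x\<close> is the basis vector of \<open>x\<close>, and \<open>free_ext\<close> is the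
  linear extension of a map given on the basis.\<close>

definition free_mod :: "('a, 'm) ring_scheme \<Rightarrow> 'x set \<Rightarrow> ('a, 'x \<Rightarrow> 'a) module" where
  "free_mod R S = \<lparr>carrier = {f. (\<forall>x. f x \<in> carrier R) \<and> finite {x. f x \<noteq> \<zero>\<^bsub>R\<^esub>} \<and>
       {x. f x \<noteq> \<zero>\<^bsub>R\<^esub>} \<subseteq> S},
     monoid.mult = undefined, one = undefined, zero = (\<lambda>_. \<zero>\<^bsub>R\<^esub>),
     add = (\<lambda>f g x. f x \<oplus>\<^bsub>R\<^esub> g x), smult = (\<lambda>r f x. r \<otimes>\<^bsub>R\<^esub> f x)\<rparr>"

definition free_unit :: "('a, 'm) ring_scheme \<Rightarrow> 'x \<Rightarrow> 'x \<Rightarrow> 'a" where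
  "free_unit R x = (\<lambda>y. if y = x then \<one>\<^bsub>R\<^esub> else \<zero>\<^bsub>R\<^esub>)"

definition free_ext ::
    "('a, 'm) ring_scheme \<Rightarrow> ('a, 'c) module \<Rightarrow> ('x \<Rightarrow> 'c) \<Rightarrow> ('x \<Rightarrow> 'a) \<Rightarrow> 'c" where
  "free_ext R N b f = (\<Oplus>\<^bsub>N\<^esub> x \<in> {x. f x \<noteq> \<zero>\<^bsub>R\<^esub>}. f x \<odot>\<^bsub>N\<^esub> b x)"

text \<open>The canonical free resolution of \<open>M\<close>: degree \<open>0\<close> is free on the elements of \<open>M\<close>,
  degree \<open>1\<close> is free on all formal linear combinations of these generators that evaluate
  to zero in \<open>M\<close>, and degree \<open>n + 2\<close> is free on all formal linear combinations of the generators
  of degree \<open>n + 1\<close> whose boundary vanishes.  The single datatype of generators accommodates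
  all degrees, so no assumption on the size of the carrier type is needed.\<close>

datatype ('a, 'b) gen = Elt 'b | Rel "('a \<times> ('a, 'b) gen) list"

primrec lin_comb :: "('a, 'c) module \<Rightarrow> ('x \<Rightarrow> 'c) \<Rightarrow> ('a \<times> 'x) list \<Rightarrow> 'c" where
  "lin_comb N b [] = \<zero>\<^bsub>N\<^esub>"
| "lin_comb N b (p # ps) = fst p \<odot>\<^bsub>N\<^esub> b (snd p) \<oplus>\<^bsub>N\<^esub> lin_comb N b ps"

fun gen_aug :: "('a, 'b) gen \<Rightarrow> 'b" where
  "gen_aug (Elt m) = m"
| "gen_aug (Rel ps) = undefined"

fun gen_bnd :: "('a, 'm) ring_scheme \<Rightarrow> ('a, 'b) gen \<Rightarrow> ('a, 'b) gen \<Rightarrow> 'a" where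
  "gen_bnd R (Elt m) = (\<lambda>_. \<zero>\<^bsub>R\<^esub>)"
| "gen_bnd R (Rel ps) = lin_comb (free_mod R UNIV) (free_unit R) ps"

fun gens :: "('a, 'm) ring_scheme \<Rightarrow> ('a, 'b) module \<Rightarrow> nat \<Rightarrow> ('a, 'b) gen set" where
  "gens R M 0 = Elt ` carrier M"
| "gens R M (Suc 0) = Rel ` {ps. set ps \<subseteq> carrier R \<times> gens R M 0 \<and>
     lin_comb M gen_aug ps = \<zero>\<^bsub>M\<^esub>}"
| "gens R M (Suc (Suc n)) = Rel ` {ps. set ps \<subseteq> carrier R \<times> gens R M (Suc n) \<and>
     lin_comb (free_mod R (gens R M n)) (gen_bnd R) ps = \<zero>\<^bsub>free_mod R (gens R M n)\<^esub>}"

definition free_res ::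
    "('a, 'm) ring_scheme \<Rightarrow> ('a, 'b) module \<Rightarrow> ('a, ('a, 'b) gen \<Rightarrow> 'a) mod_complex" where
  "free_res R M =
     (let F = (\<lambda>n. free_mod R (if n < 0 then {} else gens R M (nat n)))
      in \<lparr>Ob = F, Diff = (\<lambda>n. free_ext R (F (n - 1)) (gen_bnd R))\<rparr>)"

text \<open>With the augmentation induced by evaluation, the complex \<open>free_res R M\<close> is indeed a
  free resolution of \<open>M\<close>: see \<open>free_res_complex\<close>, \<open>free_res_exact\<close> and
  \<open>free_res_augmented\<close> below.\<close>

lemma free_mod_module: assumes "cring R" shows "module R (free_mod R S)"
proof -
  interpret cring R by fact
  have ab: "abelian_group (free_mod R S)"
  proof (rule abelian_groupI)
    fix f g assume "f \<in> carrier (free_mod R S)" "g \<in> carrier (free_mod R S)"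
    moreover from this have "{x. f x \<oplus>\<^bsub>R\<^esub> g x \<noteq> \<zero>\<^bsub>R\<^esub>} \<subseteq> {x. f x \<noteq> \<zero>\<^bsub>R\<^esub>} \<union> {x. g x \<noteq> \<zero>\<^bsub>R\<^esub>}" by auto
    ultimately show "f \<oplus>\<^bsub>free_mod R S\<^esub> g \<in> carrier (free_mod R S)"
      by (auto simp: free_mod_def intro: finite_subset)
  next
    fix f assume f: "f \<in> carrier (free_mod R S)"
    then have "{x. \<ominus>\<^bsub>R\<^esub> f x \<noteq> \<zero>\<^bsub>R\<^esub>} \<subseteq> {x. f x \<noteq> \<zero>\<^bsub>R\<^esub>}" by (auto simp: free_mod_def)
    with f show "\<exists>g\<in>carrier (free_mod R S). g \<oplus>\<^bsub>free_mod R S\<^esub> f = \<zero>\<^bsub>free_mod R S\<^esub>"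
      by (intro bexI[of _ "\<lambda>x. \<ominus>\<^bsub>R\<^esub> f x"]) (auto simp: free_mod_def l_neg intro: finite_subset)
  qed (auto simp: free_mod_def a_ac)
  show ?thesis
  proof (rule moduleI)
    fix r f assume "r \<in> carrier R" and f: "f \<in> carrier (free_mod R S)"
    moreover from this have "{x. r \<otimes>\<^bsub>R\<^esub> f x \<noteq> \<zero>\<^bsub>R\<^esub>} \<subseteq> {x. f x \<noteq> \<zero>\<^bsub>R\<^esub>}" by (auto)
    ultimately show "r \<odot>\<^bsub>free_mod R S\<^esub> f \<in> carrier (free_mod R S)"
      by (auto simp: free_mod_def intro: finite_subset)
  qed (use ab in \<open>auto simp: free_mod_def l_distr r_distr m_assoc assms\<close>)
qed

lemma free_ext_superset:
  assumes "module R N" "f \<in> carrier (free_mod R S)" "finite A" "{x. f x \<noteq> \<zero>\<^bsub>R\<^esub>} \<subseteq> A" "A \<subseteq> S"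
    "\<And>x. x \<in> S \<Longrightarrow> b x \<in> carrier N"
  shows "free_ext R N b f = (\<Oplus>\<^bsub>N\<^esub> x \<in> A. f x \<odot>\<^bsub>N\<^esub> b x)"
proof -
  interpret module R N by fact
  show ?thesis unfolding free_ext_def
    by (rule add.finprod_mono_neutral_cong_left) (use assms in \<open>auto simp: free_mod_def\<close>)
qed

lemma free_ext_hom:
  assumes "module R N" "\<And>x. x \<in> S \<Longrightarrow> b x \<in> carrier N"
  shows "free_ext R N b \<in> mod_hom R (free_mod R S) N"
proof -
  interpret module R N by fact
  interpret F: module R "free_mod R S" by (rule free_mod_module) (rule R.is_cring)
  have cl: "f x \<odot>\<^bsub>N\<^esub> b x \<in> carrier N" if "f \<in> carrier (free_mod R S)" "x \<in> S" for f x
    using that assms by (auto simp: free_mod_def)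
  have 1: "free_ext R N b f \<in> carrier N" if "f \<in> carrier (free_mod R S)" for f
    unfolding free_ext_def by (rule finsum_closed) (use that cl in \<open>auto simp: free_mod_def\<close>)
  have 2: "free_ext R N b (f \<oplus>\<^bsub>free_mod R S\<^esub> g) = free_ext R N b f \<oplus>\<^bsub>N\<^esub> free_ext R N b g"
    if f: "f \<in> carrier (free_mod R S)" and g: "g \<in> carrier (free_mod R S)" for f g
  proof -
    let ?A = "{x. f x \<noteq> \<zero>\<^bsub>R\<^esub>} \<union> {x. g x \<noteq> \<zero>\<^bsub>R\<^esub>}"
    have A: "finite ?A" "?A \<subseteq> S" using f g by (auto simp: free_mod_def)
    have s: "{x. (f \<oplus>\<^bsub>free_mod R S\<^esub> g) x \<noteq> \<zero>\<^bsub>R\<^esub>} \<subseteq> ?A" by (auto simp: free_mod_def)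
    have "(\<Oplus>\<^bsub>N\<^esub> x \<in> ?A. (f \<oplus>\<^bsub>free_mod R S\<^esub> g) x \<odot>\<^bsub>N\<^esub> b x) = (\<Oplus>\<^bsub>N\<^esub> x \<in> ?A. f x \<odot>\<^bsub>N\<^esub> b x \<oplus>\<^bsub>N\<^esub> g x \<odot>\<^bsub>N\<^esub> b x)"
      by (rule finsum_cong') (use A f g assms cl in \<open>auto simp: free_mod_def smult_l_distr subset_iff\<close>)
    also have "\<dots> = (\<Oplus>\<^bsub>N\<^esub> x \<in> ?A. f x \<odot>\<^bsub>N\<^esub> b x) \<oplus>\<^bsub>N\<^esub> (\<Oplus>\<^bsub>N\<^esub> x \<in> ?A. g x \<odot>\<^bsub>N\<^esub> b x)"
      by (rule finsum_addf) (use A f g cl in blast)+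
    finally show ?thesis
      using free_ext_superset[OF assms(1) _ A(1) _ A(2) assms(2), of "f \<oplus>\<^bsub>free_mod R S\<^esub> g"]
        free_ext_superset[OF assms(1) f A(1) _ A(2) assms(2)]
        free_ext_superset[OF assms(1) g A(1) _ A(2) assms(2)] f g s by auto
  qed
  have 3: "free_ext R N b (r \<odot>\<^bsub>free_mod R S\<^esub> f) = r \<odot>\<^bsub>N\<^esub> free_ext R N b f"
    if f: "f \<in> carrier (free_mod R S)" and r: "r \<in> carrier R" for f r
  proof -
    let ?A = "{x. f x \<noteq> \<zero>\<^bsub>R\<^esub>}"
    have A: "finite ?A" "?A \<subseteq> S" using f by (auto simp: free_mod_def)
    have s: "{x. (r \<odot>\<^bsub>free_mod R S\<^esub> f) x \<noteq> \<zero>\<^bsub>R\<^esub>} \<subseteq> ?A" using r by (auto simp: free_mod_def)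
    have "(\<Oplus>\<^bsub>N\<^esub> x \<in> ?A. (r \<odot>\<^bsub>free_mod R S\<^esub> f) x \<odot>\<^bsub>N\<^esub> b x) = (\<Oplus>\<^bsub>N\<^esub> x \<in> ?A. r \<odot>\<^bsub>N\<^esub> (f x \<odot>\<^bsub>N\<^esub> b x))"
      by (rule finsum_cong') (use A f r assms cl in \<open>auto simp: free_mod_def smult_assoc1 subset_iff\<close>)
    also have "\<dots> = r \<odot>\<^bsub>N\<^esub> (\<Oplus>\<^bsub>N\<^esub> x \<in> ?A. f x \<odot>\<^bsub>N\<^esub> b x)"
      by (rule finsum_smult_ldistr[symmetric]) (use A f r cl in blast)+
    finally show ?thesis
      using free_ext_superset[OF assms(1) _ A(1) s A(2) assms(2)]
        free_ext_superset[OF assms(1) f A(1) _ A(2) assms(2)] f r by auto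
  qed
  show ?thesis unfolding mod_hom_def hom_def using 1 2 3 by auto
qed

lemma lin_comb_closed:
  assumes "module R N" "set ps \<subseteq> carrier R \<times> S" "\<And>x. x \<in> S \<Longrightarrow> b x \<in> carrier N"
  shows "lin_comb N b ps \<in> carrier N"
proof -
  interpret module R N by fact
  show ?thesis using assms(2) by (induction ps) (auto simp: assms(3))
qed

lemma lin_comb_hom:
  assumes "module R M" "module R N" "h \<in> mod_hom R M N"
    "set ps \<subseteq> carrier R \<times> S" "\<And>x. x \<in> S \<Longrightarrow> b x \<in> carrier M"
  shows "h (lin_comb M b ps) = lin_comb N (\<lambda>x. h (b x)) ps"
proof -
  interpret M: module R M by fact
  interpret N: module R N by fact
  have a: "h (x \<oplus>\<^bsub>M\<^esub> y) = h x \<oplus>\<^bsub>N\<^esub> h y" if "x \<in> carrier M" "y \<in> carrier M" for x y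
    using assms(3) that by (auto simp: mod_hom_def hom_def)
  have m: "h x \<in> carrier N" if "x \<in> carrier M" for x
    using assms(3) that by (auto simp: mod_hom_def hom_def)
  have s: "h (r \<odot>\<^bsub>M\<^esub> x) = r \<odot>\<^bsub>N\<^esub> h x" if "x \<in> carrier M" "r \<in> carrier R" for x r
    using assms(3) that by (auto simp: mod_hom_def hom_def)
  have z: "h \<zero>\<^bsub>M\<^esub> = \<zero>\<^bsub>N\<^esub>" using s[of "\<zero>\<^bsub>M\<^esub>" "\<zero>\<^bsub>R\<^esub>"] m by simp
  show ?thesis using assms(4)
  proof (induction ps)
    case (Cons p ps)
    then show ?case using lin_comb_closed[OF assms(1) _ assms(5), of ps S] 
      by (auto simp: a s assms(5))
  qed (simp add: z)
qed

lemma free_unit_closed: "cring R \<Longrightarrow> x \<in> S \<Longrightarrow> free_unit R x \<in> carrier (free_mod R S)"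
  by (auto simp: free_mod_def free_unit_def cring.cring_simprules)

lemma free_ext_unit:
  assumes "module R N" "x \<in> S" "\<And>x. x \<in> S \<Longrightarrow> b x \<in> carrier N"
  shows "free_ext R N b (free_unit R x) = b x"
proof -
  interpret module R N by fact
  have "free_ext R N b (free_unit R x) = (\<Oplus>\<^bsub>N\<^esub> y \<in> {x}. free_unit R x y \<odot>\<^bsub>N\<^esub> b y)"
    by (rule free_ext_superset[OF assms(1) free_unit_closed[OF R.is_cring assms(2)] _ _ _ assms(3)])
       (use assms in \<open>auto simp: free_unit_def split: if_splits\<close>)
  then show ?thesis using assms by (simp add: free_unit_def)
qed

lemma lin_comb_free_UNIV: "lin_comb (free_mod R S) b ps = lin_comb (free_mod R UNIV) b ps"
  by (induction ps) (auto simp: free_mod_def)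

lemma free_ext_lin_comb:
  assumes "module R N" "set ps \<subseteq> carrier R \<times> S" "\<And>x. x \<in> S \<Longrightarrow> b x \<in> carrier N"
  shows "free_ext R N b (lin_comb (free_mod R UNIV) (free_unit R) ps) = lin_comb N b ps"
proof -
  interpret module R N by fact
  have "free_ext R N b (lin_comb (free_mod R S) (free_unit R) ps)
    = lin_comb N (\<lambda>x. free_ext R N b (free_unit R x)) ps"
    by (rule lin_comb_hom[OF free_mod_module[OF R.is_cring] assms(1) free_ext_hom[OF assms(1,3)] assms(2)])
       (auto intro: free_unit_closed R.is_cring)
  also have "\<dots> = lin_comb N b ps" using assms(2)
    by (induction ps) (auto simp: free_ext_unit[OF assms(1) _ assms(3)])
  finally show ?thesis by (simp add: lin_comb_free_UNIV[of R S])
qed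

lemma free_lin_comb_ex:
  assumes "cring R" "f \<in> carrier (free_mod R S)"
  shows "\<exists>ps. set ps \<subseteq> carrier R \<times> S \<and> lin_comb (free_mod R UNIV) (free_unit R) ps = f"
proof -
  interpret cring R by fact
  have "finite A \<Longrightarrow> \<forall>f. (\<forall>x. f x \<in> carrier R) \<and> {x. f x \<noteq> \<zero>\<^bsub>R\<^esub>} \<subseteq> A \<longrightarrow> A \<subseteq> S \<longrightarrow>
    (\<exists>ps. set ps \<subseteq> carrier R \<times> S \<and> lin_comb (free_mod R UNIV) (free_unit R) ps = f)" for A
  proof (induction A rule: finite_induct)
    case empty
    show ?case by (auto intro!: exI[of _ "[]"] simp: free_mod_def)
  next
    case (insert a A)
    show ?case
    proof (intro allI impI)
      fix f assume f: "(\<forall>x. f x \<in> carrier R) \<and> {x. f x \<noteq> \<zero>\<^bsub>R\<^esub>} \<subseteq> insert a A" "insert a A \<subseteq> S"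
      have 1: "(\<forall>x. (f(a := \<zero>\<^bsub>R\<^esub>)) x \<in> carrier R) \<and> {x. (f(a := \<zero>\<^bsub>R\<^esub>)) x \<noteq> \<zero>\<^bsub>R\<^esub>} \<subseteq> A"
        using f(1) by auto
      obtain ps where ps: "set ps \<subseteq> carrier R \<times> S"
        "lin_comb (free_mod R UNIV) (free_unit R) ps = f(a := \<zero>\<^bsub>R\<^esub>)"
        using insert.IH[rule_format, OF 1] f(2) by blast
      then show "\<exists>ps. set ps \<subseteq> carrier R \<times> S \<and> lin_comb (free_mod R UNIV) (free_unit R) ps = f"
        using f by (intro exI[of _ "(f a, a) # ps"]) (auto simp: free_mod_def free_unit_def fun_eq_iff)
    qed
  qed
  then show ?thesis using assms(2) by (auto simp: free_mod_def)
qed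

lemma gen_bnd_closed:
  assumes "cring R" "x \<in> gens R M (Suc n)"
  shows "gen_bnd R x \<in> carrier (free_mod R (gens R M n))"
proof -
  from assms(2) obtain ps where "x = Rel ps" "set ps \<subseteq> carrier R \<times> gens R M n"
    by (cases n) auto
  moreover from this have "lin_comb (free_mod R (gens R M n)) (free_unit R) ps \<in> carrier (free_mod R (gens R M n))"
    using lin_comb_closed[where b = "free_unit R", OF free_mod_module[OF assms(1)] _ free_unit_closed[OF assms(1)]]
    by blast
  ultimately show ?thesis by (simp add: lin_comb_free_UNIV[of R "gens R M n"])
qed

lemma gen_aug_closed: "x \<in> gens R M 0 \<Longrightarrow> gen_aug x \<in> carrier M" by auto

lemma res_exact_gen:
  assumes "cring R"  "module R N" "\<And>x. x \<in> gens R M n \<Longrightarrow> b x \<in> carrier N"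
   "gens R M (Suc n) = Rel ` {ps. set ps \<subseteq> carrier R \<times> gens R M n \<and> lin_comb N b ps = \<zero>\<^bsub>N\<^esub>}"
  shows "free_ext R (free_mod R (gens R M n)) (gen_bnd R) ` carrier (free_mod R (gens R M (Suc n)))
    = a_kernel (free_mod R (gens R M n)) N (free_ext R N b)"
proof -
  interpret cring R by fact
  let ?d = "free_ext R (free_mod R (gens R M n)) (gen_bnd R)"
  note fm = free_mod_module[OF assms(1)]
  have dh: "?d \<in> mod_hom R (free_mod R (gens R M (Suc n))) (free_mod R (gens R M n))"
    by (rule free_ext_hom[OF fm gen_bnd_closed[OF assms(1)]])
  have bh: "free_ext R N b \<in> mod_hom R (free_mod R (gens R M n)) N" by (rule free_ext_hom[OF assms(2,3)])
  have g0: "free_ext R N b (gen_bnd R x) = \<zero>\<^bsub>N\<^esub>" if "x \<in> gens R M (Suc n)" for x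
    using that free_ext_lin_comb[where b = b, OF assms(2) _ assms(3)] unfolding assms(4) by auto
  have z: "lin_comb N b' ps = \<zero>\<^bsub>N\<^esub>" if "set ps \<subseteq> carrier R \<times> S" "\<And>x. x \<in> S \<Longrightarrow> b' x = \<zero>\<^bsub>N\<^esub>" for b' ps S
  proof -
    interpret N: module R N by fact
    show ?thesis using that by (induction ps) auto
  qed
  show ?thesis
  proof (intro equalityI subsetI)
    fix y assume "y \<in> ?d ` carrier (free_mod R (gens R M (Suc n)))"
    then obtain f where f: "f \<in> carrier (free_mod R (gens R M (Suc n)))" "y = ?d f" by auto
    obtain ps where ps: "set ps \<subseteq> carrier R \<times> gens R M (Suc n)" "f = lin_comb (free_mod R UNIV) (free_unit R) ps"
      using free_lin_comb_ex[OF assms(1) f(1)] by auto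
    have y: "y = lin_comb (free_mod R (gens R M n)) (gen_bnd R) ps"
      using free_ext_lin_comb[OF fm ps(1) gen_bnd_closed[OF assms(1)]] f ps by simp
    have "free_ext R N b y = lin_comb N (\<lambda>x. free_ext R N b (gen_bnd R x)) ps"
      unfolding y by (rule lin_comb_hom[OF fm assms(2) bh ps(1) gen_bnd_closed[OF assms(1)]])
    then have "free_ext R N b y = \<zero>\<^bsub>N\<^esub>" using z[OF ps(1) g0] by simp
    moreover have "y \<in> carrier (free_mod R (gens R M n))" using dh f by (auto simp: mod_hom_def hom_def)
    ultimately show "y \<in> a_kernel (free_mod R (gens R M n)) N (free_ext R N b)"
      by (simp add: a_kernel_def kernel_def)
  next
    fix y assume "y \<in> a_kernel (free_mod R (gens R M n)) N (free_ext R N b)"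
    then have y: "y \<in> carrier (free_mod R (gens R M n))" "free_ext R N b y = \<zero>\<^bsub>N\<^esub>" by (auto simp: a_kernel_def kernel_def)
    obtain ps where ps: "set ps \<subseteq> carrier R \<times> gens R M n" "y = lin_comb (free_mod R UNIV) (free_unit R) ps"
      using free_lin_comb_ex[OF assms(1) y(1)] by auto
    have r: "Rel ps \<in> gens R M (Suc n)" unfolding assms(4)
      using ps y free_ext_lin_comb[OF assms(2) ps(1) assms(3)] by auto
    have "?d (free_unit R (Rel ps)) = gen_bnd R (Rel ps)"
      by (rule free_ext_unit[OF fm r gen_bnd_closed[OF assms(1)]])
    then have "y = ?d (free_unit R (Rel ps))" using ps by simp
    then show "y \<in> ?d ` carrier (free_mod R (gens R M (Suc n)))" using free_unit_closed[OF assms(1) r] by blast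
  qed
qed

lemma free_res_exact:
  assumes "cring R" "n > 0"
  shows "boundaries (free_res R M) n = cycles (free_res R M) n"
proof -
  obtain k where k: "n = int (Suc k)" using assms(2) by (metis gr0_implies_Suc pos_int_cases)
  have n: "nat n = Suc k" "nat (n + 1) = Suc (Suc k)" "nat (n - 1) = k" "\<not> n < 0" "\<not> n < 1" "\<not> n + 1 < 0" using k by auto
  have "free_ext R (free_mod R (gens R M (Suc k))) (gen_bnd R) ` carrier (free_mod R (gens R M (Suc (Suc k))))
    = a_kernel (free_mod R (gens R M (Suc k))) (free_mod R (gens R M k)) (free_ext R (free_mod R (gens R M k)) (gen_bnd R))"
    by (rule res_exact_gen[OF assms(1) free_mod_module[OF assms(1)] gen_bnd_closed[OF assms(1)]])
       simp_all
  then show ?thesis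
    by (simp add: boundaries_def cycles_def free_res_def n del: gens.simps)
qed

lemma free_res_complex:
  assumes "cring R"
  shows "is_complex R (free_res R M)"
proof -
  interpret cring R by fact
  let ?X = "free_res R M"
  let ?S = "\<lambda>n :: int. if n < 0 then {} else gens R M (nat n)"
  have Ob: "Ob ?X n = free_mod R (?S n)" for n by (simp add: free_res_def Let_def)
  have "gen_bnd R x \<in> carrier (free_mod R (?S (n - 1)))" if "x \<in> ?S n" for x n
  proof (cases "n > 0")
    case True
    then have "nat n = Suc (nat (n - 1))" by simp
    with True that show ?thesis using gen_bnd_closed[OF assms, of x M "nat (n - 1)"] by simp
  next
    case False
    with that have "n = 0" by (simp split: if_splits)
    with that show ?thesis by (auto simp: free_mod_def)
  qed
  then have d: "Diff ?X n \<in> mod_hom R (Ob ?X n) (Ob ?X (n - 1))" for n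
    using free_ext_hom[OF free_mod_module[OF assms], of "?S n" "gen_bnd R" "?S (n - 1)"]
    unfolding Ob by (simp add: free_res_def Let_def)
  have "Diff ?X n (Diff ?X (n + 1) x) = \<zero>\<^bsub>Ob ?X (n - 1)\<^esub>" if x: "x \<in> carrier (Ob ?X (n + 1))" for n x
  proof (cases "n > 0")
    case True
    then show ?thesis using free_res_exact[OF assms True, of M] x
      by (auto simp: boundaries_def cycles_def a_kernel_def kernel_def)
  next
    case False
    have "Diff ?X (n + 1) x \<in> carrier (Ob ?X n)" using d[of "n + 1"] x by (auto simp: mod_hom_def hom_def)
    then have "Diff ?X n (Diff ?X (n + 1) x) \<in> carrier (Ob ?X (n - 1))"
      using d[of n] by (auto simp: mod_hom_def hom_def)
    with False show ?thesis unfolding Ob by (auto simp: free_mod_def)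
  qed
  with d free_mod_module[OF assms] show ?thesis by (auto simp: is_complex_def Ob)
qed

lemma free_res_augmented:
  fixes M :: "('a, 'b) module"
  assumes "module R M"
  shows "boundaries (free_res R M) 0 = a_kernel (Ob (free_res R M) 0) M (free_ext R M gen_aug)"
    and "free_ext R M gen_aug \<in> mod_hom R (Ob (free_res R M) 0) M"
    and "free_ext R M gen_aug ` carrier (Ob (free_res R M) 0) = carrier M"
proof -
  interpret module R M by fact
  note h = free_ext_hom[OF assms, of "gens R M 0" gen_aug]
  show "boundaries (free_res R M) 0 = a_kernel (Ob (free_res R M) 0) M (free_ext R M gen_aug)"
    using res_exact_gen[OF R.is_cring assms, of M 0 gen_aug] gen_aug_closed[of _ R M]
    by (simp add: boundaries_def free_res_def Let_def)
  show hh: "free_ext R M gen_aug \<in> mod_hom R (Ob (free_res R M) 0) M"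
    using h[OF gen_aug_closed] by (simp add: free_res_def Let_def)
  have "m \<in> free_ext R M gen_aug ` carrier (Ob (free_res R M) 0)" if "m \<in> carrier M" for m
  proof (rule image_eqI)
    have "Elt m \<in> gens R M 0" using that by simp
    then show "free_unit R (Elt m) \<in> carrier (Ob (free_res R M) 0)"
      using free_unit_closed[OF R.is_cring] by (simp add: free_res_def Let_def del: gens.simps)
    show "m = free_ext R M gen_aug (free_unit R (Elt m :: ('a, 'b) gen))"
      using free_ext_unit[OF assms \<open>Elt m \<in> gens R M 0\<close>, of gen_aug] gen_aug_closed[of _ R M]
      by simp
  qed
  then show "free_ext R M gen_aug ` carrier (Ob (free_res R M) 0) = carrier M"
    using hh by (auto simp: mod_hom_def hom_def)
qed

definition Ext :: "('a, 'm) ring_scheme \<Rightarrow> nat \<Rightarrow> ('a, 'b) module \<Rightarrow> ('a, 'c) module \<Rightarrow>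
    ('a, ((('a, 'b) gen \<Rightarrow> 'a) \<Rightarrow> 'c) set) module" where
  "Ext R i M N = homology (Hom_from_complex R (free_res R M) N) (- int i)"


section \<open>Subcategories\<close>

text \<open>A full subcategory is given by its class of objects, a set of modules with carriers in
  a fixed but arbitrary type.  Direct sums and cokernels live over other types, so
  membership for these is understood up to isomorphism.\<close>

definition in_up_to_iso ::
    "('a, 'm) ring_scheme \<Rightarrow> ('a, 'b) module set \<Rightarrow> ('a, 'c) module \<Rightarrow> bool" where
  "in_up_to_iso R \<X> M \<longleftrightarrow> (\<exists>N \<in> \<X>. mod_iso R M N)"

definition iso_closed_subcat :: "('a, 'm) ring_scheme \<Rightarrow> ('a, 'b) module set \<Rightarrow> bool" where
  "iso_closed_subcat R \<X> \<longleftrightarrow> (\<forall>M \<in> \<X>. module R M) \<and>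
     (\<forall>M \<in> \<X>. \<forall>N. module R N \<longrightarrow> mod_iso R M N \<longrightarrow> N \<in> \<X>)"

definition additive_subcat :: "('a, 'm) ring_scheme \<Rightarrow> ('a, 'b) module set \<Rightarrow> bool" where
  "additive_subcat R \<X> \<longleftrightarrow> (\<exists>Z \<in> \<X>. carrier Z = {\<zero>\<^bsub>Z\<^esub>}) \<and>
     (\<forall>M \<in> \<X>. \<forall>N \<in> \<X>. in_up_to_iso R \<X> (dsum_mod M N))"

definition closed_summands :: "('a, 'm) ring_scheme \<Rightarrow> ('a, 'b) module set \<Rightarrow> bool" where
  "closed_summands R \<X> \<longleftrightarrow> (\<forall>M \<in> \<X>. \<forall>M' M''. module R M' \<longrightarrow> module R (M'' :: ('a, 'b) module) \<longrightarrow>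
     mod_iso R M (dsum_mod M' M'') \<longrightarrow> M' \<in> \<X>)"

definition short_exact :: "('a, 'm) ring_scheme \<Rightarrow> ('a, 'b) module \<Rightarrow> ('b \<Rightarrow> 'c) \<Rightarrow>
    ('a, 'c) module \<Rightarrow> ('c \<Rightarrow> 'd) \<Rightarrow> ('a, 'd) module \<Rightarrow> bool" where
  "short_exact R M' f M g M'' \<longleftrightarrow> f \<in> mod_hom R M' M \<and> g \<in> mod_hom R M M'' \<and>
     inj_on f (carrier M') \<and> f ` carrier M' = a_kernel M M'' g \<and> g ` carrier M = carrier M''"

definition closed_extensions :: "('a, 'm) ring_scheme \<Rightarrow> ('a, 'b) module set \<Rightarrow> bool" where
  "closed_extensions R \<X> \<longleftrightarrow> (\<forall>M' \<in> \<X>. \<forall>M'' \<in> \<X>. \<forall>M f g. module R M \<longrightarrow>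
     short_exact R M' f M g M'' \<longrightarrow> M \<in> \<X>)"

definition exact_subcat :: "('a, 'm) ring_scheme \<Rightarrow> ('a, 'b) module set \<Rightarrow> bool" where
  "exact_subcat R \<X> \<longleftrightarrow> closed_summands R \<X> \<and> closed_extensions R \<X>"

definition closed_ker_epi :: "('a, 'm) ring_scheme \<Rightarrow> ('a, 'b) module set \<Rightarrow> bool" where
  "closed_ker_epi R \<X> \<longleftrightarrow> (\<forall>M \<in> \<X>. \<forall>N \<in> \<X>. \<forall>f \<in> mod_hom R M N.
     f ` carrier M = carrier N \<longrightarrow> ker_mod M N f \<in> \<X>)"

definition closed_coker_mono :: "('a, 'm) ring_scheme \<Rightarrow> ('a, 'b) module set \<Rightarrow> bool" where
  "closed_coker_mono R \<X> \<longleftrightarrow> (\<forall>M \<in> \<X>. \<forall>N \<in> \<X>. \<forall>f \<in> mod_hom R M N.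
     inj_on f (carrier M) \<longrightarrow> in_up_to_iso R \<X> (coker_mod M N f))"


section \<open>Gorenstein subcategories\<close>

definition totally_acyclic ::
    "('a, 'm) ring_scheme \<Rightarrow> ('a, 'b) module set \<Rightarrow> ('a, 'b) mod_complex \<Rightarrow> bool" where
  "totally_acyclic R \<W> X \<longleftrightarrow> is_complex R X \<and> (\<forall>n. Ob X n \<in> \<W>) \<and> exact X \<and>
     (\<forall>W \<in> \<W>. exact (Hom_into_complex R W X) \<and> exact (Hom_from_complex R X W))"

text \<open>The carrier type of the modules in \<open>gorenstein R \<W>\<close> is independent of that of the modules
  in \<open>\<W>\<close>, so that modules over every type are covered.\<close>

definition gorenstein ::
    "('a, 'm) ring_scheme \<Rightarrow> ('a, 'b) module set \<Rightarrow> ('a, 'c) module set" where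
  "gorenstein R \<W> = {M. module R M \<and>
     (\<exists>X. totally_acyclic R \<W> X \<and> mod_iso R M (coker_mod (Ob X 1) (Ob X 0) (Diff X 1)))}"

end

theory Submission
  imports Defs
begin

text \<open>Cut a totally \<open>\<W>\<close>-acyclic complex into short
exact sequences \<open>0 \<rightarrow> Z\<^sub>n \<rightarrow> X\<^sub>n \<rightarrow> Z\<^sub>n\<^sub>-\<^sub>1 \<rightarrow> 0\<close>.  Exactness of the Hom complexes and \<open>Ext\<^sup>1(\<W>, \<W>) = 0\<close> give, by
one dimension shift, \<open>Ext\<^sup>1(W, Z\<^sub>n) = 0 = Ext\<^sup>1(Z\<^sub>n, W)\<close> for all \<open>W \<in> \<W>\<close>.  Conversely, short exact sequences
of this kind that fit together in both directions, with these vanishing conditions, splice to a totally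
acyclic complex.  So \<open>\<G>(\<W>)\<close> is the largest class \<open>\<P>\<close> such that every \<open>M \<in> \<P>\<close> is \<open>Ext\<^sup>1\<close>-orthogonal to \<open>\<W>\<close>
on both sides and sits in exact sequences \<open>0 \<rightarrow> K \<rightarrow> V \<rightarrow> M \<rightarrow> 0\<close> and \<open>0 \<rightarrow> M \<rightarrow> V' \<rightarrow> C \<rightarrow> 0\<close> with
\<open>V, V' \<in> \<W>\<close> and \<open>K, C \<in> \<P>\<close>.  The two halves are \<open>gorenstein_resolvable\<close> and \<open>gorenstein_coinduct\<close>; with
them no complex appears in the rest of the argument.\<close>

text \<open>Extensions: for \<open>0 \<rightarrow> A \<rightarrow> B \<rightarrow> C \<rightarrow> 0\<close> with \<open>A, C \<in> \<G>(\<W>)\<close> the horseshoe construction resolves \<open>B\<close> on both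
sides, and the new kernel and cokernel are again extensions of members of \<open>\<G>(\<W>)\<close>; hence the class of such
extensions satisfies the coinduction principle.

Summands: let \<open>A\<close> be a retract of \<open>M \<in> \<G>(\<W>)\<close> and \<open>0 \<rightarrow> K \<rightarrow> V \<rightarrow> M \<rightarrow> 0\<close> exact.  The kernel \<open>L\<close> of
\<open>V \<rightarrow> M \<rightarrow> A\<close> is not visibly in \<open>\<G>(\<W>)\<close>, but \<open>0 \<rightarrow> K \<rightarrow> L \<oplus> A \<rightarrow> M \<rightarrow> 0\<close> is exact, so \<open>L \<oplus> A\<close> is, and
\<open>L\<close> is a retract of it.  The dual argument handles cokernels, so the class of retracts satisfies the
coinduction principle.

Kernels of epimorphisms: given \<open>0 \<rightarrow> K \<rightarrow> M \<rightarrow> N \<rightarrow> 0\<close>, pull back along some \<open>V \<rightarrow> N\<close> with \<open>V \<in> \<W>\<close> and kernel in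
\<open>\<G>(\<W>)\<close>.  The pullback \<open>P\<close> is an extension of \<open>M\<close>, hence in \<open>\<G>(\<W>)\<close>, and \<open>P \<rightarrow> V\<close> has kernel \<open>K\<close>.  Cover \<open>P\<close>
by \<open>U \<in> \<W>\<close>; the kernel of \<open>U \<rightarrow> V\<close> lies in \<open>\<W>\<close> by hypothesis, so \<open>U \<rightarrow> V\<close> splits, hence so does \<open>P \<rightarrow> V\<close>,
and \<open>K\<close> is a retract of \<open>P\<close>.  Cokernels of monomorphisms are dual, with a pushout.\<close>

text \<open>Carrier types need some care, because kernels, cokernels and direct sums live over varying types while
\<open>\<W>\<close> has a fixed one.  Every module in \<open>\<G>(\<W>)\<close> embeds into some \<open>V \<in> \<W>\<close> and so has a copy over the
carrier type of \<open>\<W>\<close> (\<open>gorenstein_realise\<close>).\<close>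

section \<open>Linear maps\<close>

text \<open>Homomorphisms are bundled with the module axioms of both ends, so that a single fact justifies all rewriting
with the map.\<close>

definition mod_map ::
    "('a, 'm) ring_scheme \<Rightarrow> ('a, 'b) module \<Rightarrow> ('a, 'c) module \<Rightarrow> ('b \<Rightarrow> 'c) \<Rightarrow> bool" where
  "mod_map R M N f \<longleftrightarrow> module R M \<and> module R N \<and> f \<in> mod_hom R M N"

lemma mod_mapI:
  assumes "module R M" "module R N" "\<And>x. x \<in> carrier M \<Longrightarrow> f x \<in> carrier N"
    "\<And>x y. x \<in> carrier M \<Longrightarrow> y \<in> carrier M \<Longrightarrow> f (x \<oplus>\<^bsub>M\<^esub> y) = f x \<oplus>\<^bsub>N\<^esub> f y"
    "\<And>r x. r \<in> carrier R \<Longrightarrow> x \<in> carrier M \<Longrightarrow> f (r \<odot>\<^bsub>M\<^esub> x) = r \<odot>\<^bsub>N\<^esub> f x"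
  shows "mod_map R M N f"
  using assms by (auto simp: mod_map_def mod_hom_def hom_def)

lemma mod_map_modules: "mod_map R M N f \<Longrightarrow> module R M" "mod_map R M N f \<Longrightarrow> module R N"
  by (auto simp: mod_map_def)

lemma mod_map_simps:
  assumes "mod_map R M N f"
  shows "\<And>x. x \<in> carrier M \<Longrightarrow> f x \<in> carrier N"
    and "\<And>x y. x \<in> carrier M \<Longrightarrow> y \<in> carrier M \<Longrightarrow> f (x \<oplus>\<^bsub>M\<^esub> y) = f x \<oplus>\<^bsub>N\<^esub> f y"
    and "\<And>r x. r \<in> carrier R \<Longrightarrow> x \<in> carrier M \<Longrightarrow> f (r \<odot>\<^bsub>M\<^esub> x) = r \<odot>\<^bsub>N\<^esub> f x"
    and "f \<zero>\<^bsub>M\<^esub> = \<zero>\<^bsub>N\<^esub>"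
    and "\<And>x. x \<in> carrier M \<Longrightarrow> f (\<ominus>\<^bsub>M\<^esub> x) = \<ominus>\<^bsub>N\<^esub> f x"
    and "\<And>x y. x \<in> carrier M \<Longrightarrow> y \<in> carrier M \<Longrightarrow> f (x \<ominus>\<^bsub>M\<^esub> y) = f x \<ominus>\<^bsub>N\<^esub> f y"
proof -
  interpret M: module R M using assms by (simp add: mod_map_def)
  interpret N: module R N using assms by (simp add: mod_map_def)
  show cl: "f x \<in> carrier N" if "x \<in> carrier M" for x
    using that assms by (auto simp: mod_map_def mod_hom_def hom_def)
  show add: "f (x \<oplus>\<^bsub>M\<^esub> y) = f x \<oplus>\<^bsub>N\<^esub> f y" if "x \<in> carrier M" "y \<in> carrier M" for x y
    using that assms by (auto simp: mod_map_def mod_hom_def hom_def)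
  show sm: "f (r \<odot>\<^bsub>M\<^esub> x) = r \<odot>\<^bsub>N\<^esub> f x" if "r \<in> carrier R" "x \<in> carrier M" for r x
    using that assms by (auto simp: mod_map_def mod_hom_def hom_def)
  show z: "f \<zero>\<^bsub>M\<^esub> = \<zero>\<^bsub>N\<^esub>" using sm[of "\<zero>\<^bsub>R\<^esub>" "\<zero>\<^bsub>M\<^esub>"] cl by simp
  show neg: "f (\<ominus>\<^bsub>M\<^esub> x) = \<ominus>\<^bsub>N\<^esub> f x" if "x \<in> carrier M" for x
    using sm[of "\<ominus>\<^bsub>R\<^esub> \<one>\<^bsub>R\<^esub>" x] that cl by (simp add: M.smult_l_minus N.smult_l_minus)
  show "f (x \<ominus>\<^bsub>M\<^esub> y) = f x \<ominus>\<^bsub>N\<^esub> f y" if "x \<in> carrier M" "y \<in> carrier M" for x y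
    using that by (simp add: a_minus_def add neg)
qed

lemma mod_map_id: "module R M \<Longrightarrow> mod_map R M M (\<lambda>x. x)"
  by (rule mod_mapI) auto

lemma mod_map_comp:
  assumes "mod_map R M N f" "mod_map R N P g"
  shows "mod_map R M P (\<lambda>x. g (f x))"
  using assms by (intro mod_mapI) (simp_all add: mod_map_modules mod_map_simps[OF assms(1)] mod_map_simps[OF assms(2)])

lemma mod_map_add:
  assumes f: "mod_map R M N f" and g: "mod_map R M N g"
  shows "mod_map R M N (\<lambda>x. f x \<oplus>\<^bsub>N\<^esub> g x)"
proof -
  interpret N: module R N using f by (simp add: mod_map_def)
  show ?thesis
    by (rule mod_mapI)
      (use f in \<open>simp_all add: mod_map_modules mod_map_simps[OF f] mod_map_simps[OF g] N.a_ac N.smult_r_distr\<close>)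
qed

lemma mod_map_minus:
  assumes f: "mod_map R M N f" and g: "mod_map R M N g"
  shows "mod_map R M N (\<lambda>x. f x \<ominus>\<^bsub>N\<^esub> g x)"
proof -
  interpret N: module R N using f by (simp add: mod_map_def)
  show ?thesis
    by (rule mod_mapI)
      (use f in \<open>simp_all add: a_minus_def mod_map_modules mod_map_simps[OF f] mod_map_simps[OF g] N.a_ac
        N.minus_add N.smult_r_distr N.smult_r_minus\<close>)
qed

lemma mod_map_zero:
  assumes "module R M" "module R N"
  shows "mod_map R M N (\<lambda>x. \<zero>\<^bsub>N\<^esub>)"
proof -
  interpret N: module R N by fact
  show ?thesis by (rule mod_mapI) (use assms in auto)
qed

lemma (in abelian_group) minus_self: "x \<in> carrier G \<Longrightarrow> x \<ominus> x = \<zero>"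
  by (simp add: a_minus_def r_neg)

lemma (in abelian_group) diff_add: "x \<in> carrier G \<Longrightarrow> y \<in> carrier G \<Longrightarrow> (x \<ominus> y) \<oplus> y = x"
  by (simp add: a_minus_def a_ac l_neg r_neg)

lemma (in abelian_group) add_diff: "x \<in> carrier G \<Longrightarrow> y \<in> carrier G \<Longrightarrow> (x \<oplus> y) \<ominus> y = x"
  by (simp add: a_minus_def a_ac r_neg)

lemma (in abelian_group) diff_eq_zero: "x \<in> carrier G \<Longrightarrow> y \<in> carrier G \<Longrightarrow> x \<ominus> y = \<zero> \<longleftrightarrow> x = y"
  by (metis diff_add minus_self)

section \<open>Submodules, quotients and transport of structure\<close>

lemma submodule_module:
  assumes "module R M" "H \<subseteq> carrier M" "\<zero>\<^bsub>M\<^esub> \<in> H"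
    "\<And>x y. x \<in> H \<Longrightarrow> y \<in> H \<Longrightarrow> x \<oplus>\<^bsub>M\<^esub> y \<in> H"
    "\<And>r x. r \<in> carrier R \<Longrightarrow> x \<in> H \<Longrightarrow> r \<odot>\<^bsub>M\<^esub> x \<in> H"
  shows "module R (M\<lparr>carrier := H\<rparr>)"
proof -
  interpret module R M by fact
  have "\<ominus>\<^bsub>M\<^esub> x \<in> H" if "x \<in> H" for x
    using assms(5)[of "\<ominus>\<^bsub>R\<^esub> \<one>\<^bsub>R\<^esub>" x] that assms(2) by (auto simp: smult_l_minus)
  then have "submodule H R M" using assms by (intro submoduleI) auto
  then show ?thesis using submodule.submodule_is_module assms(1) by blast
qed

lemma ker_mod_simps:
  "carrier (ker_mod M N f) = {x \<in> carrier M. f x = \<zero>\<^bsub>N\<^esub>}"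
  "zero (ker_mod M N f) = zero M" "add (ker_mod M N f) = add M" "smult (ker_mod M N f) = smult M"
  by (auto simp: ker_mod_def a_kernel_def kernel_def)

lemma ker_mod_module:
  assumes "mod_map R M N f"
  shows "module R (ker_mod M N f)" "mod_map R (ker_mod M N f) M (\<lambda>x. x)"
proof -
  interpret M: module R M using assms by (simp add: mod_map_def)
  interpret N: module R N using assms by (simp add: mod_map_def)
  show m: "module R (ker_mod M N f)" unfolding ker_mod_def
    by (rule submodule_module) (auto simp: a_kernel_def kernel_def mod_map_simps[OF assms] M.module_axioms)
  show "mod_map R (ker_mod M N f) M (\<lambda>x. x)"
    by (rule mod_mapI) (auto simp: m M.module_axioms ker_mod_simps)
qed

text \<open>The structure that a map \<open>q\<close> induces on its image when its fibres form a congruence.  For injective \<open>q\<close>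
this is transport of structure; for \<open>q\<close> choosing representatives of cosets it is a quotient module
over the carrier type of \<open>M\<close> itself.\<close>

definition image_mod :: "('a, 'b) module \<Rightarrow> ('b \<Rightarrow> 'c) \<Rightarrow> ('a, 'c) module" where
  "image_mod M q = \<lparr>carrier = q ` carrier M, monoid.mult = undefined, one = undefined, zero = q \<zero>\<^bsub>M\<^esub>,
     add = (\<lambda>x y. q (inv_into (carrier M) q x \<oplus>\<^bsub>M\<^esub> inv_into (carrier M) q y)),
     smult = (\<lambda>r x. q (r \<odot>\<^bsub>M\<^esub> inv_into (carrier M) q x))\<rparr>"

lemma image_mod:
  assumes "module R M"
    and qa: "\<And>x x' y y'. x \<in> carrier M \<Longrightarrow> x' \<in> carrier M \<Longrightarrow> y \<in> carrier M \<Longrightarrow> y' \<in> carrier M \<Longrightarrow>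
      q x = q x' \<Longrightarrow> q y = q y' \<Longrightarrow> q (x \<oplus>\<^bsub>M\<^esub> y) = q (x' \<oplus>\<^bsub>M\<^esub> y')"
    and qs: "\<And>r x x'. r \<in> carrier R \<Longrightarrow> x \<in> carrier M \<Longrightarrow> x' \<in> carrier M \<Longrightarrow>
      q x = q x' \<Longrightarrow> q (r \<odot>\<^bsub>M\<^esub> x) = q (r \<odot>\<^bsub>M\<^esub> x')"
  shows "mod_map R M (image_mod M q) q"
proof -
  interpret M: module R M by fact
  let ?Q = "image_mod M q"
  have inv: "inv_into (carrier M) q (q x) \<in> carrier M" "q (inv_into (carrier M) q (q x)) = q x"
    if "x \<in> carrier M" for x
    using that by (auto simp: inv_into_into f_inv_into_f)
  have add: "q x \<oplus>\<^bsub>?Q\<^esub> q y = q (x \<oplus>\<^bsub>M\<^esub> y)" if "x \<in> carrier M" "y \<in> carrier M" for x y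
    using that inv by (auto simp: image_mod_def intro: qa)
  have sm: "r \<odot>\<^bsub>?Q\<^esub> q x = q (r \<odot>\<^bsub>M\<^esub> x)" if "r \<in> carrier R" "x \<in> carrier M" for r x
    using that inv by (auto simp: image_mod_def intro: qs)
  have c: "carrier ?Q = q ` carrier M" "zero ?Q = q \<zero>\<^bsub>M\<^esub>" by (auto simp: image_mod_def)
  have "abelian_group ?Q"
  proof (rule abelian_groupI)
    fix x assume "x \<in> carrier ?Q"
    then obtain y where "y \<in> carrier M" "x = q y" by (auto simp: c)
    then show "\<exists>z\<in>carrier ?Q. z \<oplus>\<^bsub>?Q\<^esub> x = \<zero>\<^bsub>?Q\<^esub>"
      by (intro bexI[of _ "q (\<ominus>\<^bsub>M\<^esub> y)"]) (auto simp: add c M.l_neg)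
  qed (auto simp: c add M.a_ac)
  then have "module R ?Q"
    by (intro moduleI) (auto simp: c add sm M.R.is_cring M.smult_l_distr M.smult_r_distr M.smult_assoc1)
  then show ?thesis
    by (intro mod_mapI) (auto simp: add sm c M.module_axioms)
qed

section \<open>Direct sums\<close>

lemma dsum_simps:
  "carrier (dsum_mod M N) = carrier M \<times> carrier N" "zero (dsum_mod M N) = (\<zero>\<^bsub>M\<^esub>, \<zero>\<^bsub>N\<^esub>)"
  "(x, y) \<oplus>\<^bsub>dsum_mod M N\<^esub> (x', y') = (x \<oplus>\<^bsub>M\<^esub> x', y \<oplus>\<^bsub>N\<^esub> y')"
  "r \<odot>\<^bsub>dsum_mod M N\<^esub> (x, y) = (r \<odot>\<^bsub>M\<^esub> x, r \<odot>\<^bsub>N\<^esub> y)"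
  by (auto simp: dsum_mod_def)

lemma dsum_module:
  assumes "module R M" "module R N"
  shows "module R (dsum_mod M N)"
proof -
  interpret M: module R M by fact
  interpret N: module R N by fact
  have "abelian_group (dsum_mod M N)"
  proof (rule abelian_groupI)
    fix x assume "x \<in> carrier (dsum_mod M N)"
    then show "\<exists>y\<in>carrier (dsum_mod M N). y \<oplus>\<^bsub>dsum_mod M N\<^esub> x = \<zero>\<^bsub>dsum_mod M N\<^esub>"
      by (intro bexI[of _ "(\<ominus>\<^bsub>M\<^esub> fst x, \<ominus>\<^bsub>N\<^esub> snd x)"]) (auto simp: dsum_simps M.l_neg N.l_neg)
  qed (auto simp: dsum_simps M.a_ac N.a_ac)
  then show ?thesis
    by (intro moduleI) (auto simp: dsum_simps M.R.is_cring M.smult_l_distr M.smult_r_distr M.smult_assoc1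
      N.smult_l_distr N.smult_r_distr N.smult_assoc1)
qed

lemma mod_map_fst: "module R M \<Longrightarrow> module R N \<Longrightarrow> mod_map R (dsum_mod M N) M fst"
  and mod_map_snd: "module R M \<Longrightarrow> module R N \<Longrightarrow> mod_map R (dsum_mod M N) N snd"
  by (rule mod_mapI; auto simp: dsum_simps dsum_module)+

lemma mod_map_pair:
  assumes f: "mod_map R M A f" and g: "mod_map R M B g"
  shows "mod_map R M (dsum_mod A B) (\<lambda>x. (f x, g x))"
  by (rule mod_mapI) (use f g in \<open>auto simp: dsum_simps dsum_module mod_map_modules mod_map_simps[OF f] mod_map_simps[OF g]\<close>)

lemma mod_map_copair:
  assumes f: "mod_map R A N f" and g: "mod_map R B N g"
  shows "mod_map R (dsum_mod A B) N (\<lambda>z. f (fst z) \<oplus>\<^bsub>N\<^esub> g (snd z))"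
  by (intro mod_map_add mod_map_comp[OF _ f] mod_map_comp[OF _ g] mod_map_fst mod_map_snd
    mod_map_modules[OF f] mod_map_modules[OF g])

section \<open>Short exact sequences\<close>

definition ses where
  "ses R A i B p C \<longleftrightarrow> module R A \<and> module R B \<and> module R C \<and> short_exact R A i B p C"

lemma sesI:
  assumes i: "mod_map R A B i" and p: "mod_map R B C p"
    and "\<And>x. x \<in> carrier A \<Longrightarrow> i x = \<zero>\<^bsub>B\<^esub> \<Longrightarrow> x = \<zero>\<^bsub>A\<^esub>"
    and "\<And>x. x \<in> carrier A \<Longrightarrow> p (i x) = \<zero>\<^bsub>C\<^esub>"
    and "\<And>y. y \<in> carrier B \<Longrightarrow> p y = \<zero>\<^bsub>C\<^esub> \<Longrightarrow> \<exists>x \<in> carrier A. y = i x"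
    and "\<And>z. z \<in> carrier C \<Longrightarrow> \<exists>y \<in> carrier B. z = p y"
  shows "ses R A i B p C"
proof -
  interpret A: module R A using i by (simp add: mod_map_def)
  interpret B: module R B using i by (simp add: mod_map_def)
  have "inj_on i (carrier A)"
  proof (rule inj_onI)
    fix x y assume "x \<in> carrier A" "y \<in> carrier A" "i x = i y"
    then have "x \<ominus>\<^bsub>A\<^esub> y = \<zero>\<^bsub>A\<^esub>"
      by (intro assms(3)) (auto simp: mod_map_simps[OF i] B.minus_self)
    with \<open>x \<in> carrier A\<close> \<open>y \<in> carrier A\<close> show "x = y" by (simp add: A.diff_eq_zero)
  qed
  moreover have "i ` carrier A = a_kernel B C p"
    using assms(4,5) mod_map_simps[OF i] by (auto simp: a_kernel_def kernel_def)
  moreover have "p ` carrier B = carrier C"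
    using assms(6) mod_map_simps[OF p] by auto
  ultimately show ?thesis using i p by (auto simp: ses_def short_exact_def mod_map_def)
qed

lemma ses_maps: "ses R A i B p C \<Longrightarrow> mod_map R A B i" "ses R A i B p C \<Longrightarrow> mod_map R B C p"
  by (auto simp: ses_def short_exact_def mod_map_def)

lemma ses_modules:
  "ses R A i B p C \<Longrightarrow> module R A" "ses R A i B p C \<Longrightarrow> module R B" "ses R A i B p C \<Longrightarrow> module R C"
  by (auto simp: ses_def)

lemma ses_inj: "ses R A i B p C \<Longrightarrow> x \<in> carrier A \<Longrightarrow> y \<in> carrier A \<Longrightarrow> i x = i y \<longleftrightarrow> x = y"
  by (auto simp: ses_def short_exact_def dest: inj_onD)

lemma ses_mono_zero:
  assumes "ses R A i B p C" "x \<in> carrier A"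
  shows "i x = \<zero>\<^bsub>B\<^esub> \<longleftrightarrow> x = \<zero>\<^bsub>A\<^esub>"
proof -
  interpret A: module R A using assms by (simp add: ses_def)
  show ?thesis using ses_inj[OF assms(1), of x "\<zero>\<^bsub>A\<^esub>"] assms(2) mod_map_simps(4)[OF ses_maps(1)[OF assms(1)]] by simp
qed

lemma ses_comp: "ses R A i B p C \<Longrightarrow> x \<in> carrier A \<Longrightarrow> p (i x) = \<zero>\<^bsub>C\<^esub>"
  by (auto simp: ses_def short_exact_def a_kernel_def kernel_def)

lemma ses_exactE:
  assumes "ses R A i B p C" "y \<in> carrier B" "p y = \<zero>\<^bsub>C\<^esub>"
  obtains x where "x \<in> carrier A" "y = i x"
  using assms by (auto simp: ses_def short_exact_def a_kernel_def kernel_def set_eq_iff image_iff)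

lemma ses_epiE:
  assumes "ses R A i B p C" "z \<in> carrier C"
  obtains y where "y \<in> carrier B" "z = p y"
  using assms unfolding ses_def short_exact_def by (metis imageE)

lemma ses_epi: "ses R A i B p C \<Longrightarrow> z \<in> carrier C \<Longrightarrow> \<exists>y \<in> carrier B. z = p y"
  by (auto elim: ses_epiE)

lemma ses_exact: "ses R A i B p C \<Longrightarrow> y \<in> carrier B \<Longrightarrow> p y = \<zero>\<^bsub>C\<^esub> \<Longrightarrow> \<exists>x \<in> carrier A. y = i x"
  by (auto elim: ses_exactE)

lemmas ses_simps = mod_map_simps[OF ses_maps(1)] mod_map_simps[OF ses_maps(2)] ses_mono_zero ses_inj ses_comp

lemma ses_kernel:
  assumes "mod_map R M N f" "\<And>z. z \<in> carrier N \<Longrightarrow> \<exists>y \<in> carrier M. z = f y"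
  shows "ses R (ker_mod M N f) (\<lambda>x. x) M f N"
  by (rule sesI) (use assms ker_mod_module[OF assms(1)] in \<open>auto simp: ker_mod_simps\<close>)

text \<open>A quotient of \<open>M\<close> has at most as many elements as \<open>M\<close>, so it can be realised on representatives of
cosets, and no change of the carrier type is needed.\<close>

lemma ses_cokernel_ex:
  fixes M :: "('a, 'b) module" and A :: "('a, 'c) module"
  assumes i: "mod_map R A M i" and inj: "\<And>x. x \<in> carrier A \<Longrightarrow> i x = \<zero>\<^bsub>M\<^esub> \<Longrightarrow> x = \<zero>\<^bsub>A\<^esub>"
  shows "\<exists>(Q :: ('a, 'b) module) q. ses R A i M q Q"
proof -
  interpret M: module R M using i by (simp add: mod_map_def)
  interpret A: module R A using i by (simp add: mod_map_def)
  note i_s = mod_map_simps[OF i]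
  (* q x is the chosen representative of the coset of x *)
  let ?rel = "\<lambda>x y. y \<in> carrier M \<and> (\<exists>a \<in> carrier A. y = x \<oplus>\<^bsub>M\<^esub> i a)"
  define q where "q = (\<lambda>x. SOME y. ?rel x y)"
  have q_ex: "?rel x (q x)" if "x \<in> carrier M" for x
    unfolding q_def by (rule someI[of _ x]) (use that i_s in \<open>auto intro!: bexI[of _ "\<zero>\<^bsub>A\<^esub>"]\<close>)
  have q_eq: "q x = q y \<longleftrightarrow> (\<exists>a \<in> carrier A. x = y \<oplus>\<^bsub>M\<^esub> i a)"
    if xy: "x \<in> carrier M" "y \<in> carrier M" for x y
  proof
    assume "q x = q y"
    then obtain a b where ab: "a \<in> carrier A" "b \<in> carrier A" "x \<oplus>\<^bsub>M\<^esub> i a = y \<oplus>\<^bsub>M\<^esub> i b"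
      using q_ex xy by metis
    have "x = (x \<oplus>\<^bsub>M\<^esub> i a) \<ominus>\<^bsub>M\<^esub> i a"
      by (rule M.add_diff[symmetric]) (use ab xy i_s in auto)
    also have "\<dots> = y \<oplus>\<^bsub>M\<^esub> i (b \<ominus>\<^bsub>A\<^esub> a)" unfolding ab(3) using ab xy i_s by (simp add: a_minus_def M.a_ac)
    finally show "\<exists>a \<in> carrier A. x = y \<oplus>\<^bsub>M\<^esub> i a" using ab by blast
  next
    assume "\<exists>a \<in> carrier A. x = y \<oplus>\<^bsub>M\<^esub> i a"
    then obtain a where a: "a \<in> carrier A" "x = y \<oplus>\<^bsub>M\<^esub> i a" by blast
    have y: "y = x \<oplus>\<^bsub>M\<^esub> i (\<ominus>\<^bsub>A\<^esub> a)" using a xy i_s by (simp add: M.a_assoc M.r_neg)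
    have "?rel x z \<longleftrightarrow> ?rel y z" for z
    proof
      assume "?rel x z"
      then obtain b where "z \<in> carrier M" "b \<in> carrier A" "z = x \<oplus>\<^bsub>M\<^esub> i b" by blast
      then show "?rel y z" using a xy i_s
        by (intro conjI bexI[of _ "a \<oplus>\<^bsub>A\<^esub> b"]) (simp_all add: M.a_assoc)
    next
      assume "?rel y z"
      then obtain b where "z \<in> carrier M" "b \<in> carrier A" "z = y \<oplus>\<^bsub>M\<^esub> i b" by blast
      then show "?rel x z" using a xy i_s
        by (intro conjI bexI[of _ "\<ominus>\<^bsub>A\<^esub> a \<oplus>\<^bsub>A\<^esub> b"]) (simp_all add: M.a_assoc M.r_neg2)
    qed
    then show "q x = q y" unfolding q_def by presburger
  qed
  have q: "mod_map R M (image_mod M q) q"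
  proof (rule image_mod[OF M.module_axioms])
    fix x x' y y' assume "x \<in> carrier M" "x' \<in> carrier M" "y \<in> carrier M" "y' \<in> carrier M" "q x = q x'" "q y = q y'"
    moreover from this obtain a b where "a \<in> carrier A" "b \<in> carrier A" "x = x' \<oplus>\<^bsub>M\<^esub> i a" "y = y' \<oplus>\<^bsub>M\<^esub> i b"
      using q_eq by metis
    ultimately show "q (x \<oplus>\<^bsub>M\<^esub> y) = q (x' \<oplus>\<^bsub>M\<^esub> y')"
      using i_s by (subst q_eq) (auto intro!: bexI[of _ "a \<oplus>\<^bsub>A\<^esub> b"] simp: M.a_ac)
  next
    fix r x x' assume "r \<in> carrier R" "x \<in> carrier M" "x' \<in> carrier M" "q x = q x'"
    moreover from this obtain a where "a \<in> carrier A" "x = x' \<oplus>\<^bsub>M\<^esub> i a" using q_eq by metis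
    ultimately show "q (r \<odot>\<^bsub>M\<^esub> x) = q (r \<odot>\<^bsub>M\<^esub> x')"
      using i_s by (subst q_eq) (auto intro!: bexI[of _ "r \<odot>\<^bsub>A\<^esub> a"] simp: M.smult_r_distr)
  qed
  have z: "zero (image_mod M q) = q \<zero>\<^bsub>M\<^esub>" "carrier (image_mod M q) = q ` carrier M" by (auto simp: image_mod_def)
  have "ses R A i M q (image_mod M q)"
    by (rule sesI[OF i q inj]) (use i_s in \<open>auto simp: z q_eq\<close>)
  then show ?thesis by blast
qed

section \<open>Factoring and lifting linear maps\<close>

lemma factor_through_kernel:
  assumes s: "ses R A i B p C" and h: "mod_map R M B h" and z: "\<And>x. x \<in> carrier M \<Longrightarrow> p (h x) = \<zero>\<^bsub>C\<^esub>"
  shows "\<exists>h'. mod_map R M A h' \<and> (\<forall>x \<in> carrier M. i (h' x) = h x)"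
proof -
  interpret M: module R M using h by (simp add: mod_map_def)
  interpret A: module R A using s by (simp add: ses_def)
  note sm = ses_simps[OF s] mod_map_simps[OF h]
  have "\<exists>a. a \<in> carrier A \<and> i a = h x" if "x \<in> carrier M" for x
    using ses_exactE[OF s _ z] that sm by metis
  then obtain h' where h': "\<And>x. x \<in> carrier M \<Longrightarrow> h' x \<in> carrier A \<and> i (h' x) = h x" by metis
  have "mod_map R M A h'"
  proof (rule mod_mapI)
    fix x y assume "x \<in> carrier M" "y \<in> carrier M"
    then show "h' (x \<oplus>\<^bsub>M\<^esub> y) = h' x \<oplus>\<^bsub>A\<^esub> h' y"
      using h' by (subst ses_inj[OF s, symmetric]) (simp_all add: sm)
  next
    fix r x assume "r \<in> carrier R" "x \<in> carrier M"
    then show "h' (r \<odot>\<^bsub>M\<^esub> x) = r \<odot>\<^bsub>A\<^esub> h' x"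
      using h' by (subst ses_inj[OF s, symmetric]) (simp_all add: sm)
  qed (use h' in \<open>auto simp: M.module_axioms A.module_axioms\<close>)
  with h' show ?thesis by blast
qed

lemma factor_through_epi:
  assumes p: "mod_map R B C p" and epi: "\<And>z. z \<in> carrier C \<Longrightarrow> \<exists>y \<in> carrier B. z = p y"
    and h: "mod_map R B N h" and z: "\<And>x. x \<in> carrier B \<Longrightarrow> p x = \<zero>\<^bsub>C\<^esub> \<Longrightarrow> h x = \<zero>\<^bsub>N\<^esub>"
  shows "\<exists>h'. mod_map R C N h' \<and> (\<forall>x \<in> carrier B. h' (p x) = h x)"
proof -
  interpret B: module R B using h by (simp add: mod_map_def)
  interpret C: module R C using p by (simp add: mod_map_def)
  interpret N: module R N using h by (simp add: mod_map_def)
  note sm = mod_map_simps[OF p] mod_map_simps[OF h]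
  have eq: "h x = h y" if "x \<in> carrier B" "y \<in> carrier B" "p x = p y" for x y
    using z[of "x \<ominus>\<^bsub>B\<^esub> y"] that by (simp add: sm C.minus_self N.diff_eq_zero)
  define h' where "h' = (\<lambda>c. h (SOME x. x \<in> carrier B \<and> c = p x))"
  have h'p: "h' (p x) = h x" if "x \<in> carrier B" for x
  proof -
    have "(SOME y. y \<in> carrier B \<and> p x = p y) \<in> carrier B \<and> p x = p (SOME y. y \<in> carrier B \<and> p x = p y)"
      by (rule someI[of _ x]) (use that in auto)
    then show ?thesis unfolding h'_def using eq that by metis
  qed
  have "mod_map R C N h'"
  proof (rule mod_mapI)
    fix x assume "x \<in> carrier C"
    then obtain x' where "x' \<in> carrier B" "x = p x'" using epi by blast
    then show "h' x \<in> carrier N" by (simp add: h'p sm)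
  next
    fix x y assume "x \<in> carrier C" "y \<in> carrier C"
    then obtain x' y' where "x' \<in> carrier B" "x = p x'" "y' \<in> carrier B" "y = p y'" using epi by meson
    then show "h' (x \<oplus>\<^bsub>C\<^esub> y) = h' x \<oplus>\<^bsub>N\<^esub> h' y"
      using h'p[of "x' \<oplus>\<^bsub>B\<^esub> y'"] by (simp add: h'p sm)
  next
    fix r x assume "r \<in> carrier R" "x \<in> carrier C"
    moreover from this obtain x' where "x' \<in> carrier B" "x = p x'" using epi by blast
    ultimately show "h' (r \<odot>\<^bsub>C\<^esub> x) = r \<odot>\<^bsub>N\<^esub> h' x"
      using h'p[of "r \<odot>\<^bsub>B\<^esub> x'"] by (simp add: h'p sm)
  qed (auto simp: C.module_axioms N.module_axioms)
  with h'p show ?thesis by blast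
qed

lemma factor_through_cokernel:
  assumes s: "ses R A i B p C" and h: "mod_map R B N h" and z: "\<And>x. x \<in> carrier A \<Longrightarrow> h (i x) = \<zero>\<^bsub>N\<^esub>"
  shows "\<exists>h'. mod_map R C N h' \<and> (\<forall>x \<in> carrier B. h' (p x) = h x)"
proof (rule factor_through_epi[OF ses_maps(2)[OF s] _ h])
  show "\<exists>y \<in> carrier B. z = p y" if "z \<in> carrier C" for z using ses_epiE[OF s that] by blast
  show "h x = \<zero>\<^bsub>N\<^esub>" if "x \<in> carrier B" "p x = \<zero>\<^bsub>C\<^esub>" for x
    using ses_exactE[OF s that] z by metis
qed

lemma free_mod_map_ext:
  assumes h: "mod_map R (free_mod R S) N h" and g: "mod_map R (free_mod R S) N g"
    and eq: "\<And>x. x \<in> S \<Longrightarrow> h (free_unit R x) = g (free_unit R x)" and f: "f \<in> carrier (free_mod R S)"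
  shows "h f = g f"
proof -
  interpret N: module R N using h by (simp add: mod_map_def)
  note cr = N.R.is_cring
  obtain ps where ps: "set ps \<subseteq> carrier R \<times> S" "f = lin_comb (free_mod R S) (free_unit R) ps"
    using free_lin_comb_ex[OF cr f] lin_comb_free_UNIV[of R S] by metis
  have *: "k f = lin_comb N (\<lambda>x. k (free_unit R x)) ps" if "mod_map R (free_mod R S) N k" for k
    unfolding ps(2) by (rule lin_comb_hom[OF free_mod_module[OF cr] N.module_axioms _ ps(1)])
      (use that free_unit_closed[OF cr] in \<open>auto simp: mod_map_def\<close>)
  have "lin_comb N (\<lambda>x. h (free_unit R x)) ps = lin_comb N (\<lambda>x. g (free_unit R x)) ps"
    using ps(1) by (induction ps) (auto simp: eq)
  then show ?thesis using *[OF h] *[OF g] by simp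
qed

text \<open>A lift is the linear extension of any choice of preimages of the images of the basis vectors.\<close>

lemma free_mod_projective:
  assumes h: "mod_map R (free_mod R S) Z h" and g: "mod_map R Y Z g"
    and epi: "\<And>z. z \<in> carrier Z \<Longrightarrow> \<exists>y \<in> carrier Y. z = g y"
  shows "\<exists>h'. mod_map R (free_mod R S) Y h' \<and> (\<forall>x \<in> carrier (free_mod R S). g (h' x) = h x)"
proof -
  interpret Y: module R Y using g by (simp add: mod_map_def)
  note cr = Y.R.is_cring
  have "\<exists>y. y \<in> carrier Y \<and> g y = h (free_unit R x)" if "x \<in> S" for x
    using epi[OF mod_map_simps(1)[OF h free_unit_closed[OF cr that]]] by metis
  then obtain b where b: "\<And>x. x \<in> S \<Longrightarrow> b x \<in> carrier Y \<and> g (b x) = h (free_unit R x)" by metis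
  have e: "mod_map R (free_mod R S) Y (free_ext R Y b)"
    using free_ext_hom[OF Y.module_axioms, of S b] b free_mod_module[OF cr] by (auto simp: mod_map_def Y.module_axioms)
  have "g (free_ext R Y b f) = h f" if "f \<in> carrier (free_mod R S)" for f
    by (rule free_mod_map_ext[OF mod_map_comp[OF e g] h _ that])
      (use b free_ext_unit[OF Y.module_axioms, of _ S b] in auto)
  with e show ?thesis by blast
qed

section \<open>Vanishing of the first extension module\<close>

text \<open>Degree \<open>0\<close> of the canonical free resolution, with its augmentation and the kernel of the augmentation.\<close>

definition free_cover :: "('a, 'm) ring_scheme \<Rightarrow> ('a, 'b) module \<Rightarrow> ('a, ('a, 'b) gen \<Rightarrow> 'a) module" where
  "free_cover R U = free_mod R (gens R U 0)"

definition cover_map :: "('a, 'm) ring_scheme \<Rightarrow> ('a, 'b) module \<Rightarrow> (('a, 'b) gen \<Rightarrow> 'a) \<Rightarrow> 'b" where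
  "cover_map R U = free_ext R U gen_aug"

definition syzygy :: "('a, 'm) ring_scheme \<Rightarrow> ('a, 'b) module \<Rightarrow> ('a, ('a, 'b) gen \<Rightarrow> 'a) module" where
  "syzygy R U = ker_mod (free_cover R U) U (cover_map R U)"

lemma ses_syzygy:
  assumes "module R U"
  shows "ses R (syzygy R U) (\<lambda>x. x) (free_cover R U) (cover_map R U) U"
proof -
  interpret U: module R U by fact
  note h = free_res_augmented(2,3)[OF assms]
  have Ob: "Ob (free_res R U) 0 = free_cover R U" by (simp add: free_res_def Let_def free_cover_def)
  show ?thesis unfolding syzygy_def
    by (rule ses_kernel)
      (use h free_mod_module[OF U.R.is_cring] in \<open>auto simp: mod_map_def U.module_axioms Ob free_cover_def cover_map_def\<close>)
qed

lemma free_cover_projective: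
  assumes h: "mod_map R (free_cover R U) Z h" and s: "ses R X j Y g Z"
  shows "\<exists>h'. mod_map R (free_cover R U) Y h' \<and> (\<forall>x \<in> carrier (free_cover R U). g (h' x) = h x)"
  using free_mod_projective[OF h[unfolded free_cover_def] ses_maps(2)[OF s]] ses_epiE[OF s]
  unfolding free_cover_def by metis

text \<open>The usual description of \<open>Ext\<^sup>1(U, A) = 0\<close> by a projective presentation of \<open>U\<close>.  The canonical presentation
has a carrier type determined by that of \<open>U\<close>, so this is one condition that does not quantify over
modules over arbitrary types; it nevertheless yields lifting and extension along short exact sequences
over all types, see \<open>ext1_zero_lift\<close> and \<open>ext1_zero_extend\<close>.\<close>

definition ext1_zero :: "('a, 'm) ring_scheme \<Rightarrow> ('a, 'b) module \<Rightarrow> ('a, 'c) module \<Rightarrow> bool" where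
  "ext1_zero R U A \<longleftrightarrow> module R U \<and> module R A \<and> (\<forall>h. mod_map R (syzygy R U) A h \<longrightarrow>
     (\<exists>g. mod_map R (free_cover R U) A g \<and> (\<forall>x \<in> carrier (syzygy R U). g x = h x)))"

lemma ext1_zeroD:
  assumes "ext1_zero R U A" "mod_map R (syzygy R U) A h"
  obtains g where "mod_map R (free_cover R U) A g" "\<And>x. x \<in> carrier (syzygy R U) \<Longrightarrow> g x = h x"
  using assms by (auto simp: ext1_zero_def)

text \<open>Lift \<open>g\<close> to the free cover of \<open>U\<close>.  On the syzygy the lift takes values in \<open>A\<close>; extend this
restriction to the cover and subtract it.  The difference vanishes on the syzygy, so it descends to \<open>U\<close>.\<close>

lemma ext1_zero_lift:
  assumes e: "ext1_zero R U A" and s: "ses R A i Y q Z" and g: "mod_map R U Z g"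
  shows "\<exists>g'. mod_map R U Y g' \<and> (\<forall>u \<in> carrier U. q (g' u) = g u)"
proof -
  let ?F = "free_cover R U" and ?K = "syzygy R U" and ?a = "cover_map R U"
  interpret Y: module R Y using s by (simp add: ses_def)
  interpret Z: module R Z using s by (simp add: ses_def)
  have t: "ses R ?K (\<lambda>x. x) ?F ?a U" using e by (intro ses_syzygy) (simp add: ext1_zero_def)
  note ss = ses_simps[OF s] ses_simps[OF t] mod_map_simps[OF g]
  obtain l where l: "mod_map R ?F Y l" "\<And>x. x \<in> carrier ?F \<Longrightarrow> q (l x) = g (?a x)"
    using free_cover_projective[OF mod_map_comp[OF ses_maps(2)[OF t] g] s] by blast
  have lK: "mod_map R ?K Y l" by (rule mod_map_comp[OF ses_maps(1)[OF t] l(1)])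
  have "q (l x) = \<zero>\<^bsub>Z\<^esub>" if "x \<in> carrier ?K" for x
    using that l(2) by (simp add: ss)
  then obtain h where h: "mod_map R ?K A h" "\<And>x. x \<in> carrier ?K \<Longrightarrow> i (h x) = l x"
    using factor_through_kernel[OF s lK] by blast
  obtain k where k: "mod_map R ?F A k" "\<And>x. x \<in> carrier ?K \<Longrightarrow> k x = h x"
    using ext1_zeroD[OF e h(1)] by metis
  note mm = mod_map_simps[OF l(1)] mod_map_simps[OF h(1)] mod_map_simps[OF k(1)]
  have d: "mod_map R ?F Y (\<lambda>x. l x \<ominus>\<^bsub>Y\<^esub> i (k x))"
    by (rule mod_map_minus[OF l(1) mod_map_comp[OF k(1) ses_maps(1)[OF s]]])
  have "l x \<ominus>\<^bsub>Y\<^esub> i (k x) = \<zero>\<^bsub>Y\<^esub>" if "x \<in> carrier ?K" for x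
    using that mod_map_simps(1)[OF lK that] by (simp add: k h Y.minus_self)
  then obtain g' where g': "mod_map R U Y g'" "\<And>x. x \<in> carrier ?F \<Longrightarrow> g' (?a x) = l x \<ominus>\<^bsub>Y\<^esub> i (k x)"
    using factor_through_cokernel[OF t d] by blast
  have "q (g' u) = g u" if u: "u \<in> carrier U" for u
  proof -
    obtain f where f: "f \<in> carrier ?F" "u = ?a f" using ses_epiE[OF t u] by blast
    then show ?thesis by (simp add: g' ss mm l(2) a_minus_def)
  qed
  with g' show ?thesis by blast
qed

text \<open>Let \<open>l\<close> lift the free cover \<open>F \<rightarrow> U\<close> to \<open>F \<rightarrow> Y\<close>; it maps the syzygy into \<open>X\<close>.  Then \<open>Y\<close> is the
quotient of \<open>X \<oplus> F\<close> by the elements \<open>(x, f)\<close> with \<open>i x + l f = 0\<close>, so a map on \<open>Y\<close> amounts to \<open>h\<close> on \<open>X\<close>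
and an extension to \<open>F\<close> of the composite of \<open>h\<close> with syzygy \<open>\<rightarrow> X\<close>.\<close>

lemma ext1_zero_extend:
  assumes e: "ext1_zero R U A" and s: "ses R X i Y q U" and h: "mod_map R X A h"
  shows "\<exists>h'. mod_map R Y A h' \<and> (\<forall>x \<in> carrier X. h' (i x) = h x)"
proof -
  let ?F = "free_cover R U" and ?K = "syzygy R U" and ?a = "cover_map R U"
  interpret X: module R X using s by (simp add: ses_def)
  interpret Y: module R Y using s by (simp add: ses_def)
  interpret U: module R U using s by (simp add: ses_def)
  interpret A: module R A using h by (simp add: mod_map_def)
  have t: "ses R ?K (\<lambda>x. x) ?F ?a U" by (intro ses_syzygy U.module_axioms)
  interpret F: module R ?F using t by (simp add: ses_def)
  note ss = ses_simps[OF s] ses_simps[OF t] mod_map_simps[OF h]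
  obtain l where l: "mod_map R ?F Y l" "\<And>x. x \<in> carrier ?F \<Longrightarrow> q (l x) = ?a x"
    using free_cover_projective[OF ses_maps(2)[OF t] s] by blast
  have lK: "mod_map R ?K Y l" by (rule mod_map_comp[OF ses_maps(1)[OF t] l(1)])
  have "q (l x) = \<zero>\<^bsub>U\<^esub>" if "x \<in> carrier ?K" for x
    using that l(2) by (simp add: ss)
  then obtain m where m: "mod_map R ?K X m" "\<And>x. x \<in> carrier ?K \<Longrightarrow> i (m x) = l x"
    using factor_through_kernel[OF s lK] by blast
  obtain k where k: "mod_map R ?F A k" "\<And>x. x \<in> carrier ?K \<Longrightarrow> k x = h (m x)"
    using ext1_zeroD[OF e mod_map_comp[OF m(1) h]] by metis
  note mm = mod_map_simps[OF l(1)] mod_map_simps[OF m(1)] mod_map_simps[OF k(1)]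
  have "x' \<oplus>\<^bsub>X\<^esub> m f = \<zero>\<^bsub>X\<^esub> \<and> f \<in> carrier ?K"
    if x: "x' \<in> carrier X" "f \<in> carrier ?F" "i x' \<oplus>\<^bsub>Y\<^esub> l f = \<zero>\<^bsub>Y\<^esub>" for x' f
  proof -
    have "q (i x' \<oplus>\<^bsub>Y\<^esub> l f) = ?a f" using x(1,2) by (simp add: ss mm l(2))
    then have "?a f = \<zero>\<^bsub>U\<^esub>" unfolding x(3) by (simp add: ss)
    then have f: "f \<in> carrier ?K" by (rule ses_exactE[OF t x(2)]) simp
    then have "i (x' \<oplus>\<^bsub>X\<^esub> m f) = \<zero>\<^bsub>Y\<^esub>" using x by (simp add: ss mm m(2))
    then show ?thesis using f x by (simp add: ses_mono_zero[OF s] mm)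
  qed note ker = this
  have "h x' \<oplus>\<^bsub>A\<^esub> k f = \<zero>\<^bsub>A\<^esub>"
    if x: "x' \<in> carrier X" "f \<in> carrier ?F" "i x' \<oplus>\<^bsub>Y\<^esub> l f = \<zero>\<^bsub>Y\<^esub>" for x' f
  proof -
    have f: "f \<in> carrier ?K" using ker[OF x] by simp
    have "h (x' \<oplus>\<^bsub>X\<^esub> m f) = h x' \<oplus>\<^bsub>A\<^esub> k f" using x(1) f by (simp add: ss mm k(2))
    moreover have "h (x' \<oplus>\<^bsub>X\<^esub> m f) = \<zero>\<^bsub>A\<^esub>" using ker[OF x] by (simp add: ss)
    ultimately show ?thesis by simp
  qed
  moreover have "\<exists>z \<in> carrier X \<times> carrier ?F. y = i (fst z) \<oplus>\<^bsub>Y\<^esub> l (snd z)" if y: "y \<in> carrier Y" for y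
  proof -
    obtain f where f: "f \<in> carrier ?F" "q y = ?a f" using ses_epiE[OF t] y by (metis ss(7))
    then have "q (y \<ominus>\<^bsub>Y\<^esub> l f) = \<zero>\<^bsub>U\<^esub>" using y by (simp add: ss mm l(2) U.minus_self)
    then obtain x where "x \<in> carrier X" "y \<ominus>\<^bsub>Y\<^esub> l f = i x" using ses_exactE[OF s] y f mm by (metis Y.minus_closed)
    moreover have "y = y \<ominus>\<^bsub>Y\<^esub> l f \<oplus>\<^bsub>Y\<^esub> l f" using y f by (simp add: Y.diff_add mm)
    ultimately show ?thesis using f by (intro bexI[of _ "(x, f)"]) auto
  qed
  ultimately obtain h' where h': "mod_map R Y A h'"
      "\<And>z. z \<in> carrier X \<times> carrier ?F \<Longrightarrow> h' (i (fst z) \<oplus>\<^bsub>Y\<^esub> l (snd z)) = h (fst z) \<oplus>\<^bsub>A\<^esub> k (snd z)"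
    using factor_through_epi[OF mod_map_copair[OF ses_maps(1)[OF s] l(1)] _ mod_map_copair[OF h k(1)]]
    by (auto simp: dsum_simps)
  have "h' (i x) = h x" if "x \<in> carrier X" for x
    using h'(2)[of "(x, \<zero>\<^bsub>?F\<^esub>)"] that by (simp add: ss mm)
  with h' show ?thesis by blast
qed

section \<open>Pullbacks\<close>

definition pullback where
  "pullback Y M Z q g = ker_mod (dsum_mod Y M) Z (\<lambda>x. q (fst x) \<ominus>\<^bsub>Z\<^esub> g (snd x))"

lemma pullback:
  assumes q: "mod_map R Y Z q" and g: "mod_map R M Z g"
  shows "carrier (pullback Y M Z q g) = {(y, m). y \<in> carrier Y \<and> m \<in> carrier M \<and> q y = g m}"
    and "zero (pullback Y M Z q g) = (\<zero>\<^bsub>Y\<^esub>, \<zero>\<^bsub>M\<^esub>)"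
    and "mod_map R (pullback Y M Z q g) Y fst" and "mod_map R (pullback Y M Z q g) M snd"
    and "\<And>f h T. mod_map R T Y f \<Longrightarrow> mod_map R T M h \<Longrightarrow> (\<And>x. x \<in> carrier T \<Longrightarrow> q (f x) = g (h x)) \<Longrightarrow>
      mod_map R T (pullback Y M Z q g) (\<lambda>x. (f x, h x))"
proof -
  note md = mod_map_modules[OF q] mod_map_modules[OF g]
  interpret Z: module R Z by (rule md)
  note sm = mod_map_simps[OF q] mod_map_simps[OF g]
  have d: "mod_map R (dsum_mod Y M) Z (\<lambda>x. q (fst x) \<ominus>\<^bsub>Z\<^esub> g (snd x))"
    by (intro mod_map_minus mod_map_comp[OF _ q] mod_map_comp[OF _ g] mod_map_fst mod_map_snd md)
  note k = ker_mod_module[OF d, folded pullback_def]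
  show c: "carrier (pullback Y M Z q g) = {(y, m). y \<in> carrier Y \<and> m \<in> carrier M \<and> q y = g m}"
    by (auto simp: pullback_def ker_mod_simps dsum_simps sm Z.diff_eq_zero)
  show "zero (pullback Y M Z q g) = (\<zero>\<^bsub>Y\<^esub>, \<zero>\<^bsub>M\<^esub>)" by (simp add: pullback_def ker_mod_simps dsum_simps)
  show "mod_map R (pullback Y M Z q g) Y fst" "mod_map R (pullback Y M Z q g) M snd"
    by (intro mod_map_comp[OF k(2)] mod_map_fst mod_map_snd md)+
  show "mod_map R T (pullback Y M Z q g) (\<lambda>x. (f x, h x))"
    if f: "mod_map R T Y f" and h: "mod_map R T M h" and eq: "\<And>x. x \<in> carrier T \<Longrightarrow> q (f x) = g (h x)" for f h T
  proof (rule mod_mapI)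
    show "module R T" by (rule mod_map_modules[OF f])
    show "module R (pullback Y M Z q g)" by (rule k)
  qed (auto simp: c eq mod_map_simps[OF f] mod_map_simps[OF h], auto simp: pullback_def ker_mod_simps dsum_simps)
qed

lemma ses_pullback_snd:
  assumes s: "ses R K j Y q Z" and g: "mod_map R M Z g"
  shows "ses R K (\<lambda>x. (j x, \<zero>\<^bsub>M\<^esub>)) (pullback Y M Z q g) snd M"
proof -
  interpret M: module R M using g by (simp add: mod_map_def)
  interpret K: module R K using s by (simp add: ses_def)
  note q = ses_maps(2)[OF s]
  note sm = ses_simps[OF s] mod_map_simps[OF g]
  show ?thesis
  proof (rule sesI)
    show "mod_map R K (pullback Y M Z q g) (\<lambda>x. (j x, \<zero>\<^bsub>M\<^esub>))"
      by (intro pullback(5)[OF q g] ses_maps(1)[OF s] mod_map_zero) (auto simp: sm K.module_axioms M.module_axioms)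
    show "\<exists>y\<in>carrier (pullback Y M Z q g). z = snd y" if "z \<in> carrier M" for z
      using that ses_epi[OF s, of "g z"] by (force simp: pullback(1)[OF q g] sm)
    show "\<exists>x\<in>carrier K. y = (j x, \<zero>\<^bsub>M\<^esub>)" if "y \<in> carrier (pullback Y M Z q g)" "snd y = \<zero>\<^bsub>M\<^esub>" for y
    proof -
      have y: "fst y \<in> carrier Y" "q (fst y) = \<zero>\<^bsub>Z\<^esub>" using that by (auto simp: pullback(1)[OF q g] sm)
      obtain x where "x \<in> carrier K" "fst y = j x" by (rule ses_exactE[OF s y])
      with that show ?thesis by (intro bexI[of _ x]) (auto simp: prod_eq_iff)
    qed
  qed (auto simp: pullback[OF q g] sm)
qed

lemma ses_pullback_fst:
  assumes s: "ses R K j M g Z" and q: "mod_map R Y Z q"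
  shows "ses R K (\<lambda>x. (\<zero>\<^bsub>Y\<^esub>, j x)) (pullback Y M Z q g) fst Y"
proof -
  interpret Y: module R Y using q by (simp add: mod_map_def)
  interpret K: module R K using s by (simp add: ses_def)
  note g = ses_maps(2)[OF s]
  note sm = ses_simps[OF s] mod_map_simps[OF q]
  show ?thesis
  proof (rule sesI)
    show "mod_map R K (pullback Y M Z q g) (\<lambda>x. (\<zero>\<^bsub>Y\<^esub>, j x))"
      by (intro pullback(5)[OF q g] ses_maps(1)[OF s] mod_map_zero) (auto simp: sm K.module_axioms Y.module_axioms)
    show "\<exists>y\<in>carrier (pullback Y M Z q g). z = fst y" if "z \<in> carrier Y" for z
      using that ses_epi[OF s, of "q z"] by (force simp: pullback(1)[OF q g] sm)
    show "\<exists>x\<in>carrier K. y = (\<zero>\<^bsub>Y\<^esub>, j x)" if "y \<in> carrier (pullback Y M Z q g)" "fst y = \<zero>\<^bsub>Y\<^esub>" for y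
    proof -
      have y: "snd y \<in> carrier M" "g (snd y) = \<zero>\<^bsub>Z\<^esub>" using that by (auto simp: pullback(1)[OF q g] sm)
      obtain x where "x \<in> carrier K" "snd y = j x" by (rule ses_exactE[OF s y])
      with that show ?thesis by (intro bexI[of _ x]) (auto simp: prod_eq_iff)
    qed
  qed (auto simp: pullback[OF q g] sm)
qed

section \<open>Permanence properties of the vanishing condition\<close>

lemma ext1_zeroI:
  assumes "module R U" "module R A"
    "\<And>h. mod_map R (syzygy R U) A h \<Longrightarrow> \<exists>g. mod_map R (free_cover R U) A g \<and> (\<forall>x \<in> carrier (syzygy R U). g x = h x)"
  shows "ext1_zero R U A"
  using assms by (auto simp: ext1_zero_def)

lemma ext1_zero_modules: "ext1_zero R U A \<Longrightarrow> module R U" "ext1_zero R U A \<Longrightarrow> module R A"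
  by (auto simp: ext1_zero_def)

text \<open>From \<open>Hom(U, B) \<rightarrow> Hom(U, C) \<rightarrow> Ext\<^sup>1(U, A) \<rightarrow> Ext\<^sup>1(U, B)\<close>: the middle term vanishes if the first map is
surjective and the last term is zero.\<close>

lemma ext1_zero_kernel:
  assumes s: "ses R A i B p C" and e: "ext1_zero R U B"
    and lift: "\<And>h. mod_map R U C h \<Longrightarrow> \<exists>h'. mod_map R U B h' \<and> (\<forall>x \<in> carrier U. p (h' x) = h x)"
  shows "ext1_zero R U A"
proof (rule ext1_zeroI[OF ext1_zero_modules(1)[OF e] ses_modules(1)[OF s]])
  let ?F = "free_cover R U" and ?K = "syzygy R U" and ?a = "cover_map R U"
  fix h assume h: "mod_map R ?K A h"
  have t: "ses R ?K (\<lambda>x. x) ?F ?a U" by (intro ses_syzygy ext1_zero_modules(1)[OF e])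
  interpret B: module R B using s by (simp add: ses_def)
  interpret C: module R C using s by (simp add: ses_def)
  obtain g where g: "mod_map R ?F B g" "\<And>x. x \<in> carrier ?K \<Longrightarrow> g x = i (h x)"
    using ext1_zeroD[OF e mod_map_comp[OF h ses_maps(1)[OF s]]] by metis
  note sm = ses_simps[OF s] ses_simps[OF t] mod_map_simps[OF h] mod_map_simps[OF g(1)]
  obtain l where l: "mod_map R U C l" "\<And>x. x \<in> carrier ?F \<Longrightarrow> l (?a x) = p (g x)"
    using factor_through_cokernel[OF t mod_map_comp[OF g(1) ses_maps(2)[OF s]]] g(2) sm by metis
  obtain m where m: "mod_map R U B m" "\<And>x. x \<in> carrier U \<Longrightarrow> p (m x) = l x"
    using lift[OF l(1)] by blast
  note mm = mod_map_simps[OF m(1)]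
  have d: "mod_map R ?F B (\<lambda>x. g x \<ominus>\<^bsub>B\<^esub> m (?a x))"
    by (intro mod_map_minus g mod_map_comp[OF ses_maps(2)[OF t] m(1)])
  obtain k where k: "mod_map R ?F A k" "\<And>x. x \<in> carrier ?F \<Longrightarrow> i (k x) = g x \<ominus>\<^bsub>B\<^esub> m (?a x)"
    using factor_through_kernel[OF s d] by (auto simp: sm mm m(2) l(2) C.minus_self)
  have "k x = h x" if x: "x \<in> carrier ?K" for x
  proof -
    have "i (k x) = i (h x)" using x by (simp add: k(2) sm mm g(2) a_minus_def)
    then show ?thesis using x by (simp add: sm mod_map_simps[OF k(1)])
  qed
  with k(1) show "\<exists>g. mod_map R ?F A g \<and> (\<forall>x\<in>carrier ?K. g x = h x)" by blast
qed

text \<open>From \<open>Hom(B, V) \<rightarrow> Hom(A, V) \<rightarrow> Ext\<^sup>1(C, V) \<rightarrow> Ext\<^sup>1(B, V)\<close>.  The free covers of \<open>B\<close> and \<open>C\<close> are unrelated, so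
the proof passes through the pullback of the cover of \<open>C\<close> and \<open>B\<close>, which is an extension of \<open>B\<close> by the
syzygy of \<open>C\<close> and also of the cover by \<open>A\<close>.\<close>

lemma ext1_zero_cokernel:
  assumes s: "ses R A i B p C" and e: "ext1_zero R B V"
    and ext: "\<And>h. mod_map R A V h \<Longrightarrow> \<exists>h'. mod_map R B V h' \<and> (\<forall>x \<in> carrier A. h' (i x) = h x)"
  shows "ext1_zero R C V"
proof (rule ext1_zeroI[OF ses_modules(3)[OF s] ext1_zero_modules(2)[OF e]])
  let ?F = "free_cover R C" and ?K = "syzygy R C" and ?a = "cover_map R C"
  fix h assume h: "mod_map R ?K V h"
  have t: "ses R ?K (\<lambda>x. x) ?F ?a C" by (intro ses_syzygy ses_modules[OF s])
  let ?P = "pullback ?F B C ?a p"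
  interpret V: module R V using h by (simp add: mod_map_def)
  have t1: "ses R ?K (\<lambda>x. (x, \<zero>\<^bsub>B\<^esub>)) ?P snd B" by (rule ses_pullback_snd[OF t ses_maps(2)[OF s]])
  have t2: "ses R A (\<lambda>x. (\<zero>\<^bsub>?F\<^esub>, i x)) ?P fst ?F" by (rule ses_pullback_fst[OF s ses_maps(2)[OF t]])
  obtain g where g: "mod_map R ?P V g" "\<And>x. x \<in> carrier ?K \<Longrightarrow> g (x, \<zero>\<^bsub>B\<^esub>) = h x"
    using ext1_zero_extend[OF e t1 h] by blast
  obtain k where k: "mod_map R B V k" "\<And>x. x \<in> carrier A \<Longrightarrow> k (i x) = g (\<zero>\<^bsub>?F\<^esub>, i x)"
    using ext[OF mod_map_comp[OF ses_maps(1)[OF t2] g(1)]] by blast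
  note sm = ses_simps[OF s] ses_simps[OF t] ses_simps[OF t1] ses_simps[OF t2] mod_map_simps[OF h]
    mod_map_simps[OF g(1)] mod_map_simps[OF k(1)]
  have d: "mod_map R ?P V (\<lambda>x. g x \<ominus>\<^bsub>V\<^esub> k (snd x))"
    by (intro mod_map_minus g mod_map_comp[OF ses_maps(2)[OF t1] k(1)])
  obtain f where f: "mod_map R ?F V f" "\<And>x. x \<in> carrier ?P \<Longrightarrow> f (fst x) = g x \<ominus>\<^bsub>V\<^esub> k (snd x)"
    using factor_through_cokernel[OF t2 d] by (auto simp: k(2) sm V.minus_self)
  have "f x = h x" if x: "x \<in> carrier ?K" for x
    using f(2)[of "(x, \<zero>\<^bsub>B\<^esub>)"] x ses_comp[OF t x] by (simp add: sm g(2) a_minus_def)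
  with f(1) show "\<exists>g. mod_map R ?F V g \<and> (\<forall>x\<in>carrier ?K. g x = h x)" by blast
qed

lemma ext1_zero_extension_right:
  assumes s: "ses R A i B p C" and eA: "ext1_zero R U A" and eC: "ext1_zero R U C"
  shows "ext1_zero R U B"
proof (rule ext1_zeroI[OF ext1_zero_modules(1)[OF eA] ses_modules(2)[OF s]])
  let ?F = "free_cover R U" and ?K = "syzygy R U" and ?a = "cover_map R U"
  fix h assume h: "mod_map R ?K B h"
  have t: "ses R ?K (\<lambda>x. x) ?F ?a U" by (intro ses_syzygy ext1_zero_modules(1)[OF eA])
  interpret B: module R B using s by (simp add: ses_def)
  interpret C: module R C using s by (simp add: ses_def)
  obtain g where g: "mod_map R ?F C g" "\<And>x. x \<in> carrier ?K \<Longrightarrow> g x = p (h x)"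
    using ext1_zeroD[OF eC mod_map_comp[OF h ses_maps(2)[OF s]]] by metis
  obtain l where l: "mod_map R ?F B l" "\<And>x. x \<in> carrier ?F \<Longrightarrow> p (l x) = g x"
    using free_cover_projective[OF g(1) s] by blast
  have d: "mod_map R ?K B (\<lambda>x. h x \<ominus>\<^bsub>B\<^esub> l x)"
    by (intro mod_map_minus h mod_map_comp[OF ses_maps(1)[OF t] l(1)])
  note sm = ses_simps[OF s] ses_simps[OF t] mod_map_simps[OF h] mod_map_simps[OF l(1)]
  obtain m where m: "mod_map R ?K A m" "\<And>x. x \<in> carrier ?K \<Longrightarrow> i (m x) = h x \<ominus>\<^bsub>B\<^esub> l x"
    using factor_through_kernel[OF s d] by (auto simp: sm l(2) g(2) C.minus_self)
  obtain k where k: "mod_map R ?F A k" "\<And>x. x \<in> carrier ?K \<Longrightarrow> k x = m x"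
    using ext1_zeroD[OF eA m(1)] by metis
  have "mod_map R ?F B (\<lambda>x. i (k x) \<oplus>\<^bsub>B\<^esub> l x)"
    by (intro mod_map_add l mod_map_comp[OF k(1) ses_maps(1)[OF s]])
  moreover have "i (k x) \<oplus>\<^bsub>B\<^esub> l x = h x" if "x \<in> carrier ?K" for x
    using that by (simp add: k(2) m(2) sm B.diff_add)
  ultimately show "\<exists>g. mod_map R ?F B g \<and> (\<forall>x\<in>carrier ?K. g x = h x)" by blast
qed

text \<open>Extend in two steps, first from the syzygy of \<open>B\<close> to the preimage of \<open>A\<close> in the free cover of \<open>B\<close>, then to
the whole cover; the successive quotients are \<open>A\<close> and \<open>C\<close>.\<close>

lemma ext1_zero_extension_left:
  assumes s: "ses R A i B p C" and eA: "ext1_zero R A V" and eC: "ext1_zero R C V"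
  shows "ext1_zero R B V"
proof (rule ext1_zeroI[OF ses_modules(2)[OF s] ext1_zero_modules(2)[OF eA]])
  let ?F = "free_cover R B" and ?K = "syzygy R B" and ?a = "cover_map R B"
  fix h assume h: "mod_map R ?K V h"
  have t: "ses R ?K (\<lambda>x. x) ?F ?a B" by (intro ses_syzygy ses_modules[OF s])
  let ?L = "ker_mod ?F C (\<lambda>x. p (?a x))"
  note pa = mod_map_comp[OF ses_maps(2)[OF t] ses_maps(2)[OF s]]
  note sm = ses_simps[OF s] ses_simps[OF t]
  have t1: "ses R ?L (\<lambda>x. x) ?F (\<lambda>x. p (?a x)) C"
  proof (rule ses_kernel[OF pa])
    fix z assume "z \<in> carrier C"
    then obtain y where y: "y \<in> carrier B" "z = p y" by (rule ses_epiE[OF s])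
    obtain f where "f \<in> carrier ?F" "y = ?a f" by (rule ses_epiE[OF t y(1)])
    with y show "\<exists>f\<in>carrier ?F. z = p (?a f)" by blast
  qed
  obtain b where b: "mod_map R ?L A b" "\<And>x. x \<in> carrier ?L \<Longrightarrow> i (b x) = ?a x"
    using factor_through_kernel[OF s mod_map_comp[OF ses_maps(1)[OF t1] ses_maps(2)[OF t]]]
    by (auto simp: ker_mod_simps)
  note bs = mod_map_simps[OF b(1)]
  have b0: "b x = \<zero>\<^bsub>A\<^esub> \<longleftrightarrow> ?a x = \<zero>\<^bsub>B\<^esub>" if "x \<in> carrier ?L" for x
    using that ses_mono_zero[OF s, of "b x"] by (simp add: bs b(2))
  have KL: "x \<in> carrier ?L" if "x \<in> carrier ?K" for x
    using that by (simp add: ker_mod_simps sm)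
  have t2: "ses R ?K (\<lambda>x. x) ?L b A"
  proof (rule sesI[OF _ b(1)])
    show "mod_map R ?K ?L (\<lambda>x. x)"
    proof (rule mod_mapI)
      show "module R ?K" by (rule ses_modules[OF t])
      show "module R ?L" by (rule ses_modules[OF t1])
    qed (auto simp: KL, auto simp: syzygy_def ker_mod_simps)
    show "\<exists>y \<in> carrier ?L. z = b y" if z: "z \<in> carrier A" for z
    proof -
      obtain f where f: "f \<in> carrier ?F" "i z = ?a f" using ses_epiE[OF t] z by (metis sm(1))
      moreover from this z have L: "f \<in> carrier ?L" by (simp add: ker_mod_simps) (metis ses_comp[OF s])
      ultimately have "i (b f) = i z" by (simp add: b)
      with L z show ?thesis by (intro bexI[of _ f]) (simp_all add: sm bs)
    qed
    show "\<exists>x\<in>carrier ?K. y = x" if "y \<in> carrier ?L" "b y = \<zero>\<^bsub>A\<^esub>" for y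
    proof -
      have y: "y \<in> carrier ?F" "?a y = \<zero>\<^bsub>B\<^esub>" using that b0 by (simp_all add: ker_mod_simps)
      show ?thesis by (rule ses_exactE[OF t, OF y]) blast
    qed
    show "b x = \<zero>\<^bsub>A\<^esub>" if "x \<in> carrier ?K" for x
      using that KL[OF that] b0 ses_comp[OF t] by simp
  qed (simp add: syzygy_def ker_mod_simps)
  obtain g where g: "mod_map R ?L V g" "\<And>x. x \<in> carrier ?K \<Longrightarrow> g x = h x"
    using ext1_zero_extend[OF eA t2 h] by blast
  obtain k where k: "mod_map R ?F V k" "\<And>x. x \<in> carrier ?L \<Longrightarrow> k x = g x"
    using ext1_zero_extend[OF eC t1 g(1)] by blast
  show "\<exists>g. mod_map R ?F V g \<and> (\<forall>x\<in>carrier ?K. g x = h x)"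
    using k g KL by metis
qed

text \<open>Direct summands are handled as retracts: the complement is then not mentioned, and with it neither is its
carrier type.\<close>

definition retract where
  "retract R A s r M \<longleftrightarrow> mod_map R A M s \<and> mod_map R M A r \<and> (\<forall>x \<in> carrier A. r (s x) = x)"

lemma ext1_zero_retract_right:
  assumes r: "retract R A s r M" and e: "ext1_zero R U M"
  shows "ext1_zero R U A"
proof (rule ext1_zeroI)
  have s: "mod_map R A M s" using r by (simp add: retract_def)
  show "module R U" using e by (rule ext1_zero_modules)
  show "module R A" using r by (auto simp: retract_def mod_map_def)
  let ?F = "free_cover R U" and ?K = "syzygy R U"
  fix h assume h: "mod_map R ?K A h"
  obtain g where g: "mod_map R ?F M g" "\<And>x. x \<in> carrier ?K \<Longrightarrow> g x = s (h x)"
    using ext1_zeroD[OF e mod_map_comp[OF h s]] by metis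
  show "\<exists>g. mod_map R ?F A g \<and> (\<forall>x\<in>carrier ?K. g x = h x)"
    by (rule exI[of _ "\<lambda>x. r (g x)"]) (use mod_map_comp[OF g(1)] g(2) mod_map_simps[OF h] r in \<open>auto simp: retract_def\<close>)
qed

text \<open>Extend over the pullback of the free cover of \<open>A\<close> along \<open>r\<close>, which has quotient \<open>M\<close>, and restrict along the
section of that pullback given by \<open>s\<close>.\<close>

lemma ext1_zero_retract_left:
  assumes r: "retract R A s r M" and e: "ext1_zero R M V"
  shows "ext1_zero R A V"
proof (rule ext1_zeroI)
  show A: "module R A" using r by (auto simp: retract_def mod_map_def)
  show "module R V" using e by (rule ext1_zero_modules)
  let ?F = "free_cover R A" and ?K = "syzygy R A" and ?a = "cover_map R A"
  fix h assume h: "mod_map R ?K V h"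
  have t: "ses R ?K (\<lambda>x. x) ?F ?a A" by (rule ses_syzygy[OF A])
  have rM: "mod_map R M A r" and sM: "mod_map R A M s" and rs: "\<And>x. x \<in> carrier A \<Longrightarrow> r (s x) = x"
    using r by (auto simp: retract_def)
  let ?P = "pullback ?F M A ?a r"
  have t1: "ses R ?K (\<lambda>x. (x, \<zero>\<^bsub>M\<^esub>)) ?P snd M" by (rule ses_pullback_snd[OF t rM])
  note sm = ses_simps[OF t] mod_map_simps[OF sM]
  obtain g where g: "mod_map R ?P V g" "\<And>x. x \<in> carrier ?K \<Longrightarrow> g (x, \<zero>\<^bsub>M\<^esub>) = h x"
    using ext1_zero_extend[OF e t1 h] by blast
  have "mod_map R ?F ?P (\<lambda>x. (x, s (?a x)))"
    by (intro pullback(5) mod_map_comp[OF ses_maps(2)[OF t]] sM ses_maps[OF t] rM mod_map_id ses_modules[OF t])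
      (simp add: rs sm)
  from mod_map_comp[OF this g(1)]
  show "\<exists>g. mod_map R ?F V g \<and> (\<forall>x\<in>carrier ?K. g x = h x)"
    by (rule exI[of _ "\<lambda>x. g (x, s (?a x))", OF conjI]) (simp add: sm g(2))
qed

section \<open>Isomorphisms and cokernels\<close>

lemma mod_isoI:
  assumes f: "mod_map R M N f" and g: "\<And>y. y \<in> carrier N \<Longrightarrow> g y \<in> carrier M"
    and gf: "\<And>x. x \<in> carrier M \<Longrightarrow> g (f x) = x" and fg: "\<And>y. y \<in> carrier N \<Longrightarrow> f (g y) = y"
  shows "mod_iso R M N"
proof -
  have "bij_betw f (carrier M) (carrier N)"
    by (rule bij_betw_byWitness[of _ g]) (use gf fg g mod_map_simps(1)[OF f] in auto)
  then show ?thesis using f by (auto simp: mod_iso_def mod_map_def)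
qed

text \<open>\<open>N\<close> is allowed to be a bare structure: the module axioms hold in \<open>M\<close> and the bijection carries over what is
needed.  This lets \<open>coker_mod\<close> be used without proving that it is a module.\<close>

lemma mod_iso_sym:
  assumes "module R M" "mod_iso R M N"
  shows "mod_iso R N M"
proof -
  interpret M: module R M by fact
  obtain f where f: "f \<in> mod_hom R M N" "bij_betw f (carrier M) (carrier N)" using assms(2) by (auto simp: mod_iso_def)
  let ?g = "inv_into (carrier M) f"
  have fM: "f (x \<oplus>\<^bsub>M\<^esub> y) = f x \<oplus>\<^bsub>N\<^esub> f y" "f (r \<odot>\<^bsub>M\<^esub> x) = r \<odot>\<^bsub>N\<^esub> f x"
    if "x \<in> carrier M" "y \<in> carrier M" "r \<in> carrier R" for x y r
    using f(1) that by (auto simp: mod_hom_def hom_def)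
  have N: "carrier N = f ` carrier M" using f(2) by (simp add: bij_betw_def)
  have gf: "?g (f x) = x" if "x \<in> carrier M" for x using f(2) that by (simp add: bij_betw_def)
  have "?g (f x \<oplus>\<^bsub>N\<^esub> f y) = x \<oplus>\<^bsub>M\<^esub> y" if "x \<in> carrier M" "y \<in> carrier M" for x y
    using that gf[of "x \<oplus>\<^bsub>M\<^esub> y"] fM(1)[of x y "\<zero>\<^bsub>R\<^esub>"] by simp
  moreover have "?g (r \<odot>\<^bsub>N\<^esub> f x) = r \<odot>\<^bsub>M\<^esub> x" if "x \<in> carrier M" "r \<in> carrier R" for x r
    using that gf[of "r \<odot>\<^bsub>M\<^esub> x"] fM(2)[of x x r] by simp
  ultimately have "?g \<in> mod_hom R N M" by (auto simp: mod_hom_def hom_def N gf)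
  moreover have "bij_betw ?g (carrier N) (carrier M)" using f(2) by (rule bij_betw_inv_into)
  ultimately show ?thesis by (auto simp: mod_iso_def)
qed

lemma mod_iso_trans:
  assumes "mod_iso R M N" "mod_iso R N P"
  shows "mod_iso R M P"
proof -
  obtain f g where f: "f \<in> mod_hom R M N" "bij_betw f (carrier M) (carrier N)"
    and g: "g \<in> mod_hom R N P" "bij_betw g (carrier N) (carrier P)" using assms by (auto simp: mod_iso_def)
  have "g \<circ> f \<in> mod_hom R M P" using f(1) g(1) by (auto simp: mod_hom_def hom_def Pi_def)
  with bij_betw_trans[OF f(2) g(2)] show ?thesis by (auto simp: mod_iso_def)
qed

lemma mod_isoE:
  assumes "module R M" "module R N" "mod_iso R M N"
  obtains f g where "mod_map R M N f" "mod_map R N M g" "\<And>x. x \<in> carrier M \<Longrightarrow> g (f x) = x"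
    "\<And>y. y \<in> carrier N \<Longrightarrow> f (g y) = y"
proof -
  interpret M: module R M by fact
  obtain f where f: "f \<in> mod_hom R M N" "bij_betw f (carrier M) (carrier N)" using assms(3) by (auto simp: mod_iso_def)
  have fm: "mod_map R M N f" using f(1) assms by (simp add: mod_map_def)
  note fs = mod_map_simps[OF fm]
  have N: "carrier N = f ` carrier M" using f(2) by (simp add: bij_betw_def)
  have "x = y" if "x \<in> carrier M" "y \<in> carrier M" "f x = f y" for x y
    using f(2) that by (auto simp: bij_betw_def dest: inj_onD)
  then obtain g where g: "mod_map R N M g" "\<And>x. x \<in> carrier M \<Longrightarrow> g (f x) = x"
    using factor_through_epi[OF fm _ mod_map_id[OF assms(1)]] N fs(4) by (metis (no_types, lifting) M.zero_closed imageE)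
  moreover have "f (g y) = y" if "y \<in> carrier N" for y using that g(2) by (auto simp: N)
  ultimately show ?thesis using that fm by blast
qed

lemma mod_iso_retract:
  assumes "module R M" "module R N" "mod_iso R M N"
  shows "\<exists>s r. retract R M s r N"
  using mod_isoE[OF assms] unfolding retract_def by metis

text \<open>The isomorphism sends an element of \<open>C\<close> to its fibre under \<open>p\<close>, which is a coset of the image of \<open>f\<close>.\<close>

lemma ses_coker_iso:
  assumes s: "ses R A i B p C" and im: "f ` carrier M = i ` carrier A"
  shows "mod_iso R C (coker_mod M B f)"
proof -
  interpret B: module R B using s by (simp add: ses_def)
  interpret C: module R C using s by (simp add: ses_def)
  note ss = ses_simps[OF s]
  let ?H = "i ` carrier A" and ?Q = "coker_mod M B f"
  define \<phi> where "\<phi> = (\<lambda>c. {y \<in> carrier B. p y = c})"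
  have \<phi>: "?H +>\<^bsub>B\<^esub> x = \<phi> (p x)" if x: "x \<in> carrier B" for x
  proof (intro equalityI subsetI)
    fix y assume "y \<in> ?H +>\<^bsub>B\<^esub> x"
    then show "y \<in> \<phi> (p x)" using x by (auto simp: a_r_coset_def' \<phi>_def ss)
  next
    fix y assume "y \<in> \<phi> (p x)"
    then have y: "y \<in> carrier B" "p (y \<ominus>\<^bsub>B\<^esub> x) = \<zero>\<^bsub>C\<^esub>" using x by (auto simp: \<phi>_def ss C.minus_self)
    then obtain a where "a \<in> carrier A" "y \<ominus>\<^bsub>B\<^esub> x = i a" using x ses_exact[OF s, of "y \<ominus>\<^bsub>B\<^esub> x"] by auto
    moreover have "y = y \<ominus>\<^bsub>B\<^esub> x \<oplus>\<^bsub>B\<^esub> x" using x y by (simp add: B.diff_add)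
    ultimately show "y \<in> ?H +>\<^bsub>B\<^esub> x" by (auto simp: a_r_coset_def')
  qed
  have c: "carrier ?Q = \<phi> ` carrier C"
  proof -
    have "carrier ?Q = (\<lambda>x. ?H +>\<^bsub>B\<^esub> x) ` carrier B" by (auto simp: coker_mod_def quot_mod_def A_RCOSETS_def' im)
    also have "\<dots> = \<phi> ` p ` carrier B" using \<phi> by (auto simp: image_image)
    also have "p ` carrier B = carrier C" using s by (simp add: ses_def short_exact_def)
    finally show ?thesis .
  qed
  have ex: "\<exists>x. x \<in> carrier B \<and> z = p x" if "z \<in> carrier C" for z using ses_epi[OF s that] by blast
  have inj: "inj_on \<phi> (carrier C)"
  proof (rule inj_onI)
    fix x y assume "x \<in> carrier C" "y \<in> carrier C" "\<phi> x = \<phi> y"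
    then show "x = y" using ex[of x] unfolding \<phi>_def by auto
  qed
  have add: "\<phi> (x \<oplus>\<^bsub>C\<^esub> y) = \<phi> x \<oplus>\<^bsub>?Q\<^esub> \<phi> y" if "x \<in> carrier C" "y \<in> carrier C" for x y
  proof (intro equalityI subsetI)
    fix u assume "u \<in> \<phi> (x \<oplus>\<^bsub>C\<^esub> y)"
    then have u: "u \<in> carrier B" "p u = x \<oplus>\<^bsub>C\<^esub> y" by (auto simp: \<phi>_def)
    obtain w where w: "w \<in> carrier B" "y = p w" using ex \<open>y \<in> carrier C\<close> by blast
    have "p (u \<ominus>\<^bsub>B\<^esub> w) = x" using u w \<open>x \<in> carrier C\<close> by (simp add: ss C.add_diff)
    moreover have "u = u \<ominus>\<^bsub>B\<^esub> w \<oplus>\<^bsub>B\<^esub> w" using u w by (simp add: B.diff_add)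
    ultimately show "u \<in> \<phi> x \<oplus>\<^bsub>?Q\<^esub> \<phi> y"
      using u w by (auto simp: coker_mod_def quot_mod_def set_add_def' \<phi>_def)
  next
    fix u assume "u \<in> \<phi> x \<oplus>\<^bsub>?Q\<^esub> \<phi> y"
    then show "u \<in> \<phi> (x \<oplus>\<^bsub>C\<^esub> y)" by (auto simp: coker_mod_def quot_mod_def set_add_def' \<phi>_def ss)
  qed
  have sm: "\<phi> (r \<odot>\<^bsub>C\<^esub> x) = r \<odot>\<^bsub>?Q\<^esub> \<phi> x" if r: "r \<in> carrier R" and x: "x \<in> carrier C" for r x
  proof -
    have "r \<odot>\<^bsub>?Q\<^esub> \<phi> x = (\<Union>y \<in> \<phi> x. ?H +>\<^bsub>B\<^esub> (r \<odot>\<^bsub>B\<^esub> y))" by (simp add: coker_mod_def quot_mod_def im)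
    also have "\<dots> = (\<Union>y \<in> \<phi> x. \<phi> (r \<odot>\<^bsub>C\<^esub> x))"
      using r by (intro SUP_cong) (auto simp: \<phi> \<phi>_def ss)
    also have "\<dots> = \<phi> (r \<odot>\<^bsub>C\<^esub> x)" using ex[OF x] by (auto simp: \<phi>_def)
    finally show ?thesis by simp
  qed
  have "\<phi> \<in> mod_hom R C ?Q" by (auto simp: mod_hom_def hom_def c add sm)
  moreover have "bij_betw \<phi> (carrier C) (carrier ?Q)" using inj c by (simp add: bij_betw_def)
  ultimately show ?thesis by (auto simp: mod_iso_def)
qed

lemma ses_iso_right:
  assumes s: "ses R A i B p C" and f: "mod_map R C D f" and g: "mod_map R D C g"
    and gf: "\<And>x. x \<in> carrier C \<Longrightarrow> g (f x) = x" and fg: "\<And>y. y \<in> carrier D \<Longrightarrow> f (g y) = y"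
  shows "ses R A i B (\<lambda>x. f (p x)) D"
proof (rule sesI)
  note sm = ses_simps[OF s] mod_map_simps[OF f] mod_map_simps[OF g]
  show "mod_map R A B i" by (rule ses_maps[OF s])
  show "mod_map R B D (\<lambda>x. f (p x))" by (rule mod_map_comp[OF ses_maps(2)[OF s] f])
  show "\<exists>x\<in>carrier A. y = i x" if "y \<in> carrier B" "f (p y) = \<zero>\<^bsub>D\<^esub>" for y
    using ses_exact[OF s that(1)] gf[of "p y"] that by (simp add: sm)
  show "\<exists>y\<in>carrier B. z = f (p y)" if z: "z \<in> carrier D" for z
    using ses_epi[OF s, of "g z"] fg[OF z] z by (force simp: sm)
qed (simp_all add: ses_simps[OF s] mod_map_simps[OF f])

lemma ses_iso_left:
  assumes s: "ses R A i B p C" and f: "mod_map R D A f" and g: "mod_map R A D g"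
    and gf: "\<And>x. x \<in> carrier D \<Longrightarrow> g (f x) = x" and fg: "\<And>y. y \<in> carrier A \<Longrightarrow> f (g y) = y"
  shows "ses R D (\<lambda>x. i (f x)) B p C"
proof (rule sesI)
  note sm = ses_simps[OF s] mod_map_simps[OF f] mod_map_simps[OF g]
  show "mod_map R D B (\<lambda>x. i (f x))" by (rule mod_map_comp[OF f ses_maps(1)[OF s]])
  show "mod_map R B C p" by (rule ses_maps[OF s])
  show "x = \<zero>\<^bsub>D\<^esub>" if "x \<in> carrier D" "i (f x) = \<zero>\<^bsub>B\<^esub>" for x
    using gf[of x] that by (simp add: sm)
  show "\<exists>x\<in>carrier D. y = i (f x)" if "y \<in> carrier B" "p y = \<zero>\<^bsub>C\<^esub>" for y
    using ses_exact[OF s that] fg sm by metis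
qed (simp_all add: ses_simps[OF s] mod_map_simps[OF f] ses_epi[OF s])

lemma ses_iso_middle:
  assumes s: "ses R A i B p C" and f: "mod_map R B D f" and g: "mod_map R D B g"
    and gf: "\<And>x. x \<in> carrier B \<Longrightarrow> g (f x) = x" and fg: "\<And>y. y \<in> carrier D \<Longrightarrow> f (g y) = y"
  shows "ses R A (\<lambda>x. f (i x)) D (\<lambda>x. p (g x)) C"
proof (rule sesI)
  note sm = ses_simps[OF s] mod_map_simps[OF f] mod_map_simps[OF g]
  show "mod_map R A D (\<lambda>x. f (i x))" by (rule mod_map_comp[OF ses_maps(1)[OF s] f])
  show "mod_map R D C (\<lambda>x. p (g x))" by (rule mod_map_comp[OF g ses_maps(2)[OF s]])
  show "x = \<zero>\<^bsub>A\<^esub>" if "x \<in> carrier A" "f (i x) = \<zero>\<^bsub>D\<^esub>" for x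
  proof -
    have "i x = g (f (i x))" using that(1) by (simp add: gf sm)
    also have "\<dots> = \<zero>\<^bsub>B\<^esub>" unfolding that(2) by (simp add: sm)
    finally show ?thesis using that(1) by (simp add: sm)
  qed
  show "p (g (f (i x))) = \<zero>\<^bsub>C\<^esub>" if "x \<in> carrier A" for x using that by (simp add: gf sm)
  show "\<exists>x\<in>carrier A. y = f (i x)" if "y \<in> carrier D" "p (g y) = \<zero>\<^bsub>C\<^esub>" for y
    using ses_exact[OF s, of "g y"] fg[of y] that by (simp add: sm) metis
  show "\<exists>y\<in>carrier D. z = p (g y)" if z: "z \<in> carrier C" for z
    using ses_epi[OF s z] gf sm by metis
qed

section \<open>Hom complexes and the vanishing of Ext\<close>

lemma Hom_carrier: "module R M \<Longrightarrow> module R N \<Longrightarrow>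
    f \<in> carrier (Hom_mod R M N) \<longleftrightarrow> mod_map R M N f \<and> f \<in> extensional (carrier M)"
  by (simp add: Hom_mod_def mod_map_def)

lemma mod_map_cong:
  assumes f: "mod_map R M N f" and eq: "\<And>x. x \<in> carrier M \<Longrightarrow> g x = f x"
  shows "mod_map R M N g"
proof -
  interpret M: module R M using f by (simp add: mod_map_def)
  show ?thesis by (rule mod_mapI) (auto simp: eq mod_map_simps[OF f] mod_map_modules[OF f])
qed

lemma Hom_into_cycles:
  assumes X: "is_complex R X" and W: "module R W"
  shows "f \<in> cycles (Hom_into_complex R W X) n \<longleftrightarrow> mod_map R W (Ob X n) f \<and> f \<in> extensional (carrier W) \<and>
    (\<forall>x \<in> carrier W. Diff X n (f x) = \<zero>\<^bsub>Ob X (n - 1)\<^esub>)"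
proof -
  have m: "module R (Ob X n)" using X by (simp add: is_complex_def)
  have "compose (carrier W) (Diff X n) f = (\<lambda>x \<in> carrier W. \<zero>\<^bsub>Ob X (n - 1)\<^esub>) \<longleftrightarrow>
      (\<forall>x \<in> carrier W. Diff X n (f x) = \<zero>\<^bsub>Ob X (n - 1)\<^esub>)"
    by (simp add: compose_def restrict_def fun_eq_iff Ball_def)
  then show ?thesis
    by (simp add: cycles_def a_kernel_def' Hom_into_complex_def Hom_carrier[OF W m])
      (auto simp: Hom_mod_def)
qed

lemma Hom_into_boundaries:
  assumes X: "is_complex R X" and W: "module R W"
  shows "f \<in> boundaries (Hom_into_complex R W X) n \<longleftrightarrow> f \<in> extensional (carrier W) \<and>
    (\<exists>g. mod_map R W (Ob X (n + 1)) g \<and> (\<forall>x \<in> carrier W. Diff X (n + 1) (g x) = f x))" (is "?l \<longleftrightarrow> ?r")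
proof
  have m: "module R (Ob X n)" for n using X by (simp add: is_complex_def)
  show ?r if ?l using that
    by (force simp: boundaries_def Hom_into_complex_def Hom_carrier[OF W m] compose_eq)
  show ?l if ?r
  proof -
    from that obtain g where g: "f \<in> extensional (carrier W)" "mod_map R W (Ob X (n + 1)) g"
      "\<And>x. x \<in> carrier W \<Longrightarrow> Diff X (n + 1) (g x) = f x" by blast
    have "restrict g (carrier W) \<in> carrier (Hom_mod R W (Ob X (n + 1)))"
      using mod_map_cong[OF g(2)] by (simp add: Hom_carrier[OF W m])
    moreover have "f = compose (carrier W) (Diff X (n + 1)) (restrict g (carrier W))"
      using g by (auto simp: compose_def fun_eq_iff extensional_def)
    ultimately show ?l by (auto simp: boundaries_def Hom_into_complex_def)
  qed
qed

text \<open>Exactness of the covariant Hom complex in terms of maps on carriers only, without the extensional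
representatives that make up \<open>Hom_mod\<close>.\<close>

lemma exact_Hom_into:
  assumes X: "is_complex R X" and W: "module R W"
  shows "exact (Hom_into_complex R W X) \<longleftrightarrow> (\<forall>n f. mod_map R W (Ob X n) f \<longrightarrow>
    (\<forall>x \<in> carrier W. Diff X n (f x) = \<zero>\<^bsub>Ob X (n - 1)\<^esub>) \<longrightarrow>
    (\<exists>g. mod_map R W (Ob X (n + 1)) g \<and> (\<forall>x \<in> carrier W. Diff X (n + 1) (g x) = f x)))" (is "?l \<longleftrightarrow> ?r")
proof -
  have d: "mod_map R (Ob X n) (Ob X (n - 1)) (Diff X n)" for n using X by (simp add: is_complex_def mod_map_def)
  have dd: "Diff X n (Diff X (n + 1) x) = \<zero>\<^bsub>Ob X (n - 1)\<^esub>" if "x \<in> carrier (Ob X (n + 1))" for x n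
    using X that by (simp add: is_complex_def)
  have bc: "boundaries (Hom_into_complex R W X) n \<subseteq> cycles (Hom_into_complex R W X) n" for n
  proof
    fix f assume "f \<in> boundaries (Hom_into_complex R W X) n"
    then obtain g where g: "f \<in> extensional (carrier W)" "mod_map R W (Ob X (n + 1)) g"
      "\<And>x. x \<in> carrier W \<Longrightarrow> Diff X (n + 1) (g x) = f x" unfolding Hom_into_boundaries[OF X W] by blast
    have "mod_map R W (Ob X n) (\<lambda>x. Diff X (n + 1) (g x))" using mod_map_comp[OF g(2) d] by simp
    then have "mod_map R W (Ob X n) f" by (rule mod_map_cong) (simp add: g)
    moreover have "Diff X n (f x) = \<zero>\<^bsub>Ob X (n - 1)\<^esub>" if "x \<in> carrier W" for x
      using dd[OF mod_map_simps(1)[OF g(2) that]] g(3)[OF that] by simp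
    ultimately show "f \<in> cycles (Hom_into_complex R W X) n" using g(1) by (simp add: Hom_into_cycles[OF X W])
  qed
  show ?thesis
  proof
    assume l: ?l
    show ?r
    proof (intro allI impI)
      fix n f assume f: "mod_map R W (Ob X n) f" "\<forall>x \<in> carrier W. Diff X n (f x) = \<zero>\<^bsub>Ob X (n - 1)\<^esub>"
      have "mod_map R W (Ob X n) (restrict f (carrier W))" by (rule mod_map_cong[OF f(1)]) simp
      then have "restrict f (carrier W) \<in> cycles (Hom_into_complex R W X) n"
        using f(2) by (simp add: Hom_into_cycles[OF X W])
      then have "restrict f (carrier W) \<in> boundaries (Hom_into_complex R W X) n" using l by (simp add: exact_def)
      then show "\<exists>g. mod_map R W (Ob X (n + 1)) g \<and> (\<forall>x \<in> carrier W. Diff X (n + 1) (g x) = f x)"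
        by (auto simp: Hom_into_boundaries[OF X W])
    qed
  next
    assume ?r
    then have "cycles (Hom_into_complex R W X) n \<subseteq> boundaries (Hom_into_complex R W X) n" for n
      unfolding subset_iff Hom_into_cycles[OF X W] Hom_into_boundaries[OF X W] by blast
    then show ?l using bc by (auto simp: exact_def)
  qed
qed

lemma Hom_from_cycles:
  assumes X: "is_complex R X" and W: "module R W"
  shows "f \<in> cycles (Hom_from_complex R X W) (- n) \<longleftrightarrow> mod_map R (Ob X n) W f \<and> f \<in> extensional (carrier (Ob X n)) \<and>
    (\<forall>x \<in> carrier (Ob X (n + 1)). f (Diff X (n + 1) x) = \<zero>\<^bsub>W\<^esub>)"
proof -
  have m: "module R (Ob X n)" using X by (simp add: is_complex_def)
  have "compose (carrier (Ob X (n + 1))) f (Diff X (n + 1)) = (\<lambda>x \<in> carrier (Ob X (n + 1)). \<zero>\<^bsub>W\<^esub>) \<longleftrightarrow>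
      (\<forall>x \<in> carrier (Ob X (n + 1)). f (Diff X (n + 1) x) = \<zero>\<^bsub>W\<^esub>)"
    by (simp add: compose_def restrict_def fun_eq_iff Ball_def)
  moreover have "1 - - n = n + 1" "- (- n - 1) = n + 1" by simp_all
  ultimately show ?thesis
    by (simp add: cycles_def a_kernel_def' Hom_from_complex_def Hom_carrier[OF m W])
      (auto simp: Hom_mod_def add.commute)
qed

lemma Hom_from_boundaries:
  assumes X: "is_complex R X" and W: "module R W"
  shows "f \<in> boundaries (Hom_from_complex R X W) (- n) \<longleftrightarrow> f \<in> extensional (carrier (Ob X n)) \<and>
    (\<exists>g. mod_map R (Ob X (n - 1)) W g \<and> (\<forall>x \<in> carrier (Ob X n). g (Diff X n x) = f x))" (is "?l \<longleftrightarrow> ?r")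
proof -
  have m: "module R (Ob X n)" for n using X by (simp add: is_complex_def)
  have d: "mod_map R (Ob X n) (Ob X (n - 1)) (Diff X n)" using X by (simp add: is_complex_def mod_map_def)
  have eq: "boundaries (Hom_from_complex R X W) (- n) =
      (\<lambda>g. compose (carrier (Ob X n)) g (Diff X n)) ` carrier (Hom_mod R (Ob X (n - 1)) W)"
    by (simp add: boundaries_def Hom_from_complex_def)
  show ?thesis
  proof
    show ?r if ?l using that unfolding eq by (auto simp: Hom_carrier[OF m W] compose_eq)
    show ?l if ?r
    proof -
      from that obtain g where g: "f \<in> extensional (carrier (Ob X n))" "mod_map R (Ob X (n - 1)) W g"
        "\<And>x. x \<in> carrier (Ob X n) \<Longrightarrow> g (Diff X n x) = f x" by blast
      have "restrict g (carrier (Ob X (n - 1))) \<in> carrier (Hom_mod R (Ob X (n - 1)) W)"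
        using mod_map_cong[OF g(2)] by (simp add: Hom_carrier[OF m W])
      moreover have "f = compose (carrier (Ob X n)) (restrict g (carrier (Ob X (n - 1)))) (Diff X n)"
        using g mod_map_simps(1)[OF d] by (auto simp: compose_def fun_eq_iff extensional_def)
      ultimately show ?l unfolding eq by auto
    qed
  qed
qed

lemma Hom_from_boundaries_subset_cycles:
  assumes X: "is_complex R X" and W: "module R W"
  shows "boundaries (Hom_from_complex R X W) (- n) \<subseteq> cycles (Hom_from_complex R X W) (- n)"
proof
  have d: "mod_map R (Ob X n) (Ob X (n - 1)) (Diff X n)" for n using X by (simp add: is_complex_def mod_map_def)
  have dd: "Diff X n (Diff X (n + 1) x) = \<zero>\<^bsub>Ob X (n - 1)\<^esub>" if "x \<in> carrier (Ob X (n + 1))" for x n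
    using X that by (simp add: is_complex_def)
  fix f assume "f \<in> boundaries (Hom_from_complex R X W) (- n)"
  then obtain g where g: "f \<in> extensional (carrier (Ob X n))" "mod_map R (Ob X (n - 1)) W g"
    "\<And>x. x \<in> carrier (Ob X n) \<Longrightarrow> g (Diff X n x) = f x" unfolding Hom_from_boundaries[OF X W] by blast
  have "mod_map R (Ob X n) W f" by (rule mod_map_cong[OF mod_map_comp[OF d g(2)]]) (simp add: g)
  moreover have "f (Diff X (n + 1) x) = \<zero>\<^bsub>W\<^esub>" if "x \<in> carrier (Ob X (n + 1))" for x
    using g(3)[of "Diff X (n + 1) x"] dd[OF that] mod_map_simps(1)[OF d[of "n + 1"] that] mod_map_simps(4)[OF g(2)] by simp
  ultimately show "f \<in> cycles (Hom_from_complex R X W) (- n)" using g(1) by (simp add: Hom_from_cycles[OF X W])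
qed

text \<open>One inclusion in a single degree, because vanishing of \<open>Ext\<^sup>1\<close> gives information about the
Hom complex of the free resolution in degree \<open>- 1\<close> alone.\<close>

lemma Hom_from_cycles_subset_boundaries:
  assumes X: "is_complex R X" and W: "module R W"
  shows "cycles (Hom_from_complex R X W) (- n) \<subseteq> boundaries (Hom_from_complex R X W) (- n) \<longleftrightarrow>
    (\<forall>f. mod_map R (Ob X n) W f \<longrightarrow> (\<forall>x \<in> carrier (Ob X (n + 1)). f (Diff X (n + 1) x) = \<zero>\<^bsub>W\<^esub>) \<longrightarrow>
    (\<exists>g. mod_map R (Ob X (n - 1)) W g \<and> (\<forall>x \<in> carrier (Ob X n). g (Diff X n x) = f x)))" (is "?l \<longleftrightarrow> ?r")
proof
  have d: "mod_map R (Ob X (n + 1)) (Ob X n) (Diff X (n + 1))" using X unfolding is_complex_def mod_map_def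
    by (metis add_diff_cancel_right')
  assume l: ?l
  show ?r
  proof (intro allI impI)
    fix f assume f: "mod_map R (Ob X n) W f" "\<forall>x \<in> carrier (Ob X (n + 1)). f (Diff X (n + 1) x) = \<zero>\<^bsub>W\<^esub>"
    have "mod_map R (Ob X n) W (restrict f (carrier (Ob X n)))" by (rule mod_map_cong[OF f(1)]) simp
    then have "restrict f (carrier (Ob X n)) \<in> cycles (Hom_from_complex R X W) (- n)"
      using f(2) mod_map_simps(1)[OF d] by (simp add: Hom_from_cycles[OF X W])
    then have "restrict f (carrier (Ob X n)) \<in> boundaries (Hom_from_complex R X W) (- n)" using l by blast
    then show "\<exists>g. mod_map R (Ob X (n - 1)) W g \<and> (\<forall>x \<in> carrier (Ob X n). g (Diff X n x) = f x)"
      by (auto simp: Hom_from_boundaries[OF X W])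
  qed
next
  assume ?r
  then show ?l
    unfolding subset_iff Hom_from_cycles[OF X W] Hom_from_boundaries[OF X W] by blast
qed

lemma exact_Hom_from:
  assumes X: "is_complex R X" and W: "module R W"
  shows "exact (Hom_from_complex R X W) \<longleftrightarrow> (\<forall>n f. mod_map R (Ob X n) W f \<longrightarrow>
    (\<forall>x \<in> carrier (Ob X (n + 1)). f (Diff X (n + 1) x) = \<zero>\<^bsub>W\<^esub>) \<longrightarrow>
    (\<exists>g. mod_map R (Ob X (n - 1)) W g \<and> (\<forall>x \<in> carrier (Ob X n). g (Diff X n x) = f x)))"
proof -
  have "exact (Hom_from_complex R X W) \<longleftrightarrow>
      (\<forall>n. boundaries (Hom_from_complex R X W) (- n) = cycles (Hom_from_complex R X W) (- n))"
    unfolding exact_def by (metis minus_minus)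
  also have "\<dots> \<longleftrightarrow> (\<forall>n. cycles (Hom_from_complex R X W) (- n) \<subseteq> boundaries (Hom_from_complex R X W) (- n))"
    using Hom_from_boundaries_subset_cycles[OF X W] by (auto simp: subset_antisym)
  finally show ?thesis unfolding Hom_from_cycles_subset_boundaries[OF X W] .
qed

text \<open>Vanishing of the quotient \<open>Ext R 1 U V\<close> says that cocycles in degree \<open>1\<close> are coboundaries.  The image of the
first differential of the free resolution is the syzygy, so a map \<open>h\<close> on the syzygy composes with
the differential to a cocycle, and writing it as a coboundary extends \<open>h\<close>.\<close>

lemma ext1_zero_Ext:
  fixes U :: "('a, 'b) module" and V :: "('a, 'c) module"
  assumes U: "module R U" and V: "module R V" and Ext: "carrier (Ext R 1 U V) = {\<zero>\<^bsub>Ext R 1 U V\<^esub>}"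
  shows "ext1_zero R U V"
proof (rule ext1_zeroI[OF U V])
  interpret U: module R U by fact
  interpret V: module R V by fact
  let ?X = "free_res R U"
  let ?C = "Hom_from_complex R ?X V"
  have X: "is_complex R ?X" by (rule free_res_complex[OF U.R.is_cring])
  have d: "mod_map R (Ob ?X n) (Ob ?X (n - 1)) (Diff ?X n)" for n using X by (simp add: is_complex_def mod_map_def)
  have m: "module R (Ob ?X n)" for n using X by (simp add: is_complex_def)
  have Ob: "Ob ?X 0 = free_cover R U" by (simp add: free_res_def Let_def free_cover_def)
  have sub: "cycles ?C (- 1) \<subseteq> boundaries ?C (- 1)"
  proof
    fix f assume f: "f \<in> cycles ?C (- 1)"
    then have fm: "mod_map R (Ob ?X 1) V f" "f \<in> extensional (carrier (Ob ?X 1))"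
      by (auto simp: Hom_from_cycles[OF X V])
    let ?z = "\<lambda>x \<in> carrier (Ob ?X 1). \<zero>\<^bsub>V\<^esub>"
    have "?z \<in> boundaries ?C (- 1)"
      unfolding Hom_from_boundaries[OF X V] using mod_map_zero[OF m V]
      by (auto intro!: exI[of _ "\<lambda>x. \<zero>\<^bsub>V\<^esub>"])
    moreover have "?z \<oplus>\<^bsub>Hom_mod R (Ob ?X 1) V\<^esub> f = f"
      using fm mod_map_simps(1)[OF fm(1)] by (auto simp: Hom_mod_def fun_eq_iff extensional_def)
    ultimately have "f \<in> boundaries ?C (- 1) +>\<^bsub>(Ob ?C (- 1))\<lparr>carrier := cycles ?C (- 1)\<rparr>\<^esub> f"
      by (force simp: a_r_coset_def' Hom_from_complex_def)
    moreover have "boundaries ?C (- 1) +>\<^bsub>(Ob ?C (- 1))\<lparr>carrier := cycles ?C (- 1)\<rparr>\<^esub> f \<in> carrier (Ext R 1 U V)"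
      using f by (auto simp: Ext_def homology_def quot_mod_def A_RCOSETS_def')
    moreover have "\<zero>\<^bsub>Ext R 1 U V\<^esub> = boundaries ?C (- 1)" by (simp add: Ext_def homology_def quot_mod_def)
    ultimately show "f \<in> boundaries ?C (- 1)" using Ext by auto
  qed
  fix h assume h: "mod_map R (syzygy R U) V h"
  have K: "carrier (syzygy R U) = Diff ?X 1 ` carrier (Ob ?X 1)"
    using free_res_augmented(1)[OF U] by (simp add: boundaries_def syzygy_def ker_mod_def Ob cover_map_def)
  have dK: "mod_map R (Ob ?X 1) (syzygy R U) (Diff ?X 1)"
  proof (rule mod_mapI[OF m ses_modules(1)[OF ses_syzygy[OF U]]])
    note d1 = mod_map_simps[OF d[of 1]]
    show "Diff ?X 1 (x \<oplus>\<^bsub>Ob ?X 1\<^esub> y) = Diff ?X 1 x \<oplus>\<^bsub>syzygy R U\<^esub> Diff ?X 1 y"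
      if "x \<in> carrier (Ob ?X 1)" "y \<in> carrier (Ob ?X 1)" for x y
      using d1(2)[OF that] by (simp add: syzygy_def ker_mod_simps Ob)
    show "Diff ?X 1 (r \<odot>\<^bsub>Ob ?X 1\<^esub> x) = r \<odot>\<^bsub>syzygy R U\<^esub> Diff ?X 1 x"
      if "r \<in> carrier R" "x \<in> carrier (Ob ?X 1)" for r x
      using d1(3)[OF that] by (simp add: syzygy_def ker_mod_simps Ob)
  qed (simp add: K)
  have z: "\<zero>\<^bsub>syzygy R U\<^esub> = \<zero>\<^bsub>Ob ?X 0\<^esub>" by (simp add: syzygy_def ker_mod_simps Ob)
  have "h (Diff ?X 1 (Diff ?X (1 + 1) x)) = \<zero>\<^bsub>V\<^esub>" if "x \<in> carrier (Ob ?X (1 + 1))" for x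
  proof -
    have "Diff ?X 1 (Diff ?X (1 + 1) x) = \<zero>\<^bsub>Ob ?X (1 - 1)\<^esub>" using X that unfolding is_complex_def by blast
    then show ?thesis using mod_map_simps(4)[OF h] z by simp
  qed
  then obtain g where g: "mod_map R (Ob ?X (1 - 1)) V g" "\<And>x. x \<in> carrier (Ob ?X 1) \<Longrightarrow> g (Diff ?X 1 x) = h (Diff ?X 1 x)"
    using sub[unfolded Hom_from_cycles_subset_boundaries[OF X V], rule_format, OF mod_map_comp[OF dK h]] by blast
  then show "\<exists>g. mod_map R (free_cover R U) V g \<and> (\<forall>x\<in>carrier (syzygy R U). g x = h x)"
    by (intro exI[of _ g]) (auto simp: K Ob)
qed

section \<open>Gorenstein modules by coinduction\<close>

text \<open>One step of resolution to either side, with the remainders in \<open>\<P>\<close>.  The carrier type of \<open>M\<close> is free, whereas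
\<open>\<P>\<close> lives over that of \<open>\<W>\<close>, so that steps can be iterated.\<close>

definition resolvable ::
    "('a, 'm) ring_scheme \<Rightarrow> ('a, 'b) module set \<Rightarrow> ('a, 'b) module set \<Rightarrow> ('a, 'c) module \<Rightarrow> bool" where
  "resolvable R \<W> \<P> M \<longleftrightarrow>
     (\<exists>V \<in> \<W>. \<exists>K \<in> \<P>. \<exists>j p. ses R K j V p M) \<and>
     (\<exists>V \<in> \<W>. \<exists>C \<in> \<P>. \<exists>i q. ses R M i V q C) \<and>
     (\<forall>V \<in> \<W>. ext1_zero R V M \<and> ext1_zero R M V)"

lemma resolvable_module: "resolvable R \<W> \<P> M \<Longrightarrow> module R M"
  by (auto simp: resolvable_def ses_def)

lemma resolvable_mono: "resolvable R \<W> \<P> M \<Longrightarrow> \<P> \<subseteq> \<P>' \<Longrightarrow> resolvable R \<W> \<P>' M"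
  unfolding resolvable_def by blast

lemma resolvable_iso:
  assumes r: "resolvable R \<W> \<P> M" and N: "module R N" and iso: "mod_iso R M N"
  shows "resolvable R \<W> \<P> N"
proof -
  note M = resolvable_module[OF r]
  obtain f g where fg: "mod_map R M N f" "mod_map R N M g" "\<And>x. x \<in> carrier M \<Longrightarrow> g (f x) = x"
    "\<And>y. y \<in> carrier N \<Longrightarrow> f (g y) = y" using mod_isoE[OF M N iso] by blast
  have "retract R N g f M" using fg by (simp add: retract_def)
  then have "\<forall>V \<in> \<W>. ext1_zero R V N \<and> ext1_zero R N V"
    using r ext1_zero_retract_left ext1_zero_retract_right unfolding resolvable_def by blast
  moreover have "\<exists>V \<in> \<W>. \<exists>K \<in> \<P>. \<exists>j p. ses R K j V p N"
    using r ses_iso_right[OF _ fg] unfolding resolvable_def by blast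
  moreover have "\<exists>V \<in> \<W>. \<exists>C \<in> \<P>. \<exists>i q. ses R N i V q C"
    using r ses_iso_left[OF _ fg(2,1,4,3)] unfolding resolvable_def by blast
  ultimately show ?thesis by (simp add: resolvable_def)
qed

text \<open>Dependent choice in both directions.  The chain starts at \<open>- 1\<close> because in an exact complex the cokernel of
\<open>Diff X 1\<close> is isomorphic to the cycles in degree \<open>- 1\<close>.\<close>

lemma biinfinite_chain:
  assumes x: "x \<in> P" and down: "\<And>x. x \<in> P \<Longrightarrow> \<exists>y \<in> P. T y x" and up: "\<And>x. x \<in> P \<Longrightarrow> \<exists>y \<in> P. T x y"
  shows "\<exists>Z :: int \<Rightarrow> 'x. Z (- 1) = x \<and> (\<forall>n. Z n \<in> P \<and> T (Z n) (Z (n - 1)))"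
proof -
  have "\<exists>f. \<forall>n::nat. (f n \<in> P \<and> (n = 0 \<longrightarrow> f n = x)) \<and> T (f (Suc n)) (f n)"
    by (rule dependent_nat_choice) (use x down in auto)
  then obtain f where f: "\<And>n::nat. f n \<in> P" "f 0 = x" "\<And>n. T (f (Suc n)) (f n)" by metis
  have "\<exists>g. \<forall>n::nat. (g n \<in> P \<and> (n = 0 \<longrightarrow> g n = x)) \<and> T (g n) (g (Suc n))"
    by (rule dependent_nat_choice) (use x up in auto)
  then obtain g where g: "\<And>n::nat. g n \<in> P" "g 0 = x" "\<And>n. T (g n) (g (Suc n))" by metis
  define Z where "Z = (\<lambda>n :: int. if n \<ge> - 1 then f (nat (n + 1)) else g (nat (- n - 1)))"
  have "T (Z n) (Z (n - 1))" for n
  proof (cases "n \<ge> 0")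
    case True
    then have "nat (n + 1) = Suc (nat n)" by simp
    with True f(3)[of "nat n"] show ?thesis by (simp add: Z_def)
  next
    case False
    then have "nat (- (n - 1) - 1) = Suc (nat (- n - 1))" by simp
    with False g(3)[of "nat (- n - 1)"] show ?thesis by (auto simp: Z_def f(2) g(2) split: if_splits)
  qed
  then show ?thesis using f g by (intro exI[of _ Z]) (auto simp: Z_def)
qed

text \<open>A map into \<open>V n\<close> killed by the differential factors through \<open>Z n\<close> and lifts along \<open>V (n + 1) \<rightarrow> Z n\<close>; a map
out of \<open>V n\<close> killed by the differential factors through \<open>Z (n - 1)\<close> and extends to \<open>V (n - 1)\<close>.\<close>

lemma totally_acyclic_splice:
  assumes s: "\<And>n. ses R (Z n) (j n) (V n) (p n) (Z (n - 1))" and V: "\<And>n. V n \<in> \<W>"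
    and e: "\<And>n W. W \<in> \<W> \<Longrightarrow> ext1_zero R W (Z n) \<and> ext1_zero R (Z n) W"
  shows "totally_acyclic R \<W> \<lparr>Ob = V, Diff = \<lambda>n x. j (n - 1) (p n x)\<rparr>"
proof -
  let ?X = "\<lparr>Ob = V, Diff = \<lambda>n x. j (n - 1) (p n x)\<rparr>"
  have d: "mod_map R (V n) (V (n - 1)) (\<lambda>x. j (n - 1) (p n x))" for n
    by (rule mod_map_comp[OF ses_maps(2)[OF s] ses_maps(1)[OF s]])
  have s': "ses R (Z (n + 1)) (j (n + 1)) (V (n + 1)) (p (n + 1)) (Z n)" for n using s[of "n + 1"] by simp
  have j0: "j (n - 1) (p n x) = \<zero>\<^bsub>V (n - 1)\<^esub> \<longleftrightarrow> p n x = \<zero>\<^bsub>Z (n - 1)\<^esub>" if "x \<in> carrier (V n)" for n x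
    by (rule ses_mono_zero[OF s mod_map_simps(1)[OF ses_maps(2)[OF s] that]])
  have pj: "p n (j n x) = \<zero>\<^bsub>Z (n - 1)\<^esub>" if "x \<in> carrier (Z n)" for n x by (rule ses_comp[OF s that])
  have jV: "j n x \<in> carrier (V n)" if "x \<in> carrier (Z n)" for n x by (rule mod_map_simps(1)[OF ses_maps(1)[OF s] that])
  have pZ: "p n x \<in> carrier (Z (n - 1))" if "x \<in> carrier (V n)" for n x by (rule mod_map_simps(1)[OF ses_maps(2)[OF s] that])
  have pZ': "p (n + 1) x \<in> carrier (Z n)" if "x \<in> carrier (V (n + 1))" for n x using pZ[OF that] by simp
  have X: "is_complex R ?X"
    using d mod_map_simps(4)[OF ses_maps(1)[OF s]] by (auto simp: is_complex_def mod_map_def j0 pj jV pZ')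
  have "boundaries ?X n = cycles ?X n" for n
  proof -
    have "boundaries ?X n = j n ` p (n + 1) ` carrier (V (n + 1))" by (auto simp: boundaries_def)
    also have "p (n + 1) ` carrier (V (n + 1)) = carrier (Z n)" using s'[of n] by (simp add: ses_def short_exact_def)
    also have "j n ` carrier (Z n) = a_kernel (V n) (Z (n - 1)) (p n)" using s[of n] by (simp add: ses_def short_exact_def)
    also have "\<dots> = cycles ?X n" using j0[of _ n] by (auto simp: cycles_def a_kernel_def')
    finally show ?thesis .
  qed
  then have "exact ?X" by (simp add: exact_def)
  moreover have "exact (Hom_into_complex R W ?X)" if W: "W \<in> \<W>" for W
  proof -
    have Wm: "module R W" using e[OF W] by (auto simp: ext1_zero_def)
    show ?thesis unfolding exact_Hom_into[OF X Wm]
    proof (intro allI impI)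
      fix n f assume f: "mod_map R W (Ob ?X n) f" "\<forall>x\<in>carrier W. Diff ?X n (f x) = \<zero>\<^bsub>Ob ?X (n - 1)\<^esub>"
      then have f1: "mod_map R W (V n) f" by simp
      have "p n (f x) = \<zero>\<^bsub>Z (n - 1)\<^esub>" if "x \<in> carrier W" for x
        using f(2) j0[OF mod_map_simps(1)[OF f1 that]] that by simp
      then obtain f' where f': "mod_map R W (Z n) f'" "\<And>x. x \<in> carrier W \<Longrightarrow> j n (f' x) = f x"
        using factor_through_kernel[OF s f1] by blast
      obtain g where "mod_map R W (V (n + 1)) g" "\<And>x. x \<in> carrier W \<Longrightarrow> p (n + 1) (g x) = f' x"
        using ext1_zero_lift[OF _ s' f'(1)] e[OF W] by blast
      with f'(2) show "\<exists>g. mod_map R W (Ob ?X (n + 1)) g \<and> (\<forall>x\<in>carrier W. Diff ?X (n + 1) (g x) = f x)" by auto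
    qed
  qed
  moreover have "exact (Hom_from_complex R ?X W)" if W: "W \<in> \<W>" for W
  proof -
    have Wm: "module R W" using e[OF W] by (auto simp: ext1_zero_def)
    show ?thesis unfolding exact_Hom_from[OF X Wm]
    proof (intro allI impI)
      fix n f assume f: "mod_map R (Ob ?X n) W f" "\<forall>x\<in>carrier (Ob ?X (n + 1)). f (Diff ?X (n + 1) x) = \<zero>\<^bsub>W\<^esub>"
      then have f1: "mod_map R (V n) W f" by simp
      have "f (j n z) = \<zero>\<^bsub>W\<^esub>" if "z \<in> carrier (Z n)" for z
        using ses_epi[OF s' that] f(2) by auto
      then obtain f' where f': "mod_map R (Z (n - 1)) W f'" "\<And>x. x \<in> carrier (V n) \<Longrightarrow> f' (p n x) = f x"
        using factor_through_cokernel[OF s f1] by blast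
      obtain g where "mod_map R (V (n - 1)) W g" "\<And>x. x \<in> carrier (Z (n - 1)) \<Longrightarrow> g (j (n - 1) x) = f' x"
        using ext1_zero_extend[OF _ s f'(1)] e[OF W] by blast
      with f'(2) show "\<exists>g. mod_map R (Ob ?X (n - 1)) W g \<and> (\<forall>x\<in>carrier (Ob ?X n). g (Diff ?X n x) = f x)"
        by (auto simp: pZ)
    qed
  qed
  ultimately show ?thesis using X V by (simp add: totally_acyclic_def)
qed

text \<open>Iterating the steps gives a two-sided sequence of syzygies and cosyzygies of \<open>M\<close>, which is spliced to a
complex.  The module \<open>M\<close> itself is first replaced by its image in a member of \<open>\<W>\<close>, so that all terms of the
sequence have the same carrier type.\<close>

theorem gorenstein_coinduct:
  fixes \<W> \<P> :: "('a, 'b) module set" and M :: "('a, 'c) module"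
  assumes P: "\<And>A. A \<in> \<P> \<Longrightarrow> resolvable R \<W> \<P> A" and M: "resolvable R \<W> \<P> M"
  shows "M \<in> gorenstein R \<W>"
proof -
  note Mm = resolvable_module[OF M]
  obtain U i q and C :: "('a, 'b) module" where U: "U \<in> \<W>" "ses R M i U q C"
    using M unfolding resolvable_def by blast
  let ?M = "image_mod M i"
  have inj: "i x = i y \<longleftrightarrow> x = y" if "x \<in> carrier M" "y \<in> carrier M" for x y by (rule ses_inj[OF U(2) that])
  have im: "mod_map R M ?M i" by (rule image_mod[OF Mm]) (simp_all add: inj)
  have iso: "mod_iso R M ?M"
    by (rule mod_isoI[OF im, of "inv_into (carrier M) i"])
      (auto simp: image_mod_def inj inv_into_into f_inv_into_f intro!: inv_into_f_f inj_onI)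
  define \<P>' where "\<P>' = insert ?M \<P>"
  have P': "resolvable R \<W> \<P>' A" if "A \<in> \<P>'" for A
    using that P resolvable_iso[OF M mod_map_modules(2)[OF im] iso]
    by (auto simp: \<P>'_def intro: resolvable_mono)
  define T :: "('a, 'b) module \<Rightarrow> ('a, 'b) module \<Rightarrow> bool" where "T = (\<lambda>K A. \<exists>V \<in> \<W>. \<exists>j p. ses R K j V p A)"
  have "\<exists>Z :: int \<Rightarrow> ('a, 'b) module. Z (- 1) = ?M \<and> (\<forall>n. Z n \<in> \<P>' \<and> T (Z n) (Z (n - 1)))"
  proof (rule biinfinite_chain)
    show "?M \<in> \<P>'" by (simp add: \<P>'_def)
    show "\<exists>K \<in> \<P>'. T K A" if "A \<in> \<P>'" for A
      using P'[OF that] unfolding resolvable_def T_def by blast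
    show "\<exists>C \<in> \<P>'. T A C" if "A \<in> \<P>'" for A
      using P'[OF that] unfolding resolvable_def T_def by blast
  qed
  then obtain Z :: "int \<Rightarrow> ('a, 'b) module"
    where Z: "Z (- 1) = ?M" "\<And>n. Z n \<in> \<P>'" "\<And>n. T (Z n) (Z (n - 1))" by blast
  obtain V j p where V: "\<And>n. V n \<in> \<W>" "\<And>n. ses R (Z n) (j n) (V n) (p n) (Z (n - 1))"
    using Z(3) unfolding T_def by metis
  let ?X = "\<lparr>Ob = V, Diff = \<lambda>n x. j (n - 1) (p n x)\<rparr>"
  have X: "totally_acyclic R \<W> ?X"
    by (rule totally_acyclic_splice[where Z = Z, OF V(2) V(1)]) (use P' Z(2) in \<open>auto simp: resolvable_def\<close>)
  have "(\<lambda>x. j 0 (p 1 x)) ` carrier (V 1) = j 0 ` carrier (Z 0)"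
    using V(2)[of 1] by (auto simp: ses_def short_exact_def simp flip: image_image)
  then have "mod_iso R (Z (- 1)) (coker_mod (V 1) (V 0) (\<lambda>x. j 0 (p 1 x)))"
    using ses_coker_iso[OF V(2)[of 0]] by simp
  then have "mod_iso R M (coker_mod (Ob ?X 1) (Ob ?X 0) (Diff ?X 1))"
    using mod_iso_trans[OF iso] Z(1) by simp
  with X Mm show ?thesis by (auto simp: gorenstein_def)
qed

lemma gorenstein_module: "M \<in> gorenstein R \<W> \<Longrightarrow> module R M"
  by (simp add: gorenstein_def)

text \<open>The cycles of a totally acyclic complex supply the short exact sequences; exactness of the Hom complexes
provides the liftings and extensions that shift the vanishing of \<open>Ext\<^sup>1\<close> from \<open>\<W>\<close> to the cycles.
The cycles are Gorenstein modules themselves by coinduction, which avoids reindexing the complex.\<close>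

theorem gorenstein_resolvable:
  fixes \<W> :: "('a, 'b) module set" and M :: "('a, 'c) module"
  assumes W: "\<And>V W. V \<in> \<W> \<Longrightarrow> W \<in> \<W> \<Longrightarrow> ext1_zero R V W" and M: "M \<in> gorenstein R \<W>"
  shows "resolvable R \<W> (gorenstein R \<W> :: ('a, 'b) module set) M"
proof -
  obtain X where X: "totally_acyclic R \<W> X" and iso: "mod_iso R M (coker_mod (Ob X 1) (Ob X 0) (Diff X 1))"
    using M by (auto simp: gorenstein_def)
  have c: "is_complex R X" and V: "\<And>n. Ob X n \<in> \<W>" and ex: "exact X"
    and H: "\<And>W. W \<in> \<W> \<Longrightarrow> exact (Hom_into_complex R W X)" "\<And>W. W \<in> \<W> \<Longrightarrow> exact (Hom_from_complex R X W)"
    using X by (auto simp: totally_acyclic_def)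
  have d: "mod_map R (Ob X n) (Ob X (n - 1)) (Diff X n)" for n using c by (simp add: is_complex_def mod_map_def)
  define Z where "Z = (\<lambda>n. ker_mod (Ob X n) (Ob X (n - 1)) (Diff X n))"
  have Zc: "carrier (Z n) = Diff X (n + 1) ` carrier (Ob X (n + 1))" for n
    using ex by (auto simp: exact_def cycles_def boundaries_def Z_def ker_mod_def)
  have Zi: "mod_map R (Z n) (Ob X n) (\<lambda>x. x)" for n unfolding Z_def by (rule ker_mod_module[OF d])
  have s: "ses R (Z n) (\<lambda>x. x) (Ob X n) (Diff X n) (Z (n - 1))" for n
  proof -
    have Zop: "zero (Z m) = zero (Ob X m)" "add (Z m) = add (Ob X m)" "smult (Z m) = smult (Ob X m)" for m
      by (simp_all add: Z_def ker_mod_simps)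
    have im: "carrier (Z (n - 1)) = Diff X n ` carrier (Ob X n)" using Zc[of "n - 1"] by simp
    show ?thesis
    proof (rule sesI[OF Zi])
      show "mod_map R (Ob X n) (Z (n - 1)) (Diff X n)"
        by (rule mod_mapI) (use mod_map_simps[OF d[of n]] mod_map_modules[OF d] mod_map_modules(1)[OF Zi] in
          \<open>auto simp: im Zop\<close>)
    qed (use Zc in \<open>auto simp: Zop im\<close>, auto simp: Z_def ker_mod_simps)
  qed
  have s': "ses R (Z (n + 1)) (\<lambda>x. x) (Ob X (n + 1)) (Diff X (n + 1)) (Z n)" for n using s[of "n + 1"] by simp
  have e: "ext1_zero R W (Z n) \<and> ext1_zero R (Z n) W" if WW: "W \<in> \<W>" for W n
  proof
    have Wm: "module R W" using W[OF WW WW] by (rule ext1_zero_modules)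
    show "ext1_zero R W (Z n)"
    proof (rule ext1_zero_kernel[OF s W[OF WW V]])
      fix h assume h: "mod_map R W (Z (n - 1)) h"
      have "Diff X (n - 1) (h x) = \<zero>\<^bsub>Ob X (n - 1 - 1)\<^esub>" if "x \<in> carrier W" for x
        using mod_map_simps(1)[OF h that] by (simp add: Z_def ker_mod_simps)
      then show "\<exists>h'. mod_map R W (Ob X n) h' \<and> (\<forall>x\<in>carrier W. Diff X n (h' x) = h x)"
        using H(1)[OF WW, unfolded exact_Hom_into[OF c Wm], rule_format, OF mod_map_comp[OF h Zi]] by simp
    qed
    have "ext1_zero R (Z (n + 1 - 1)) W"
    proof (rule ext1_zero_cokernel[OF s W[OF V WW]])
      fix h assume h: "mod_map R (Z (n + 1)) W h"
      note hd = mod_map_comp[OF ses_maps(2)[OF s'] h]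
      have "h (Diff X (n + 1 + 1) (Diff X (n + 1 + 1 + 1) x)) = \<zero>\<^bsub>W\<^esub>"
        if "x \<in> carrier (Ob X (n + 1 + 1 + 1))" for x
      proof -
        have "Diff X (n + 1 + 1) (Diff X (n + 1 + 1 + 1) x) = \<zero>\<^bsub>Z (n + 1)\<^esub>"
          using ses_comp[OF s', of "Diff X (n + 1 + 1 + 1) x" "n + 1"] mod_map_simps(1)[OF ses_maps(2)[OF s'] that] by simp
        then show ?thesis using mod_map_simps(4)[OF h] by simp
      qed
      then obtain g where g: "mod_map R (Ob X (n + 1 + 1 - 1)) W g"
        "\<And>x. x \<in> carrier (Ob X (n + 1 + 1)) \<Longrightarrow> g (Diff X (n + 1 + 1) x) = h (Diff X (n + 1 + 1) x)"
        using H(2)[OF WW, unfolded exact_Hom_from[OF c Wm], rule_format, OF hd] by blast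
      moreover have "n + 1 + 1 - 1 = n + 1" by simp
      ultimately show "\<exists>h'. mod_map R (Ob X (n + 1)) W h' \<and> (\<forall>x\<in>carrier (Z (n + 1)). h' x = h x)"
        unfolding Zc by (metis (no_types, lifting) imageE)
    qed
    then show "ext1_zero R (Z n) W" by simp
  qed
  have r: "resolvable R \<W> (range Z) (Z n)" for n
    unfolding resolvable_def using s[of n] s'[of n] V e by blast
  have "Z n \<in> gorenstein R \<W>" for n by (rule gorenstein_coinduct[of "range Z"]) (use r in auto)
  then have "range Z \<subseteq> gorenstein R \<W>" by blast
  then have "resolvable R \<W> (gorenstein R \<W> :: ('a, 'b) module set) (Z (- 1))" using r resolvable_mono by blast
  moreover have "mod_iso R (Z (- 1)) M"
  proof -
    have "mod_iso R (Z (- 1)) (coker_mod (Ob X 1) (Ob X 0) (Diff X 1))"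
      using ses_coker_iso[OF s[of 0], of "Diff X 1" "Ob X 1"] Zc[of 0] by simp
    moreover have "mod_iso R (coker_mod (Ob X 1) (Ob X 0) (Diff X 1)) M"
      by (rule mod_iso_sym[OF gorenstein_module[OF M] iso])
    ultimately show ?thesis by (rule mod_iso_trans)
  qed
  ultimately show ?thesis using resolvable_iso gorenstein_module[OF M] by blast
qed

lemma gorenstein_iso:
  assumes "M \<in> gorenstein R \<W>" "module R N" "mod_iso R M N"
  shows "N \<in> gorenstein R \<W>"
  using assms mod_iso_trans[OF mod_iso_sym[OF _ assms(3)]] by (auto simp: gorenstein_def)

section \<open>Realising modules on a given carrier type\<close>

lemma ses_same_epi_iso:
  assumes s: "ses R A i B p C" and s': "ses R A' i' B p C"
  shows "mod_iso R A A'"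
proof -
  obtain u where u: "mod_map R A A' u" "\<And>x. x \<in> carrier A \<Longrightarrow> i' (u x) = i x"
    using factor_through_kernel[OF s' ses_maps(1)[OF s]] ses_comp[OF s] by blast
  obtain v where v: "mod_map R A' A v" "\<And>x. x \<in> carrier A' \<Longrightarrow> i (v x) = i' x"
    using factor_through_kernel[OF s ses_maps(1)[OF s']] ses_comp[OF s'] by blast
  note uv = mod_map_simps(1)[OF u(1)] mod_map_simps(1)[OF v(1)]
  have "v (u x) = x" if "x \<in> carrier A" for x
    using that ses_inj[OF s, of "v (u x)" x] u v uv by simp
  moreover have "u (v x) = x" if "x \<in> carrier A'" for x
    using that ses_inj[OF s', of "u (v x)" x] u v uv by simp
  ultimately show ?thesis by (intro mod_isoI[OF u(1), of v]) (auto simp: uv)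
qed

lemma ses_same_mono_iso:
  assumes s: "ses R A i B p C" and s': "ses R A i B p' C'"
  shows "mod_iso R C C'"
proof -
  obtain u where u: "mod_map R C C' u" "\<And>x. x \<in> carrier B \<Longrightarrow> u (p x) = p' x"
    using factor_through_cokernel[OF s ses_maps(2)[OF s']] ses_comp[OF s'] by blast
  obtain v where v: "mod_map R C' C v" "\<And>x. x \<in> carrier B \<Longrightarrow> v (p' x) = p x"
    using factor_through_cokernel[OF s' ses_maps(2)[OF s]] ses_comp[OF s] by blast
  note uv = mod_map_simps(1)[OF u(1)] mod_map_simps(1)[OF v(1)]
  have "v (u x) = x" if "x \<in> carrier C" for x
    using ses_epi[OF s that] u v by auto
  moreover have "u (v x) = x" if "x \<in> carrier C'" for x
    using ses_epi[OF s' that] u v by auto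
  ultimately show ?thesis by (intro mod_isoI[OF u(1), of v]) (auto simp: uv)
qed

text \<open>A kernel of an epimorphism from \<open>D\<close> is realised inside any copy \<open>V\<close> of \<open>D\<close>; this brings back kernels of
maps on direct sums to the carrier type of \<open>\<W>\<close>.\<close>

lemma ses_realise_kernel:
  fixes V :: "('a, 'v) module"
  assumes s: "ses R K j D p B" and V: "module R V" and iso: "mod_iso R D V"
  shows "\<exists>(K' :: ('a, 'v) module) j' p'. ses R K' j' V p' B \<and> mod_iso R K K'"
proof -
  obtain f g where fg: "mod_map R D V f" "mod_map R V D g" "\<And>x. x \<in> carrier D \<Longrightarrow> g (f x) = x"
    "\<And>y. y \<in> carrier V \<Longrightarrow> f (g y) = y" using mod_isoE[OF ses_modules(2)[OF s] V iso] by blast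
  note s1 = ses_iso_middle[OF s fg]
  note s2 = ses_kernel[OF ses_maps(2)[OF s1] ses_epi[OF s1]]
  show ?thesis using s2 ses_same_epi_iso[OF s1 s2] by blast
qed

lemma ses_realise_cokernel:
  fixes V :: "('a, 'v) module"
  assumes s: "ses R B i D q Q" and V: "module R V" and iso: "mod_iso R D V"
  shows "\<exists>(Q' :: ('a, 'v) module) i' q'. ses R B i' V q' Q' \<and> mod_iso R Q Q'"
proof -
  obtain f g where fg: "mod_map R D V f" "mod_map R V D g" "\<And>x. x \<in> carrier D \<Longrightarrow> g (f x) = x"
    "\<And>y. y \<in> carrier V \<Longrightarrow> f (g y) = y" using mod_isoE[OF ses_modules(2)[OF s] V iso] by blast
  note s1 = ses_iso_middle[OF s fg]
  obtain Q' :: "('a, 'v) module" and q' where s2: "ses R B (\<lambda>x. f (i x)) V q' Q'"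
    using ses_cokernel_ex[OF ses_maps(1)[OF s1]] ses_mono_zero[OF s1] by blast
  show ?thesis using s2 ses_same_mono_iso[OF s1 s2] by blast
qed

section \<open>Horseshoe lemmas\<close>

text \<open>The vanishing of \<open>Ext\<^sup>1\<close> lifts \<open>pC\<close> to a map \<open>VC \<rightarrow> B\<close>, which stands in for projectivity of \<open>VC\<close> in the
classical horseshoe lemma.\<close>

lemma horseshoe_left:
  fixes VA :: "('a, 'v) module" and VC :: "('a, 'w) module"
  assumes s: "ses R A i B p C" and sA: "ses R KA jA VA pA A" and sC: "ses R KC jC VC pC C"
    and e: "ext1_zero R VC A"
  shows "\<exists>(K :: ('a, 'v \<times> 'w) module) j \<pi> \<alpha> \<beta>. ses R K j (dsum_mod VA VC) \<pi> B \<and> ses R KA \<alpha> K \<beta> KC"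
proof -
  interpret B: module R B using s by (simp add: ses_def)
  interpret C: module R C using s by (simp add: ses_def)
  interpret VC: module R VC using sC by (simp add: ses_def)
  interpret VA: module R VA using sA by (simp add: ses_def)
  interpret KA: module R KA using sA by (simp add: ses_def)
  obtain l where l: "mod_map R VC B l" "\<And>x. x \<in> carrier VC \<Longrightarrow> p (l x) = pC x"
    using ext1_zero_lift[OF e s ses_maps(2)[OF sC]] by blast
  note sm = ses_simps[OF s] ses_simps[OF sA] ses_simps[OF sC] mod_map_simps[OF l(1)]
  let ?D = "dsum_mod VA VC"
  define \<pi> where "\<pi> = (\<lambda>z. i (pA (fst z)) \<oplus>\<^bsub>B\<^esub> l (snd z))"
  have \<pi>: "mod_map R ?D B \<pi>" unfolding \<pi>_def
    by (rule mod_map_copair[OF mod_map_comp[OF ses_maps(2)[OF sA] ses_maps(1)[OF s]] l(1)])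
  have \<pi>_epi: "\<exists>z \<in> carrier ?D. b = \<pi> z" if b: "b \<in> carrier B" for b
  proof -
    obtain y where y: "y \<in> carrier VC" "p b = pC y" using ses_epi[OF sC, of "p b"] b sm by auto
    then obtain a where a: "a \<in> carrier A" "b \<ominus>\<^bsub>B\<^esub> l y = i a"
      using ses_exact[OF s, of "b \<ominus>\<^bsub>B\<^esub> l y"] b by (auto simp: sm l(2) C.minus_self)
    obtain x where x: "x \<in> carrier VA" "a = pA x" using ses_epi[OF sA a(1)] by blast
    have "b = b \<ominus>\<^bsub>B\<^esub> l y \<oplus>\<^bsub>B\<^esub> l y" using b y by (simp add: B.diff_add sm)
    then show ?thesis using a x y by (intro bexI[of _ "(x, y)"]) (auto simp: \<pi>_def dsum_simps)
  qed
  let ?K = "ker_mod ?D B \<pi>"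
  have s1: "ses R ?K (\<lambda>x. x) ?D \<pi> B" by (rule ses_kernel[OF \<pi>]) (rule \<pi>_epi)
  have p\<pi>: "p (\<pi> z) = pC (snd z)" if "z \<in> carrier ?D" for z
    using that by (auto simp: \<pi>_def dsum_simps sm l(2))
  have "mod_map R KA ?D (\<lambda>k. (jA k, \<zero>\<^bsub>VC\<^esub>))"
    by (rule mod_map_pair[OF ses_maps(1)[OF sA] mod_map_zero[OF KA.module_axioms VC.module_axioms]])
  from factor_through_kernel[OF s1 this]
  obtain \<alpha> where \<alpha>: "mod_map R KA ?K \<alpha>" "\<And>k. k \<in> carrier KA \<Longrightarrow> \<alpha> k = (jA k, \<zero>\<^bsub>VC\<^esub>)"
    by (auto simp: \<pi>_def sm)
  have "pC (snd z) = \<zero>\<^bsub>C\<^esub>" if "z \<in> carrier ?K" for z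
    using that p\<pi>[of z] by (simp add: ker_mod_simps sm)
  from factor_through_kernel[OF sC mod_map_comp[OF ses_maps(1)[OF s1]
      mod_map_snd[OF VA.module_axioms VC.module_axioms]] this]
  obtain \<beta> where \<beta>: "mod_map R ?K KC \<beta>" "\<And>z. z \<in> carrier ?K \<Longrightarrow> jC (\<beta> z) = snd z" by blast
  have \<beta>0: "\<beta> z = \<zero>\<^bsub>KC\<^esub> \<longleftrightarrow> snd z = \<zero>\<^bsub>VC\<^esub>" if "z \<in> carrier ?K" for z
    using that ses_mono_zero[OF sC, of "\<beta> z"] by (simp add: \<beta>(2) mod_map_simps[OF \<beta>(1)])
  have "ses R KA \<alpha> ?K \<beta> KC"
  proof (rule sesI[OF \<alpha>(1) \<beta>(1)])
    show "x = \<zero>\<^bsub>KA\<^esub>" if "x \<in> carrier KA" "\<alpha> x = \<zero>\<^bsub>?K\<^esub>" for x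
      using that by (simp add: \<alpha>(2) ker_mod_simps dsum_simps sm)
    show "\<beta> (\<alpha> x) = \<zero>\<^bsub>KC\<^esub>" if "x \<in> carrier KA" for x
      using that mod_map_simps(1)[OF \<alpha>(1) that] by (simp add: \<beta>0) (simp add: \<alpha>(2))
    show "\<exists>x\<in>carrier KA. y = \<alpha> x" if y: "y \<in> carrier ?K" "\<beta> y = \<zero>\<^bsub>KC\<^esub>" for y
    proof -
      have y1: "fst y \<in> carrier VA" "snd y = \<zero>\<^bsub>VC\<^esub>" "i (pA (fst y)) = \<zero>\<^bsub>B\<^esub>"
        using y \<beta>0[OF y(1)] by (auto simp: ker_mod_simps dsum_simps \<pi>_def sm)
      then have "pA (fst y) = \<zero>\<^bsub>A\<^esub>" by (simp add: sm)
      from ses_exact[OF sA y1(1) this] show ?thesis using y1 by (auto simp: \<alpha>(2) prod_eq_iff)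
    qed
    show "\<exists>y\<in>carrier ?K. z = \<beta> y" if z: "z \<in> carrier KC" for z
    proof -
      have lz: "l (jC z) \<in> carrier B" "p (l (jC z)) = \<zero>\<^bsub>C\<^esub>" using z by (simp_all add: sm l(2))
      obtain a where a: "a \<in> carrier A" "l (jC z) = i a" using ses_exact[OF s lz] by blast
      obtain w where w: "w \<in> carrier VA" "a = pA w" using ses_epi[OF sA a(1)] by blast
      have k: "(\<ominus>\<^bsub>VA\<^esub> w, jC z) \<in> carrier ?K"
        using w z a by (simp add: ker_mod_simps dsum_simps \<pi>_def sm B.l_neg)
      have "jC (\<beta> (\<ominus>\<^bsub>VA\<^esub> w, jC z)) = jC z" using \<beta>(2)[OF k] by simp
      then show ?thesis using k z mod_map_simps(1)[OF \<beta>(1) k] by (intro bexI[OF _ k]) (simp add: sm)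
    qed
  qed
  with s1 show ?thesis by blast
qed

text \<open>Dually, the embedding of \<open>A\<close> extends to a map \<open>B \<rightarrow> VA\<close>.\<close>

lemma horseshoe_right:
  fixes VA :: "('a, 'v) module" and VC :: "('a, 'w) module"
  assumes s: "ses R A i B p C" and sA: "ses R A a VA pA QA" and sC: "ses R C c VC pC QC"
    and e: "ext1_zero R C VA"
  shows "\<exists>(Q :: ('a, 'v \<times> 'w) module) \<iota> q \<alpha> \<beta>. ses R B \<iota> (dsum_mod VA VC) q Q \<and> ses R QA \<alpha> Q \<beta> QC"
proof -
  interpret VC: module R VC using sC by (simp add: ses_def)
  interpret VA: module R VA using sA by (simp add: ses_def)
  interpret QA: module R QA using sA by (simp add: ses_def)
  obtain l where l: "mod_map R B VA l" "\<And>x. x \<in> carrier A \<Longrightarrow> l (i x) = a x"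
    using ext1_zero_extend[OF e s ses_maps(1)[OF sA]] by blast
  note sm = ses_simps[OF s] ses_simps[OF sA] ses_simps[OF sC] mod_map_simps[OF l(1)]
  let ?D = "dsum_mod VA VC"
  let ?\<iota> = "\<lambda>b. (l b, c (p b))"
  have \<iota>: "mod_map R B ?D ?\<iota>"
    by (intro mod_map_pair l mod_map_comp[OF ses_maps(2)[OF s] ses_maps(1)[OF sC]])
  have "b = \<zero>\<^bsub>B\<^esub>" if b: "b \<in> carrier B" "?\<iota> b = \<zero>\<^bsub>?D\<^esub>" for b
  proof -
    have "l b = \<zero>\<^bsub>VA\<^esub>" "p b = \<zero>\<^bsub>C\<^esub>" using b by (auto simp: dsum_simps sm)
    moreover obtain x where "x \<in> carrier A" "b = i x" using ses_exact[OF s b(1) \<open>p b = \<zero>\<^bsub>C\<^esub>\<close>] by blast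
    ultimately show ?thesis by (simp add: l(2) sm)
  qed
  from ses_cokernel_ex[OF \<iota> this] obtain Q q where s1: "ses R B ?\<iota> ?D q (Q :: ('a, 'v \<times> 'w) module)" by blast
  interpret Q: module R Q using s1 by (simp add: ses_def)
  note sq = ses_simps[OF s1]
  have inl: "mod_map R VA ?D (\<lambda>v. (v, \<zero>\<^bsub>VC\<^esub>))"
    by (rule mod_map_pair[OF mod_map_id[OF VA.module_axioms] mod_map_zero[OF VA.module_axioms VC.module_axioms]])
  have "q (a x, \<zero>\<^bsub>VC\<^esub>) = \<zero>\<^bsub>Q\<^esub>" if "x \<in> carrier A" for x
    using ses_comp[OF s1, of "i x"] that by (simp add: sm l(2))
  from factor_through_cokernel[OF sA mod_map_comp[OF inl ses_maps(2)[OF s1]] this]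
  obtain \<alpha> where \<alpha>: "mod_map R QA Q \<alpha>" "\<And>v. v \<in> carrier VA \<Longrightarrow> \<alpha> (pA v) = q (v, \<zero>\<^bsub>VC\<^esub>)" by blast
  have "pC (snd (?\<iota> b)) = \<zero>\<^bsub>QC\<^esub>" if "b \<in> carrier B" for b using that by (simp add: sm)
  from factor_through_cokernel[OF s1 mod_map_comp[OF mod_map_snd[OF VA.module_axioms VC.module_axioms]
      ses_maps(2)[OF sC]] this]
  obtain \<beta> where \<beta>: "mod_map R Q QC \<beta>" "\<And>z. z \<in> carrier ?D \<Longrightarrow> \<beta> (q z) = pC (snd z)" by blast
  have "ses R QA \<alpha> Q \<beta> QC"
  proof (rule sesI[OF \<alpha>(1) \<beta>(1)])
    show "x = \<zero>\<^bsub>QA\<^esub>" if x: "x \<in> carrier QA" "\<alpha> x = \<zero>\<^bsub>Q\<^esub>" for x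
    proof -
      obtain w where w: "w \<in> carrier VA" "x = pA w" using ses_epi[OF sA x(1)] by blast
      have wD: "(w, \<zero>\<^bsub>VC\<^esub>) \<in> carrier ?D" using w by (simp add: dsum_simps)
      have "q (w, \<zero>\<^bsub>VC\<^esub>) = \<zero>\<^bsub>Q\<^esub>" using x(2) w by (simp add: \<alpha>(2))
      from ses_exact[OF s1 wD this] obtain b where b: "b \<in> carrier B" "w = l b" "\<zero>\<^bsub>VC\<^esub> = c (p b)" by auto
      then have pb: "p b = \<zero>\<^bsub>C\<^esub>" using ses_mono_zero[OF sC, of "p b"] by (simp add: sm)
      obtain y where "y \<in> carrier A" "b = i y" using ses_exact[OF s b(1) pb] by blast
      then show ?thesis using w b by (simp add: l(2) sm)
    qed
    show "\<beta> (\<alpha> x) = \<zero>\<^bsub>QC\<^esub>" if x: "x \<in> carrier QA" for x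
    proof -
      obtain w where w: "w \<in> carrier VA" "x = pA w" using ses_epi[OF sA x(1)] by blast
      then show ?thesis by (simp add: \<alpha>(2) \<beta>(2) dsum_simps sm)
    qed
    show "\<exists>x\<in>carrier QA. y = \<alpha> x" if y: "y \<in> carrier Q" "\<beta> y = \<zero>\<^bsub>QC\<^esub>" for y
    proof -
      obtain v v' where v: "v \<in> carrier VA" "v' \<in> carrier VC" "y = q (v, v')"
        using ses_epi[OF s1 y(1)] by (auto simp: dsum_simps)
      then have "pC v' = \<zero>\<^bsub>QC\<^esub>" using y(2) \<beta>(2)[of "(v, v')"] by (simp add: dsum_simps)
      then obtain z where z: "z \<in> carrier C" "v' = c z" using ses_exact[OF sC v(2)] by blast
      obtain b where b: "b \<in> carrier B" "z = p b" using ses_epi[OF s z(1)] by blast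
      have "(v, v') = (v \<ominus>\<^bsub>VA\<^esub> l b, \<zero>\<^bsub>VC\<^esub>) \<oplus>\<^bsub>?D\<^esub> ?\<iota> b"
        using v b z by (simp add: dsum_simps sm VA.diff_add)
      moreover have "(v \<ominus>\<^bsub>VA\<^esub> l b, \<zero>\<^bsub>VC\<^esub>) \<in> carrier ?D" "?\<iota> b \<in> carrier ?D" using v b by (simp_all add: dsum_simps sm)
      ultimately have "y = q (v \<ominus>\<^bsub>VA\<^esub> l b, \<zero>\<^bsub>VC\<^esub>) \<oplus>\<^bsub>Q\<^esub> q (?\<iota> b)" using sq(8) v(3) by metis
      moreover have "q (?\<iota> b) = \<zero>\<^bsub>Q\<^esub>" by (rule ses_comp[OF s1 b(1)])
      moreover have "\<alpha> (pA (v \<ominus>\<^bsub>VA\<^esub> l b)) = q (v \<ominus>\<^bsub>VA\<^esub> l b, \<zero>\<^bsub>VC\<^esub>)"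
        by (rule \<alpha>(2)) (use v b in \<open>simp add: sm\<close>)
      moreover have "q (v \<ominus>\<^bsub>VA\<^esub> l b, \<zero>\<^bsub>VC\<^esub>) \<in> carrier Q"
        by (rule sq(7)) (use v b in \<open>simp add: dsum_simps sm\<close>)
      ultimately have "y = \<alpha> (pA (v \<ominus>\<^bsub>VA\<^esub> l b))" by simp
      then show ?thesis using v b by (intro bexI[of _ "pA (v \<ominus>\<^bsub>VA\<^esub> l b)"]) (simp_all add: sm)
    qed
    show "\<exists>y\<in>carrier Q. z = \<beta> y" if z: "z \<in> carrier QC" for z
    proof -
      obtain v where v: "v \<in> carrier VC" "z = pC v" using ses_epi[OF sC z] by blast
      have "(\<zero>\<^bsub>VA\<^esub>, v) \<in> carrier ?D" using v by (simp add: dsum_simps)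
      then show ?thesis using v by (intro bexI[of _ "q (\<zero>\<^bsub>VA\<^esub>, v)"]) (simp_all add: \<beta>(2) sq)
    qed
  qed
  with s1 show ?thesis by blast
qed

section \<open>Splittings of short exact sequences\<close>

lemma retract_trans: "retract R A s r M \<Longrightarrow> retract R M s' r' N \<Longrightarrow> retract R A (\<lambda>x. s' (s x)) (\<lambda>x. r (r' x)) N"
  unfolding retract_def by (auto intro: mod_map_comp simp: mod_map_simps(1))

lemma ses_section_retract:
  assumes s: "ses R K i P p V" and t: "mod_map R V P \<sigma>" "\<And>v. v \<in> carrier V \<Longrightarrow> p (\<sigma> v) = v"
  shows "\<exists>r. retract R K i r P"
proof -
  interpret P: module R P using s by (simp add: ses_def)
  interpret V: module R V using s by (simp add: ses_def)
  note sm = ses_simps[OF s] mod_map_simps[OF t(1)]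
  have m: "mod_map R P P (\<lambda>x. x \<ominus>\<^bsub>P\<^esub> \<sigma> (p x))"
    by (intro mod_map_minus mod_map_id P.module_axioms mod_map_comp[OF ses_maps(2)[OF s] t(1)])
  obtain r where r: "mod_map R P K r" "\<And>x. x \<in> carrier P \<Longrightarrow> i (r x) = x \<ominus>\<^bsub>P\<^esub> \<sigma> (p x)"
    using factor_through_kernel[OF s m] by (auto simp: sm t(2) V.minus_self)
  have "r (i k) = k" if "k \<in> carrier K" for k
  proof -
    have "i (r (i k)) = i k" using that by (simp add: r(2) sm a_minus_def)
    then show ?thesis using that ses_inj[OF s] mod_map_simps(1)[OF r(1)] by (simp add: sm)
  qed
  then show ?thesis using r(1) ses_maps(1)[OF s] by (auto simp: retract_def)
qed

lemma ses_retraction_retract: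
  assumes s: "ses R V i P p C" and t: "mod_map R P V \<rho>" "\<And>v. v \<in> carrier V \<Longrightarrow> \<rho> (i v) = v"
  shows "\<exists>s. retract R C s p P"
proof -
  interpret P: module R P using s by (simp add: ses_def)
  interpret C: module R C using s by (simp add: ses_def)
  note sm = ses_simps[OF s] mod_map_simps[OF t(1)]
  have m: "mod_map R P P (\<lambda>x. x \<ominus>\<^bsub>P\<^esub> i (\<rho> x))"
    by (intro mod_map_minus mod_map_id P.module_axioms mod_map_comp[OF t(1) ses_maps(1)[OF s]])
  obtain t' where t': "mod_map R C P t'" "\<And>x. x \<in> carrier P \<Longrightarrow> t' (p x) = x \<ominus>\<^bsub>P\<^esub> i (\<rho> x)"
    using factor_through_cokernel[OF s m] by (auto simp: sm t(2) P.minus_self)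
  have "p (t' c) = c" if c: "c \<in> carrier C" for c
  proof -
    obtain x where x: "x \<in> carrier P" "c = p x" using ses_epi[OF s c] by blast
    then show ?thesis by (simp add: t'(2) sm) (simp add: a_minus_def sm)
  qed
  then show ?thesis using t'(1) ses_maps(2)[OF s] by (auto simp: retract_def)
qed

section \<open>Pushouts\<close>

text \<open>The quotient of \<open>V \<oplus> N\<close> by the elements \<open>(a x, - f x)\<close>, as an extension in two ways.\<close>

lemma pushout:
  fixes V :: "('a, 'v) module" and N :: "('a, 'n) module"
  assumes s: "ses R M f N g C" and t: "ses R M a V c M'"
  shows "\<exists>(P :: ('a, 'v \<times> 'n) module) \<iota> \<kappa> \<mu> \<nu>. ses R N \<iota> P \<kappa> M' \<and> ses R V \<mu> P \<nu> C"
proof -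
  interpret M: module R M using s by (simp add: ses_def)
  interpret N: module R N using s by (simp add: ses_def)
  interpret V: module R V using t by (simp add: ses_def)
  interpret C: module R C using s by (simp add: ses_def)
  note sm = ses_simps[OF s] ses_simps[OF t]
  let ?D = "dsum_mod V N"
  let ?d = "\<lambda>x. (a x, \<zero>\<^bsub>N\<^esub> \<ominus>\<^bsub>N\<^esub> f x)"
  have d: "mod_map R M ?D ?d"
    by (intro mod_map_pair ses_maps[OF t] mod_map_minus mod_map_zero ses_maps[OF s] M.module_axioms N.module_axioms)
  have "x = \<zero>\<^bsub>M\<^esub>" if "x \<in> carrier M" "?d x = \<zero>\<^bsub>?D\<^esub>" for x
    using that by (auto simp: dsum_simps sm)
  from ses_cokernel_ex[OF d this] obtain P :: "('a, 'v \<times> 'n) module" and q where q: "ses R M ?d ?D q P" by blast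
  interpret P: module R P using q by (simp add: ses_def)
  have q_eq: "q (v, n) = q (v', n')" if "v \<in> carrier V" "v' \<in> carrier V" "n \<in> carrier N" "n' \<in> carrier N"
    "x \<in> carrier M" "v = v' \<oplus>\<^bsub>V\<^esub> a x" "n \<oplus>\<^bsub>N\<^esub> f x = n'" for v v' n n' x
  proof -
    have "(v, n) = (v', n') \<oplus>\<^bsub>?D\<^esub> ?d x" 
      using that by (auto simp: dsum_simps sm a_minus_def N.a_assoc N.r_neg)
    moreover have "(v', n') \<in> carrier ?D" "?d x \<in> carrier ?D" using that by (auto simp: dsum_simps sm)
    ultimately have "q (v, n) = q (v', n') \<oplus>\<^bsub>P\<^esub> q (?d x)" using mod_map_simps(2)[OF ses_maps(2)[OF q]] by metis
    moreover have "q (v', n') \<in> carrier P" using that by (intro mod_map_simps(1)[OF ses_maps(2)[OF q]]) (simp add: dsum_simps)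
    ultimately show ?thesis using ses_comp[OF q \<open>x \<in> carrier M\<close>] by simp
  qed
  have q_zero: "\<exists>x \<in> carrier M. v = a x \<and> n = \<zero>\<^bsub>N\<^esub> \<ominus>\<^bsub>N\<^esub> f x"
    if "v \<in> carrier V" "n \<in> carrier N" "q (v, n) = \<zero>\<^bsub>P\<^esub>" for v n
    using ses_exact[OF q, of "(v, n)"] that by (auto simp: dsum_simps)
  have inr: "mod_map R N ?D (\<lambda>n. (\<zero>\<^bsub>V\<^esub>, n))" and inl: "mod_map R V ?D (\<lambda>v. (v, \<zero>\<^bsub>N\<^esub>))"
    by (intro mod_map_pair mod_map_id mod_map_zero V.module_axioms N.module_axioms)+
  note \<iota> = mod_map_comp[OF inr ses_maps(2)[OF q]] and \<mu> = mod_map_comp[OF inl ses_maps(2)[OF q]]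
  have "c (fst (?d x)) = \<zero>\<^bsub>M'\<^esub>" if "x \<in> carrier M" for x using that by (simp add: sm)
  from factor_through_cokernel[OF q mod_map_comp[OF mod_map_fst[OF V.module_axioms N.module_axioms] ses_maps(2)[OF t]] this]
  obtain \<kappa> where \<kappa>: "mod_map R P M' \<kappa>" "\<And>z. z \<in> carrier ?D \<Longrightarrow> \<kappa> (q z) = c (fst z)" by blast
  have "g (snd (?d x)) = \<zero>\<^bsub>C\<^esub>" if "x \<in> carrier M" for x
    using that by (simp add: sm C.minus_self)
  from factor_through_cokernel[OF q mod_map_comp[OF mod_map_snd[OF V.module_axioms N.module_axioms] ses_maps(2)[OF s]] this]
  obtain \<nu> where \<nu>: "mod_map R P C \<nu>" "\<And>z. z \<in> carrier ?D \<Longrightarrow> \<nu> (q z) = g (snd z)" by blast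
  have "ses R N (\<lambda>n. q (\<zero>\<^bsub>V\<^esub>, n)) P \<kappa> M'"
  proof (rule sesI[OF \<iota> \<kappa>(1)])
    show "n = \<zero>\<^bsub>N\<^esub>" if n: "n \<in> carrier N" "q (\<zero>\<^bsub>V\<^esub>, n) = \<zero>\<^bsub>P\<^esub>" for n
    proof -
      obtain x where x: "x \<in> carrier M" "\<zero>\<^bsub>V\<^esub> = a x" "n = \<zero>\<^bsub>N\<^esub> \<ominus>\<^bsub>N\<^esub> f x" using q_zero[OF V.zero_closed n] by blast
      from x(2)[symmetric] have "x = \<zero>\<^bsub>M\<^esub>" using x(1) by (simp add: sm)
      with x(3) show ?thesis by (simp add: sm N.minus_self)
    qed
    show "\<exists>x\<in>carrier N. y = q (\<zero>\<^bsub>V\<^esub>, x)" if y: "y \<in> carrier P" "\<kappa> y = \<zero>\<^bsub>M'\<^esub>" for y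
    proof -
      obtain v n where v: "v \<in> carrier V" "n \<in> carrier N" "y = q (v, n)"
        using ses_epi[OF q y(1)] by (auto simp: dsum_simps)
      then have "c v = \<zero>\<^bsub>M'\<^esub>" using y(2) \<kappa>(2)[of "(v, n)"] by (simp add: dsum_simps)
      then obtain x where x: "x \<in> carrier M" "v = a x" using ses_exact[OF t v(1)] by blast
      have "y = q (\<zero>\<^bsub>V\<^esub>, n \<oplus>\<^bsub>N\<^esub> f x)" unfolding v(3) by (rule q_eq[OF _ _ _ _ x(1)]) (use x v in \<open>auto simp: sm\<close>)
      then show ?thesis using v x by (intro bexI[of _ "n \<oplus>\<^bsub>N\<^esub> f x"]) (auto simp: sm)
    qed
    show "\<exists>y\<in>carrier P. z = \<kappa> y" if z: "z \<in> carrier M'" for z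
    proof -
      obtain v where "v \<in> carrier V" "z = c v" using ses_epi[OF t z] by blast
      then show ?thesis using mod_map_simps(1)[OF \<mu>] by (intro bexI[of _ "q (v, \<zero>\<^bsub>N\<^esub>)"]) (auto simp: \<kappa>(2) dsum_simps)
    qed
  qed (simp add: \<kappa>(2) dsum_simps sm)
  moreover have "ses R V (\<lambda>v. q (v, \<zero>\<^bsub>N\<^esub>)) P \<nu> C"
  proof (rule sesI[OF \<mu> \<nu>(1)])
    show "v = \<zero>\<^bsub>V\<^esub>" if v: "v \<in> carrier V" "q (v, \<zero>\<^bsub>N\<^esub>) = \<zero>\<^bsub>P\<^esub>" for v
    proof -
      obtain x where x: "x \<in> carrier M" "v = a x" "\<zero>\<^bsub>N\<^esub> = \<zero>\<^bsub>N\<^esub> \<ominus>\<^bsub>N\<^esub> f x"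
        using q_zero[OF v(1) N.zero_closed v(2)] by blast
      have "f x = \<zero>\<^bsub>N\<^esub>" using x(1) N.diff_eq_zero[of "\<zero>\<^bsub>N\<^esub>" "f x"] x(3)[symmetric] by (simp add: sm(1))
      then have "x = \<zero>\<^bsub>M\<^esub>" using x(1) by (simp add: sm)
      with x(2) show ?thesis by (simp add: sm)
    qed
    show "\<exists>x\<in>carrier V. y = q (x, \<zero>\<^bsub>N\<^esub>)" if y: "y \<in> carrier P" "\<nu> y = \<zero>\<^bsub>C\<^esub>" for y
    proof -
      obtain v n where v: "v \<in> carrier V" "n \<in> carrier N" "y = q (v, n)"
        using ses_epi[OF q y(1)] by (auto simp: dsum_simps)
      then have "g n = \<zero>\<^bsub>C\<^esub>" using y(2) \<nu>(2)[of "(v, n)"] by (simp add: dsum_simps)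
      then obtain x where x: "x \<in> carrier M" "n = f x" using ses_exact[OF s v(2)] by blast
      have "q (v \<oplus>\<^bsub>V\<^esub> a x, \<zero>\<^bsub>N\<^esub>) = y" unfolding v(3) by (rule q_eq[OF _ _ _ _ x(1)]) (use x v in \<open>auto simp: sm\<close>)
      then show ?thesis using v x by (intro bexI[of _ "v \<oplus>\<^bsub>V\<^esub> a x"]) (auto simp: sm)
    qed
    show "\<exists>y\<in>carrier P. z = \<nu> y" if z: "z \<in> carrier C" for z
    proof -
      obtain n where "n \<in> carrier N" "z = g n" using ses_epi[OF s z] by blast
      then show ?thesis using mod_map_simps(1)[OF \<iota>] by (intro bexI[of _ "q (\<zero>\<^bsub>V\<^esub>, n)"]) (auto simp: \<nu>(2) dsum_simps)
    qed
  qed (simp add: \<nu>(2) dsum_simps sm)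
  ultimately show ?thesis by blast
qed

section \<open>Closure properties\<close>

text \<open>The vanishing of \<open>Ext\<close> is assumed in the form in which it is applied, see \<open>ext1_zero_Ext\<close>.\<close>

locale orthogonal_subcat =
  fixes R :: "('a, 'm) ring_scheme" and \<W> :: "('a, 'b) module set"
  assumes iso_closed: "iso_closed_subcat R \<W>" and additive: "additive_subcat R \<W>"
    and orthogonal: "\<And>V W. V \<in> \<W> \<Longrightarrow> W \<in> \<W> \<Longrightarrow> ext1_zero R V W"
begin

lemma W_module: "V \<in> \<W> \<Longrightarrow> module R V"
  using iso_closed by (simp add: iso_closed_subcat_def)

lemma resolvable_gorenstein:
  "M \<in> gorenstein R \<W> \<Longrightarrow> resolvable R \<W> (gorenstein R \<W> :: ('a, 'b) module set) M"
  by (rule gorenstein_resolvable[OF orthogonal])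

lemma gorenstein_left:
  "M \<in> gorenstein R \<W> \<Longrightarrow> \<exists>V \<in> \<W>. \<exists>K \<in> (gorenstein R \<W> :: ('a, 'b) module set). \<exists>j p. ses R K j V p M"
  by (drule resolvable_gorenstein) (simp add: resolvable_def)

lemma gorenstein_right:
  "M \<in> gorenstein R \<W> \<Longrightarrow> \<exists>V \<in> \<W>. \<exists>C \<in> (gorenstein R \<W> :: ('a, 'b) module set). \<exists>i q. ses R M i V q C"
  by (drule resolvable_gorenstein) (simp add: resolvable_def)

text \<open>\<open>M\<close> is the kernel of a map defined on a member of \<open>\<W>\<close>.\<close>

lemma gorenstein_realise:
  assumes "M \<in> gorenstein R \<W>"
  shows "\<exists>N :: ('a, 'b) module. N \<in> gorenstein R \<W> \<and> mod_iso R M N"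
proof -
  obtain V i q and C :: "('a, 'b) module" where s: "ses R M i V q C" "V \<in> \<W>"
    using gorenstein_right[OF assms] by blast
  have t: "ses R (ker_mod V C q) (\<lambda>x. x) V q C"
    by (rule ses_kernel[OF ses_maps(2)[OF s(1)]]) (rule ses_epi[OF s(1)])
  have "mod_iso R M (ker_mod V C q)" by (rule ses_same_epi_iso[OF s(1) t])
  from gorenstein_iso[OF assms ses_modules(1)[OF t] this] this show ?thesis by (intro exI conjI)
qed

text \<open>The class of extensions of Gorenstein modules over the carrier type of \<open>\<W>\<close> is closed under the steps of
resolution given by the horseshoe lemmas.\<close>

lemma gorenstein_extension:
  assumes s: "ses R A i B p C" and A: "A \<in> gorenstein R \<W>" and C: "C \<in> gorenstein R \<W>"
  shows "B \<in> gorenstein R \<W>"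
proof -
  let ?G = "gorenstein R \<W> :: ('a, 'b) module set"
  define \<P> where "\<P> = {E :: ('a, 'b) module. \<exists>A \<in> ?G. \<exists>C \<in> ?G. \<exists>i p. ses R A i E p C}"
  have step: "resolvable R \<W> \<P> B"
    if s: "ses R A i B p C" and rA: "resolvable R \<W> ?G A" and rC: "resolvable R \<W> ?G C"
    for A :: "('a, 'x) module" and B :: "('a, 'y) module" and C :: "('a, 'z) module" and i p
    unfolding resolvable_def
  proof (intro conjI ballI)
    obtain VA KA jA pA where A: "VA \<in> \<W>" "KA \<in> ?G" "ses R KA jA VA pA A" using rA unfolding resolvable_def by blast
    obtain VC KC jC pC where C: "VC \<in> \<W>" "KC \<in> ?G" "ses R KC jC VC pC C" using rC unfolding resolvable_def by blast
    have e: "ext1_zero R VC A" using rA C(1) by (simp add: resolvable_def)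
    obtain j \<pi> \<alpha> \<beta> and K :: "('a, 'b \<times> 'b) module" where K: "ses R K j (dsum_mod VA VC) \<pi> B" "ses R KA \<alpha> K \<beta> KC"
      using horseshoe_left[OF s A(3) C(3) e] by blast
    obtain V where V: "V \<in> \<W>" "mod_iso R (dsum_mod VA VC) V"
      using additive A(1) C(1) unfolding additive_subcat_def in_up_to_iso_def by blast
    obtain K' :: "('a, 'b) module" and j' p' where K': "ses R K' j' V p' B" "mod_iso R K K'"
      using ses_realise_kernel[OF K(1) W_module[OF V(1)] V(2)] by blast
    obtain f g where fg: "mod_map R K K' f" "mod_map R K' K g" "\<And>x. x \<in> carrier K \<Longrightarrow> g (f x) = x"
      "\<And>y. y \<in> carrier K' \<Longrightarrow> f (g y) = y" using mod_isoE[OF ses_modules(2)[OF K(2)] ses_modules(1)[OF K'(1)] K'(2)] by blast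
    have "K' \<in> \<P>" using ses_iso_middle[OF K(2) fg] A(2) C(2) unfolding \<P>_def by blast
    then show "\<exists>V\<in>\<W>. \<exists>K\<in>\<P>. \<exists>j p. ses R K j V p B" using V(1) K'(1) by blast
  next
    obtain VA QA a pA where A: "VA \<in> \<W>" "QA \<in> ?G" "ses R A a VA pA QA" using rA unfolding resolvable_def by blast
    obtain VC QC c pC where C: "VC \<in> \<W>" "QC \<in> ?G" "ses R C c VC pC QC" using rC unfolding resolvable_def by blast
    have e: "ext1_zero R C VA" using rC A(1) by (simp add: resolvable_def)
    obtain \<iota> q \<alpha> \<beta> and Q :: "('a, 'b \<times> 'b) module" where Q: "ses R B \<iota> (dsum_mod VA VC) q Q" "ses R QA \<alpha> Q \<beta> QC"
      using horseshoe_right[OF s A(3) C(3) e] by blast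
    obtain V where V: "V \<in> \<W>" "mod_iso R (dsum_mod VA VC) V"
      using additive A(1) C(1) unfolding additive_subcat_def in_up_to_iso_def by blast
    obtain Q' :: "('a, 'b) module" and i' q' where Q': "ses R B i' V q' Q'" "mod_iso R Q Q'"
      using ses_realise_cokernel[OF Q(1) W_module[OF V(1)] V(2)] by blast
    obtain f g where fg: "mod_map R Q Q' f" "mod_map R Q' Q g" "\<And>x. x \<in> carrier Q \<Longrightarrow> g (f x) = x"
      "\<And>y. y \<in> carrier Q' \<Longrightarrow> f (g y) = y" using mod_isoE[OF ses_modules(2)[OF Q(2)] ses_modules(3)[OF Q'(1)] Q'(2)] by blast
    have "Q' \<in> \<P>" using ses_iso_middle[OF Q(2) fg] A(2) C(2) unfolding \<P>_def by blast
    then show "\<exists>V\<in>\<W>. \<exists>C\<in>\<P>. \<exists>i q. ses R B i V q C" using V(1) Q'(1) by blast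
  next
    fix V assume V: "V \<in> \<W>"
    show "ext1_zero R V B" by (rule ext1_zero_extension_right[OF s]) (use rA rC V in \<open>auto simp: resolvable_def\<close>)
    show "ext1_zero R B V" by (rule ext1_zero_extension_left[OF s]) (use rA rC V in \<open>auto simp: resolvable_def\<close>)
  qed
  show ?thesis
  proof (rule gorenstein_coinduct)
    show "resolvable R \<W> \<P> B" by (rule step[OF s resolvable_gorenstein[OF A] resolvable_gorenstein[OF C]])
    show "resolvable R \<W> \<P> E" if "E \<in> \<P>" for E
    proof -
      obtain A C i p where t: "A \<in> ?G" "C \<in> ?G" "ses R A i E p C" using \<open>E \<in> \<P>\<close> unfolding \<P>_def by blast
      show ?thesis by (rule step[OF t(3) resolvable_gorenstein[OF t(1)] resolvable_gorenstein[OF t(2)]])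
    qed
  qed
qed

text \<open>The coinduction runs over the retracts of Gorenstein modules.  Let \<open>L\<close> be the kernel of \<open>V \<rightarrow> M \<rightarrow> A\<close>, or
the cokernel of \<open>A \<rightarrow> M \<rightarrow> V\<close>.  Then \<open>L \<oplus> A\<close> is an extension of Gorenstein modules, and \<open>L\<close> is a retract of it.\<close>

lemma gorenstein_retract:
  assumes r: "retract R A s r M" and M: "M \<in> gorenstein R \<W>"
  shows "A \<in> gorenstein R \<W>"
proof -
  let ?G = "gorenstein R \<W> :: ('a, 'b) module set"
  define \<S> where "\<S> = {A :: ('a, 'b) module. \<exists>M \<in> ?G. \<exists>s r. retract R A s r M}"
  have small: "B \<in> \<S>" if rB: "retract R B s r N" and N: "N \<in> gorenstein R \<W>"
    for B :: "('a, 'b) module" and N :: "('a, 'x) module" and s r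
  proof -
    obtain N' where N': "N' \<in> ?G" "mod_iso R N N'" using gorenstein_realise[OF N] by blast
    obtain s' r' where "retract R N s' r' N'"
      using mod_iso_retract[OF gorenstein_module[OF N] gorenstein_module[OF N'(1)] N'(2)] by blast
    from retract_trans[OF rB this] show ?thesis using N'(1) unfolding \<S>_def by blast
  qed
  have step: "resolvable R \<W> \<S> A"
    if r: "retract R A s r M" and M: "M \<in> gorenstein R \<W>"
    for A :: "('a, 'x) module" and M :: "('a, 'y) module" and s r
    unfolding resolvable_def
  proof (intro conjI ballI)
    have sm: "mod_map R A M s" and rm: "mod_map R M A r" and rs: "\<And>x. x \<in> carrier A \<Longrightarrow> r (s x) = x"
      using r by (auto simp: retract_def)
    interpret A: module R A using sm by (simp add: mod_map_def)
    interpret M: module R M using sm by (simp add: mod_map_def)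
    note rss = mod_map_simps[OF sm] mod_map_simps[OF rm]
    have rM: "resolvable R \<W> ?G M" by (rule resolvable_gorenstein[OF M])
    show "\<exists>V\<in>\<W>. \<exists>K\<in>\<S>. \<exists>j p. ses R K j V p A"
    proof -
      obtain V K j p where V: "V \<in> \<W>" and K: "K \<in> ?G" and t: "ses R K j V p M"
        using rM unfolding resolvable_def by blast
      interpret V: module R V using t by (simp add: ses_def)
      interpret K: module R K using t by (simp add: ses_def)
      note ts = ses_simps[OF t]
      let ?L = "ker_mod V A (\<lambda>v. r (p v))"
      have epi: "\<exists>v \<in> carrier V. a = r (p v)" if "a \<in> carrier A" for a
        using ses_epi[OF t, of "s a"] that rs[OF that] by (auto simp: rss)
      have u: "ses R ?L (\<lambda>x. x) V (\<lambda>v. r (p v)) A"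
        by (rule ses_kernel[OF mod_map_comp[OF ses_maps(2)[OF t] rm]]) (rule epi)
      interpret L: module R ?L using u by (simp add: ses_def)
      have "r (p (j k)) = \<zero>\<^bsub>A\<^esub>" if "k \<in> carrier K" for k using that by (simp add: ts rss)
      then obtain j' where j': "mod_map R K ?L j'" "\<And>k. k \<in> carrier K \<Longrightarrow> j' k = j k"
        using factor_through_kernel[OF u ses_maps(1)[OF t]] by blast
      have Lc: "x \<in> carrier ?L \<longleftrightarrow> x \<in> carrier V \<and> r (p x) = \<zero>\<^bsub>A\<^esub>" for x by (auto simp: ker_mod_simps)
      have "ses R K (\<lambda>k. (j' k, \<zero>\<^bsub>A\<^esub>)) (dsum_mod ?L A) (\<lambda>z. p (fst z) \<oplus>\<^bsub>M\<^esub> s (snd z)) M"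
      proof (rule sesI)
        show "mod_map R K (dsum_mod ?L A) (\<lambda>k. (j' k, \<zero>\<^bsub>A\<^esub>))"
          by (intro mod_map_pair j' mod_map_zero K.module_axioms A.module_axioms)
        show "mod_map R (dsum_mod ?L A) M (\<lambda>z. p (fst z) \<oplus>\<^bsub>M\<^esub> s (snd z))"
          by (rule mod_map_copair[OF mod_map_comp[OF ses_maps(1)[OF u] ses_maps(2)[OF t]] sm])
        show "x = \<zero>\<^bsub>K\<^esub>" if "x \<in> carrier K" "(j' x, \<zero>\<^bsub>A\<^esub>) = \<zero>\<^bsub>dsum_mod ?L A\<^esub>" for x
          using that by (simp add: dsum_simps j'(2) ker_mod_simps ts)
        show "p (fst (j' x, \<zero>\<^bsub>A\<^esub>)) \<oplus>\<^bsub>M\<^esub> s (snd (j' x, \<zero>\<^bsub>A\<^esub>)) = \<zero>\<^bsub>M\<^esub>" if "x \<in> carrier K" for x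
          using that by (simp add: j'(2) ts rss)
        show "\<exists>x\<in>carrier K. y = (j' x, \<zero>\<^bsub>A\<^esub>)"
          if y: "y \<in> carrier (dsum_mod ?L A)" "p (fst y) \<oplus>\<^bsub>M\<^esub> s (snd y) = \<zero>\<^bsub>M\<^esub>" for y
        proof -
          have yc: "fst y \<in> carrier V" "r (p (fst y)) = \<zero>\<^bsub>A\<^esub>" "snd y \<in> carrier A"
            using y(1) by (auto simp: dsum_simps Lc)
          then have "snd y = r (p (fst y) \<oplus>\<^bsub>M\<^esub> s (snd y))" by (simp add: rss ts rs)
          then have y0: "snd y = \<zero>\<^bsub>A\<^esub>" unfolding y(2) by (simp add: rss)
          then have "p (fst y) = \<zero>\<^bsub>M\<^esub>" using y(2) yc by (simp add: rss ts)
          from ses_exact[OF t yc(1) this] show ?thesis using y0 j'(2) by (auto simp: prod_eq_iff)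
        qed
        show "\<exists>y\<in>carrier (dsum_mod ?L A). m = p (fst y) \<oplus>\<^bsub>M\<^esub> s (snd y)" if m: "m \<in> carrier M" for m
        proof -
          obtain v where v: "v \<in> carrier V" "m \<ominus>\<^bsub>M\<^esub> s (r m) = p v"
            using ses_epi[OF t, of "m \<ominus>\<^bsub>M\<^esub> s (r m)"] m by (auto simp: rss)
          have "r (p v) = \<zero>\<^bsub>A\<^esub>" unfolding v(2)[symmetric] using m by (simp add: rss rs A.minus_self)
          moreover have "m = p v \<oplus>\<^bsub>M\<^esub> s (r m)" unfolding v(2)[symmetric] using m by (simp add: M.diff_add rss)
          ultimately show ?thesis using v(1) m by (intro bexI[of _ "(v, r m)"]) (simp_all add: dsum_simps Lc rss)
        qed
      qed
      from gorenstein_extension[OF this K M] have "dsum_mod ?L A \<in> gorenstein R \<W>" .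
      moreover have "retract R ?L (\<lambda>x. (x, \<zero>\<^bsub>A\<^esub>)) fst (dsum_mod ?L A)"
        unfolding retract_def
        by (auto intro!: mod_map_pair mod_map_id mod_map_zero mod_map_fst L.module_axioms A.module_axioms)
      ultimately have "?L \<in> \<S>" by (rule small[rotated])
      then show ?thesis using V u by blast
    qed
    show "\<exists>V\<in>\<W>. \<exists>C\<in>\<S>. \<exists>i q. ses R A i V q C"
    proof -
      obtain V C i q where V: "V \<in> \<W>" and C: "C \<in> ?G" and t: "ses R M i V q C"
        using rM unfolding resolvable_def by blast
      interpret V: module R V using t by (simp add: ses_def)
      note ts = ses_simps[OF t]
      have "x = \<zero>\<^bsub>A\<^esub>" if "x \<in> carrier A" "i (s x) = \<zero>\<^bsub>V\<^esub>" for x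
        using that rs[of x] by (simp add: ts rss)
      from ses_cokernel_ex[OF mod_map_comp[OF sm ses_maps(1)[OF t]] this]
      obtain L :: "('a, 'b) module" and q' where u: "ses R A (\<lambda>x. i (s x)) V q' L" by blast
      interpret L: module R L using u by (simp add: ses_def)
      note us = ses_simps[OF u]
      have "q (i (s x)) = \<zero>\<^bsub>C\<^esub>" if "x \<in> carrier A" for x using that by (simp add: ts rss)
      then obtain h where h: "mod_map R L C h" "\<And>v. v \<in> carrier V \<Longrightarrow> h (q' v) = q v"
        using factor_through_cokernel[OF u ses_maps(2)[OF t]] by blast
      have "ses R M (\<lambda>m. (q' (i m), r m)) (dsum_mod L A) (\<lambda>z. h (fst z)) C"
      proof (rule sesI)
        show "mod_map R M (dsum_mod L A) (\<lambda>m. (q' (i m), r m))"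
          by (intro mod_map_pair rm mod_map_comp[OF ses_maps(1)[OF t] ses_maps(2)[OF u]])
        show "mod_map R (dsum_mod L A) C (\<lambda>z. h (fst z))"
          by (intro mod_map_comp[OF mod_map_fst h(1)] L.module_axioms A.module_axioms)
        show "m = \<zero>\<^bsub>M\<^esub>" if m: "m \<in> carrier M" "(q' (i m), r m) = \<zero>\<^bsub>dsum_mod L A\<^esub>" for m
        proof -
          have m0: "q' (i m) = \<zero>\<^bsub>L\<^esub>" "r m = \<zero>\<^bsub>A\<^esub>" using m(2) by (simp_all add: dsum_simps)
          obtain a where a: "a \<in> carrier A" "i m = i (s a)" using ses_exact[OF u _ m0(1)] m(1) by (auto simp: ts)
          then have "m = s a" using m(1) by (simp add: ts rss)
          with m0(2) a(1) show ?thesis by (simp add: rs rss)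
        qed
        show "h (fst (q' (i m), r m)) = \<zero>\<^bsub>C\<^esub>" if "m \<in> carrier M" for m using that by (simp add: h(2) ts)
        show "\<exists>m\<in>carrier M. y = (q' (i m), r m)"
          if y: "y \<in> carrier (dsum_mod L A)" "h (fst y) = \<zero>\<^bsub>C\<^esub>" for y
        proof -
          have yc: "fst y \<in> carrier L" "snd y \<in> carrier A" using y(1) by (auto simp: dsum_simps)
          obtain v where v: "v \<in> carrier V" "fst y = q' v" using ses_epi[OF u yc(1)] by blast
          have "q v = \<zero>\<^bsub>C\<^esub>" using y(2) v h(2) by simp
          then obtain m where m: "m \<in> carrier M" "v = i m" using ses_exact[OF t v(1)] by blast
          (* correct the component of m in the summand A, which is invisible in L *)
          let ?m = "m \<ominus>\<^bsub>M\<^esub> s (r m) \<oplus>\<^bsub>M\<^esub> s (snd y)"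
          have "r ?m = snd y" using m yc by (simp add: rss rs A.minus_self)
          moreover have "q' (i (s a)) = \<zero>\<^bsub>L\<^esub>" if "a \<in> carrier A" for a using ses_comp[OF u that] .
          then have "q' (i ?m) = fst y" using m yc v us(7)[of "i m"]
            by (simp add: rss ts us a_minus_def)
          ultimately show ?thesis using m yc by (intro bexI[of _ ?m]) (simp_all add: rss prod_eq_iff)
        qed
        show "\<exists>y\<in>carrier (dsum_mod L A). z = h (fst y)" if z: "z \<in> carrier C" for z
        proof -
          obtain v where v: "v \<in> carrier V" "z = q v" using ses_epi[OF t z] by blast
          then show ?thesis by (intro bexI[of _ "(q' v, \<zero>\<^bsub>A\<^esub>)"]) (simp_all add: dsum_simps us h(2))
        qed
      qed
      from gorenstein_extension[OF this M C] have "dsum_mod L A \<in> gorenstein R \<W>" .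
      moreover have "retract R L (\<lambda>x. (x, \<zero>\<^bsub>A\<^esub>)) fst (dsum_mod L A)"
        unfolding retract_def
        by (auto intro!: mod_map_pair mod_map_id mod_map_zero mod_map_fst L.module_axioms A.module_axioms)
      ultimately have "L \<in> \<S>" by (rule small[rotated])
      then show ?thesis using V u by blast
    qed
    show "ext1_zero R V A" "ext1_zero R A V" if "V \<in> \<W>" for V
      using rM that ext1_zero_retract_left[OF r] ext1_zero_retract_right[OF r] by (auto simp: resolvable_def)
  qed
  show ?thesis
  proof (rule gorenstein_coinduct)
    show "resolvable R \<W> \<S> A" by (rule step[OF r M])
    show "resolvable R \<W> \<S> B" if "B \<in> \<S>" for B
    proof -
      obtain M s r where t: "M \<in> ?G" "retract R B s r M" using \<open>B \<in> \<S>\<close> unfolding \<S>_def by blast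
      show ?thesis by (rule step[OF t(2,1)])
    qed
  qed
qed

text \<open>Replace \<open>N\<close> by \<open>V \<in> \<W>\<close> through a pullback \<open>P\<close>.  A cover of \<open>P\<close> by \<open>U \<in> \<W>\<close> then maps onto \<open>V\<close> with kernel in
\<open>\<W>\<close>, so it splits by orthogonality, and \<open>P \<rightarrow> V\<close> splits with it.\<close>

lemma gorenstein_kernel:
  assumes W: "closed_ker_epi R \<W>" and s: "ses R K i M f N"
    and M: "M \<in> gorenstein R \<W>" and N: "N \<in> gorenstein R \<W>"
  shows "K \<in> gorenstein R \<W>"
proof -
  let ?G = "gorenstein R \<W> :: ('a, 'b) module set"
  obtain V N1 j p where V: "V \<in> \<W>" and N1: "N1 \<in> ?G" and t: "ses R N1 j V p N"
    using gorenstein_left[OF N] by blast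
  let ?P = "pullback M V N f p"
  have P: "?P \<in> gorenstein R \<W>"
    by (rule gorenstein_extension[OF ses_pullback_fst[OF t ses_maps(2)[OF s]] N1 M])
  have u: "ses R K (\<lambda>x. (i x, \<zero>\<^bsub>V\<^esub>)) ?P snd V" by (rule ses_pullback_snd[OF s ses_maps(2)[OF t]])
  obtain U K2 j2 \<pi> where U: "U \<in> \<W>" and v: "ses R (K2 :: ('a, 'b) module) j2 U \<pi> ?P"
    using gorenstein_left[OF P] by blast
  have m: "mod_map R U V (\<lambda>x. snd (\<pi> x))" by (rule mod_map_comp[OF ses_maps(2)[OF v] ses_maps(2)[OF u]])
  let ?L = "ker_mod U V (\<lambda>x. snd (\<pi> x))"
  have w: "ses R ?L (\<lambda>x. x) U (\<lambda>x. snd (\<pi> x)) V"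
  proof (rule ses_kernel[OF m])
    fix z assume "z \<in> carrier V"
    then obtain y where y: "y \<in> carrier ?P" "z = snd y" using ses_epi[OF u] by blast
    obtain x where "x \<in> carrier U" "y = \<pi> x" using ses_epi[OF v y(1)] by blast
    with y show "\<exists>x\<in>carrier U. z = snd (\<pi> x)" by blast
  qed
  have "?L \<in> \<W>" using W U V w unfolding closed_ker_epi_def ses_def short_exact_def by blast
  from ext1_zero_lift[OF orthogonal[OF V this] w mod_map_id[OF W_module[OF V]]]
  obtain \<tau> where \<tau>: "mod_map R V U \<tau>" "\<And>x. x \<in> carrier V \<Longrightarrow> snd (\<pi> (\<tau> x)) = x" by blast
  obtain r where "retract R K (\<lambda>x. (i x, \<zero>\<^bsub>V\<^esub>)) r ?P"
    using ses_section_retract[OF u mod_map_comp[OF \<tau>(1) ses_maps(2)[OF v]]] \<tau>(2) by blast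
  then show ?thesis using P by (rule gorenstein_retract)
qed

text \<open>Replace \<open>M\<close> by \<open>V \<in> \<W>\<close> through a pushout \<open>P\<close>.  The composite of \<open>V \<rightarrow> P\<close> with an embedding of \<open>P\<close> into
\<open>U \<in> \<W>\<close> has cokernel in \<open>\<W>\<close>, so it splits, and \<open>V \<rightarrow> P\<close> splits with it.\<close>

lemma gorenstein_cokernel:
  fixes N :: "('a, 'n) module"
  assumes W: "closed_coker_mono R \<W>" and s: "ses R M f N g C"
    and M: "M \<in> gorenstein R \<W>" and N: "N \<in> gorenstein R \<W>"
  shows "C \<in> gorenstein R \<W>"
proof -
  obtain V M1 a c where V: "V \<in> \<W>" and M1: "M1 \<in> (gorenstein R \<W> :: ('a, 'b) module set)" and t: "ses R M a V c M1"
    using gorenstein_right[OF M] by blast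
  obtain \<iota> \<kappa> \<mu> \<nu> and P :: "('a, 'b \<times> 'n) module" where P1: "ses R N \<iota> P \<kappa> M1" and P2: "ses R V \<mu> P \<nu> C"
    using pushout[OF s t] by blast
  have P: "P \<in> gorenstein R \<W>" by (rule gorenstein_extension[OF P1 N M1])
  obtain U e \<epsilon> and E :: "('a, 'b) module" where U: "U \<in> \<W>" and v: "ses R P e U \<epsilon> E"
    using gorenstein_right[OF P] by blast
  have m: "mod_map R V U (\<lambda>x. e (\<mu> x))" by (rule mod_map_comp[OF ses_maps(1)[OF P2] ses_maps(1)[OF v]])
  have "x = \<zero>\<^bsub>V\<^esub>" if "x \<in> carrier V" "e (\<mu> x) = \<zero>\<^bsub>U\<^esub>" for x
    using that by (simp add: ses_simps[OF P2] ses_simps[OF v])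
  from ses_cokernel_ex[OF m this] obtain Q :: "('a, 'b) module" and q where w: "ses R V (\<lambda>x. e (\<mu> x)) U q Q" by blast
  have "mod_iso R Q (coker_mod V U (\<lambda>x. e (\<mu> x)))" by (rule ses_coker_iso[OF w refl])
  moreover have "in_up_to_iso R \<W> (coker_mod V U (\<lambda>x. e (\<mu> x)))"
    using W U V w unfolding closed_coker_mono_def ses_def short_exact_def by blast
  ultimately obtain L where L: "L \<in> \<W>" "mod_iso R Q L" unfolding in_up_to_iso_def using mod_iso_trans by blast
  have "Q \<in> \<W>"
    using iso_closed L mod_iso_sym[OF ses_modules(3)[OF w] L(2)] ses_modules(3)[OF w] unfolding iso_closed_subcat_def by blast
  from ext1_zero_extend[OF orthogonal[OF this V] w mod_map_id[OF W_module[OF V]]]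
  obtain \<rho> where \<rho>: "mod_map R U V \<rho>" "\<And>x. x \<in> carrier V \<Longrightarrow> \<rho> (e (\<mu> x)) = x" by blast
  obtain s' where "retract R C s' \<nu> P"
    using ses_retraction_retract[OF P2 mod_map_comp[OF ses_maps(1)[OF v] \<rho>(1)]] \<rho>(2) by blast
  then show ?thesis using P by (rule gorenstein_retract)
qed

end

theorem theorem2:
  fixes R :: "('a, 'm) ring_scheme" and \<W> :: "('a, 'b) module set"
  assumes "cring R"
    and "iso_closed_subcat R \<W>"
    and "additive_subcat R \<W>"
    and "\<And>W W' i. W \<in> \<W> \<Longrightarrow> W' \<in> \<W> \<Longrightarrow> i \<ge> 1 \<Longrightarrow>
           carrier (Ext R i W W') = {\<zero>\<^bsub>Ext R i W W'\<^esub>}"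
  shows "exact_subcat R (gorenstein R \<W> :: ('a, 'c) module set) \<and>
    (closed_ker_epi R \<W> \<longrightarrow> closed_ker_epi R (gorenstein R \<W> :: ('a, 'c) module set)) \<and>
    (closed_coker_mono R \<W> \<longrightarrow> closed_coker_mono R (gorenstein R \<W> :: ('a, 'c) module set))"
proof (intro conjI impI)
  have Wm: "module R V" if "V \<in> \<W>" for V using assms(2) that by (simp add: iso_closed_subcat_def)
  interpret orthogonal_subcat R \<W>
    by unfold_locales (use assms ext1_zero_Ext[OF Wm Wm] in auto)
  let ?G = "gorenstein R \<W> :: ('a, 'c) module set"
  have "closed_summands R ?G"
    unfolding closed_summands_def
  proof (intro ballI allI impI)
    fix M M' M'' :: "('a, 'c) module"
    assume M: "M \<in> ?G" and M': "module R M'" "module R M''" and iso: "mod_iso R M (dsum_mod M' M'')"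
    have "retract R M' (\<lambda>x. (x, \<zero>\<^bsub>M''\<^esub>)) fst (dsum_mod M' M'')"
      unfolding retract_def by (auto intro!: mod_map_pair mod_map_id mod_map_zero mod_map_fst M')
    then show "M' \<in> ?G" by (rule gorenstein_retract) (rule gorenstein_iso[OF M dsum_module[OF M'] iso])
  qed
  moreover have "closed_extensions R ?G"
    unfolding closed_extensions_def
  proof (intro ballI allI impI)
    fix M' M'' M :: "('a, 'c) module" and f g
    assume M': "M' \<in> ?G" and M'': "M'' \<in> ?G" and "module R M" "short_exact R M' f M g M''"
    then have "ses R M' f M g M''" by (simp add: ses_def gorenstein_module)
    then show "M \<in> ?G" using M' M'' by (rule gorenstein_extension)
  qed
  ultimately show "exact_subcat R ?G" by (simp add: exact_subcat_def)
  show "closed_ker_epi R ?G" if W: "closed_ker_epi R \<W>"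
    unfolding closed_ker_epi_def
  proof (intro ballI impI)
    fix M N :: "('a, 'c) module" and f
    assume M: "M \<in> ?G" and N: "N \<in> ?G" and f: "f \<in> mod_hom R M N" "f ` carrier M = carrier N"
    have "mod_map R M N f" using f(1) M N by (simp add: mod_map_def gorenstein_module)
    then have "ses R (ker_mod M N f) (\<lambda>x. x) M f N" by (rule ses_kernel) (use f(2) in blast)
    then show "ker_mod M N f \<in> ?G" by (rule gorenstein_kernel[OF W _ M N])
  qed
  show "closed_coker_mono R ?G" if W: "closed_coker_mono R \<W>"
    unfolding closed_coker_mono_def
  proof (intro ballI impI)
    fix M N :: "('a, 'c) module" and f
    assume M: "M \<in> ?G" and N: "N \<in> ?G" and f: "f \<in> mod_hom R M N" "inj_on f (carrier M)"
    interpret M: module R M by (rule gorenstein_module[OF M])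
    have fm: "mod_map R M N f" using f(1) M N by (simp add: mod_map_def gorenstein_module)
    have "x = \<zero>\<^bsub>M\<^esub>" if "x \<in> carrier M" "f x = \<zero>\<^bsub>N\<^esub>" for x
      using f(2) that mod_map_simps(4)[OF fm] by (auto dest: inj_onD[where y = "\<zero>\<^bsub>M\<^esub>"])
    from ses_cokernel_ex[OF fm this] obtain C :: "('a, 'c) module" and g where s: "ses R M f N g C" by blast
    have "mod_iso R (coker_mod M N f) C"
      by (rule mod_iso_sym[OF ses_modules(3)[OF s] ses_coker_iso[OF s refl]])
    then show "in_up_to_iso R ?G (coker_mod M N f)"
      using gorenstein_cokernel[OF W s M N] by (auto simp: in_up_to_iso_def)
  qed
qed

end
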